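(* Let $\mathcal C$ be a small half-balanced braided monoidal category, let $\langle-\rangle:\mathcal C\to\mathcal O$ be a half-balanced contraction, let $X\in\mathrm{Ob}\,\mathcal C$ and $n\ge2$. Then there is a commutative diagram of groups $$\begin{matrix}B_n&\leftarrow&\tilde B_n&\to&\mathrm{Aut}_{\mathcal C}(X^{\otimes n})\\ \downarrow&&\downarrow&&\downarrow\langle-\rangle\\ \Gamma_{0,n}&\leftarrow&\tilde\Gamma_{0,n}&\to&\mathrm{Aut}_{\mathcal O}(\langle X^{\otimes n}\rangle)\end{matrix}$$ in which the left and middle vertical maps are the projections, the left horizontal maps are the projections (killing the generators $\delta_i$), and the upper right map is the canonical representation of $\tilde B_n$. In other words, the composite $\tilde B_n\to\mathrm{Aut}_{\mathcal C}(X^{\otimes n})\to\mathrm{Aut}_{\mathcal O}(\langle X^{\otimes n}\rangle)$ factors through $\tilde\Gamma_{0,n}$.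
   Context: A braided monoidal category (b.m.c.) has associativity constraints $a_{XYZ}:(X\otimes Y)\otimes Z\to X\otimes(Y\otimes Z)$ and a braiding $\beta_{XY}:X\otimes Y\to Y\otimes X$ satisfying the usual axioms. A balanced structure is a natural assignment $X\mapsto\theta_X\in\mathrm{Aut}_{\mathcal C}(X)$ with $\theta_{X\otimes Y}=(\theta_X\otimes\theta_Y)\beta_{YX}\beta_{XY}$. A half-balanced structure on $\mathcal C$ is: (a) an involutive autofunctor $*:X\mapsto X^*$ with $(X\otimes Y)^*=Y^*\otimes X^*$, $(f\otimes g)^*=g^*\otimes f^*$, $\beta_{XY}^*=\beta_{Y^*X^*}$, $a_{XYZ}^*=a_{Z^*Y^*X^*}^{-1}$; (b) a natural assignment $X\mapsto a_X\in\mathrm{Iso}_{\mathcal C}(X,X^* )$ (naturality: $a_Y\phi=\phi^*a_X$ for $\phi:X\to Y$) with $a_X^*=a_{X^*}$ and $a_{X\otimes Y}=(a_Y\otimes a_X)\beta_{XY}$. It gives rise to a balanced structure $\theta_X:=a_{X^*}a_X$. A balanced contraction on a balanced b.m.c. is a functor $\langle-\rangle:\mathcal C\to\mathcal O$ to a category such that: (1) $\langle Y\otimes X\rangle=\langle X\otimes Y\rangle$ $(=:\langle X,Y\rangle)$ and $\langle(\theta_Y\otimes\mathrm{id}_X)\beta_{XY}\rangle=\mathrm{id}_{\langle X,Y\rangle}$; (2) $\langle(X\otimes Y)\otimes Z\rangle=\langle X\otimes(Y\otimes Z)\rangle$ and $\langle a_{XYZ}\rangle$ is the identity. A half-balanced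 contraction on a half-balanced b.m.c. is a balanced contraction such that moreover $\langle X\rangle=\langle X^*\rangle$ and $\langle a_X\rangle=\mathrm{id}_{\langle X\rangle}$ for all $X$. $B_n$ is the braid group with generators $\sigma_1,\dots,\sigma_{n-1}$; $B_n\to S_n$, $\sigma_i\mapsto(i,i+1)$; $z_n:=(\sigma_1\cdots\sigma_{n-1})^n$; $\Gamma_{0,n}:=B_n/(z_n,\ \sigma_1\cdots\sigma_{n-1}^2\cdots\sigma_1)$. $\tilde B_n:=\mathbb Z^n\rtimes B_n$, where $B_n$ acts on $\mathbb Z^n$ through $S_n$; $\delta_i$ is the $i$-th generator of $\mathbb Z^n$ (written multiplicatively). $\tilde\Gamma_{0,n}$ is the quotient of $\tilde B_n$ by the normal subgroup generated by $(\prod_{i=1}^n\delta_i)z_n$ and $\delta_1^2\sigma_1\cdots\sigma_{n-1}^2\cdots\sigma_1$. Fix a parenthesization of $X^{\otimes n}$. The canonical representation $\tilde B_n\to\mathrm{Aut}_{\mathcal C}(X^{\otimes n})$ is given (up to inserting associativity constraints) by $\delta_i\mapsto\mathrm{id}_{X^{\otimes i-1}}\otimes\theta_X\otimes\mathrm{id}_{X^{\otimes n-i}}$, $\sigma_i\mapsto\mathrm{id}_{X^{\otimes i-1}}\otimes\beta_{X,X}\otimes\mathrm{id}_{X^{\otimes n-i-1}}$. *)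

theory Defs
  imports "HOL-Algebra.Product_Groups" "HOL-Combinatorics.Transposition"
begin

section \<open>Categories and functors\<close>

record ('o, 'a) cat =
  Obj :: "'o set"
  Arr :: "'a set"
  Dom :: "'a \<Rightarrow> 'o"
  Cod :: "'a \<Rightarrow> 'o"
  Ident :: "'o \<Rightarrow> 'a"
  Compose :: "'a \<Rightarrow> 'a \<Rightarrow> 'a"  (infixl \<open>\<cdot>\<index>\<close> 55)

text \<open>\<open>g \<cdot> f\<close> is ``\<open>f\<close> first, then \<open>g\<close>''. Objects and arrows form sets, so every category below is small.\<close>

definition Hom :: "('o, 'a, 'c) cat_scheme \<Rightarrow> 'o \<Rightarrow> 'o \<Rightarrow> 'a set" where
  "Hom C A B = {f \<in> Arr C. Dom C f = A \<and> Cod C f = B}"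

definition inverse_arrows :: "('o, 'a, 'c) cat_scheme \<Rightarrow> 'a \<Rightarrow> 'a \<Rightarrow> bool" where
  "inverse_arrows C f g \<longleftrightarrow>
     g \<in> Hom C (Cod C f) (Dom C f) \<and>
     g \<cdot>\<^bsub>C\<^esub> f = Ident C (Dom C f) \<and> f \<cdot>\<^bsub>C\<^esub> g = Ident C (Cod C f)"

definition Iso :: "('o, 'a, 'c) cat_scheme \<Rightarrow> 'o \<Rightarrow> 'o \<Rightarrow> 'a set" where
  "Iso C A B = {f \<in> Hom C A B. \<exists>g. inverse_arrows C f g}"

definition inv_arrow :: "('o, 'a, 'c) cat_scheme \<Rightarrow> 'a \<Rightarrow> 'a" where
  "inv_arrow C f = (THE g. inverse_arrows C f g)"

definition Aut :: "('o, 'a, 'c) cat_scheme \<Rightarrow> 'o \<Rightarrow> 'a monoid" where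
  "Aut C A = \<lparr>carrier = Iso C A A, monoid.mult = Compose C, one = Ident C A\<rparr>"

locale category =
  fixes C :: "('o, 'a, 'c) cat_scheme" (structure)
  assumes dom_obj: "f \<in> Arr C \<Longrightarrow> Dom C f \<in> Obj C"
    and cod_obj: "f \<in> Arr C \<Longrightarrow> Cod C f \<in> Obj C"
    and ident_hom: "A \<in> Obj C \<Longrightarrow> Ident C A \<in> Hom C A A"
    and comp_hom: "f \<in> Hom C A B \<Longrightarrow> g \<in> Hom C B D \<Longrightarrow> g \<cdot> f \<in> Hom C A D"
    and comp_ident_left: "f \<in> Hom C A B \<Longrightarrow> Ident C B \<cdot> f = f"
    and comp_ident_right: "f \<in> Hom C A B \<Longrightarrow> f \<cdot> Ident C A = f"
    and comp_assoc: "f \<in> Hom C A B \<Longrightarrow> g \<in> Hom C B D \<Longrightarrow> h \<in> Hom C D E \<Longrightarrow>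
      (h \<cdot> g) \<cdot> f = h \<cdot> (g \<cdot> f)"

locale cat_functor = C: category C + D: category D
  for C :: "('o, 'a, 'c) cat_scheme" and D :: "('p, 'b, 'd) cat_scheme" +
  fixes Fo :: "'o \<Rightarrow> 'p" and Fa :: "'a \<Rightarrow> 'b"
  assumes functor_obj: "A \<in> Obj C \<Longrightarrow> Fo A \<in> Obj D"
    and functor_hom: "f \<in> Hom C A B \<Longrightarrow> Fa f \<in> Hom D (Fo A) (Fo B)"
    and functor_ident: "A \<in> Obj C \<Longrightarrow> Fa (Ident C A) = Ident D (Fo A)"
    and functor_comp: "f \<in> Hom C A B \<Longrightarrow> g \<in> Hom C B E \<Longrightarrow>
      Fa (g \<cdot>\<^bsub>C\<^esub> f) = Fa g \<cdot>\<^bsub>D\<^esub> Fa f"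


section \<open>Braided monoidal, balanced and half-balanced categories\<close>

record ('o, 'a) bmcat = "('o, 'a) cat" +
  tensor_obj :: "'o \<Rightarrow> 'o \<Rightarrow> 'o"  (infixr \<open>\<boxdot>\<index>\<close> 65)
  tensor_arr :: "'a \<Rightarrow> 'a \<Rightarrow> 'a"  (infixr \<open>\<boxtimes>\<index>\<close> 65)
  unit_obj :: 'o
  associator :: "'o \<Rightarrow> 'o \<Rightarrow> 'o \<Rightarrow> 'a"
  lunitor :: "'o \<Rightarrow> 'a"
  runitor :: "'o \<Rightarrow> 'a"
  braiding :: "'o \<Rightarrow> 'o \<Rightarrow> 'a"

locale monoidal_category = category C
  for C :: "('o, 'a, 'c) bmcat_scheme" (structure) +
  assumes tensor_obj: "X \<in> Obj C \<Longrightarrow> Y \<in> Obj C \<Longrightarrow> X \<boxdot> Y \<in> Obj C"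
    and tensor_hom: "f \<in> Hom C X X' \<Longrightarrow> g \<in> Hom C Y Y' \<Longrightarrow>
      f \<boxtimes> g \<in> Hom C (X \<boxdot> Y) (X' \<boxdot> Y')"
    and tensor_ident: "X \<in> Obj C \<Longrightarrow> Y \<in> Obj C \<Longrightarrow>
      Ident C X \<boxtimes> Ident C Y = Ident C (X \<boxdot> Y)"
    and tensor_comp: "f \<in> Hom C X X' \<Longrightarrow> f' \<in> Hom C X' X'' \<Longrightarrow>
      g \<in> Hom C Y Y' \<Longrightarrow> g' \<in> Hom C Y' Y'' \<Longrightarrow>
      (f' \<cdot> f) \<boxtimes> (g' \<cdot> g) = (f' \<boxtimes> g') \<cdot> (f \<boxtimes> g)"
    and unit_obj: "unit_obj C \<in> Obj C"
    and associator_iso: "X \<in> Obj C \<Longrightarrow> Y \<in> Obj C \<Longrightarrow> Z \<in> Obj C \<Longrightarrow>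
      associator C X Y Z \<in> Iso C ((X \<boxdot> Y) \<boxdot> Z) (X \<boxdot> (Y \<boxdot> Z))"
    and associator_natural: "f \<in> Hom C X X' \<Longrightarrow> g \<in> Hom C Y Y' \<Longrightarrow> h \<in> Hom C Z Z' \<Longrightarrow>
      associator C X' Y' Z' \<cdot> ((f \<boxtimes> g) \<boxtimes> h) = (f \<boxtimes> (g \<boxtimes> h)) \<cdot> associator C X Y Z"
    and lunitor_iso: "X \<in> Obj C \<Longrightarrow> lunitor C X \<in> Iso C (unit_obj C \<boxdot> X) X"
    and lunitor_natural: "f \<in> Hom C X X' \<Longrightarrow>
      lunitor C X' \<cdot> (Ident C (unit_obj C) \<boxtimes> f) = f \<cdot> lunitor C X"
    and runitor_iso: "X \<in> Obj C \<Longrightarrow> runitor C X \<in> Iso C (X \<boxdot> unit_obj C) X"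
    and runitor_natural: "f \<in> Hom C X X' \<Longrightarrow>
      runitor C X' \<cdot> (f \<boxtimes> Ident C (unit_obj C)) = f \<cdot> runitor C X"
    and pentagon: "W \<in> Obj C \<Longrightarrow> X \<in> Obj C \<Longrightarrow> Y \<in> Obj C \<Longrightarrow> Z \<in> Obj C \<Longrightarrow>
      (Ident C W \<boxtimes> associator C X Y Z) \<cdot>
        (associator C W (X \<boxdot> Y) Z \<cdot> (associator C W X Y \<boxtimes> Ident C Z))
      = associator C W X (Y \<boxdot> Z) \<cdot> associator C (W \<boxdot> X) Y Z"
    and triangle: "X \<in> Obj C \<Longrightarrow> Y \<in> Obj C \<Longrightarrow>
      (Ident C X \<boxtimes> lunitor C Y) \<cdot> associator C X (unit_obj C) Y
      = runitor C X \<boxtimes> Ident C Y"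

locale braided_monoidal_category = monoidal_category C
  for C :: "('o, 'a, 'c) bmcat_scheme" (structure) +
  assumes braiding_iso: "X \<in> Obj C \<Longrightarrow> Y \<in> Obj C \<Longrightarrow>
      braiding C X Y \<in> Iso C (X \<boxdot> Y) (Y \<boxdot> X)"
    and braiding_natural: "f \<in> Hom C X X' \<Longrightarrow> g \<in> Hom C Y Y' \<Longrightarrow>
      braiding C X' Y' \<cdot> (f \<boxtimes> g) = (g \<boxtimes> f) \<cdot> braiding C X Y"
    and hexagon_right: "X \<in> Obj C \<Longrightarrow> Y \<in> Obj C \<Longrightarrow> Z \<in> Obj C \<Longrightarrow>
      associator C Y Z X \<cdot> (braiding C X (Y \<boxdot> Z) \<cdot> associator C X Y Z)
      = (Ident C Y \<boxtimes> braiding C X Z) \<cdot>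
          (associator C Y X Z \<cdot> (braiding C X Y \<boxtimes> Ident C Z))"
    and hexagon_left: "X \<in> Obj C \<Longrightarrow> Y \<in> Obj C \<Longrightarrow> Z \<in> Obj C \<Longrightarrow>
      inv_arrow C (associator C Z X Y) \<cdot>
        (braiding C (X \<boxdot> Y) Z \<cdot> inv_arrow C (associator C X Y Z))
      = (braiding C X Z \<boxtimes> Ident C Y) \<cdot>
          (inv_arrow C (associator C X Z Y) \<cdot> (Ident C X \<boxtimes> braiding C Y Z))"

locale balanced_category = braided_monoidal_category C
  for C :: "('o, 'a, 'c) bmcat_scheme" (structure) +
  fixes \<theta> :: "'o \<Rightarrow> 'a"
  assumes twist_iso: "X \<in> Obj C \<Longrightarrow> \<theta> X \<in> Iso C X X"
    and twist_natural: "f \<in> Hom C X Y \<Longrightarrow> \<theta> Y \<cdot> f = f \<cdot> \<theta> X"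
    and twist_tensor: "X \<in> Obj C \<Longrightarrow> Y \<in> Obj C \<Longrightarrow>
      \<theta> (X \<boxdot> Y) = (\<theta> X \<boxtimes> \<theta> Y) \<cdot> (braiding C Y X \<cdot> braiding C X Y)"

record ('o, 'a) hbmcat = "('o, 'a) bmcat" +
  star_obj :: "'o \<Rightarrow> 'o"
  star_arr :: "'a \<Rightarrow> 'a"
  half_twist :: "'o \<Rightarrow> 'a"

definition twist :: "('o, 'a, 'c) hbmcat_scheme \<Rightarrow> 'o \<Rightarrow> 'a" where
  "twist C X = half_twist C (star_obj C X) \<cdot>\<^bsub>C\<^esub> half_twist C X"

locale half_balanced_category =
  braided_monoidal_category C + star: cat_functor C C "star_obj C" "star_arr C"
  for C :: "('o, 'a, 'c) hbmcat_scheme" (structure) +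
  assumes star_obj_involutive: "X \<in> Obj C \<Longrightarrow> star_obj C (star_obj C X) = X"
    and star_arr_involutive: "f \<in> Arr C \<Longrightarrow> star_arr C (star_arr C f) = f"
    and star_tensor_obj: "X \<in> Obj C \<Longrightarrow> Y \<in> Obj C \<Longrightarrow>
      star_obj C (X \<boxdot> Y) = star_obj C Y \<boxdot> star_obj C X"
    and star_tensor_arr: "f \<in> Arr C \<Longrightarrow> g \<in> Arr C \<Longrightarrow>
      star_arr C (f \<boxtimes> g) = star_arr C g \<boxtimes> star_arr C f"
    and star_braiding: "X \<in> Obj C \<Longrightarrow> Y \<in> Obj C \<Longrightarrow>
      star_arr C (braiding C X Y) = braiding C (star_obj C Y) (star_obj C X)"
    and star_associator: "X \<in> Obj C \<Longrightarrow> Y \<in> Obj C \<Longrightarrow> Z \<in> Obj C \<Longrightarrow>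
      star_arr C (associator C X Y Z)
      = inv_arrow C (associator C (star_obj C Z) (star_obj C Y) (star_obj C X))"
    and half_twist_iso: "X \<in> Obj C \<Longrightarrow> half_twist C X \<in> Iso C X (star_obj C X)"
    and half_twist_natural: "f \<in> Hom C X Y \<Longrightarrow>
      half_twist C Y \<cdot> f = star_arr C f \<cdot> half_twist C X"
    and star_half_twist: "X \<in> Obj C \<Longrightarrow>
      star_arr C (half_twist C X) = half_twist C (star_obj C X)"
    and half_twist_tensor: "X \<in> Obj C \<Longrightarrow> Y \<in> Obj C \<Longrightarrow>
      half_twist C (X \<boxdot> Y) = (half_twist C Y \<boxtimes> half_twist C X) \<cdot> braiding C X Y"

lemma (in category) iso_comp:
  assumes "f \<in> Iso C A B" and "g \<in> Iso C B D"
  shows "g \<cdot> f \<in> Iso C A D"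
proof -
  obtain f' where f': "f' \<in> Hom C B A" "f' \<cdot> f = Ident C A" "f \<cdot> f' = Ident C B"
    and f: "f \<in> Hom C A B"
    using assms(1) by (auto simp: Iso_def inverse_arrows_def Hom_def)
  obtain g' where g': "g' \<in> Hom C D B" "g' \<cdot> g = Ident C B" "g \<cdot> g' = Ident C D"
    and g: "g \<in> Hom C B D"
    using assms(2) by (auto simp: Iso_def inverse_arrows_def Hom_def)
  have gf: "g \<cdot> f \<in> Hom C A D" and fg': "f' \<cdot> g' \<in> Hom C D A"
    by (rule comp_hom[OF f g], rule comp_hom[OF g'(1) f'(1)])
  have "(f' \<cdot> g') \<cdot> (g \<cdot> f) = f' \<cdot> ((g' \<cdot> g) \<cdot> f)"
    by (simp only: comp_assoc[OF gf g'(1) f'(1)] comp_assoc[OF f g g'(1)])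
  then have 1: "(f' \<cdot> g') \<cdot> (g \<cdot> f) = Ident C A"
    by (simp only: g'(2) comp_ident_left[OF f] f'(2))
  have "(g \<cdot> f) \<cdot> (f' \<cdot> g') = g \<cdot> ((f \<cdot> f') \<cdot> g')"
    by (simp only: comp_assoc[OF fg' f g] comp_assoc[OF g'(1) f'(1) f])
  then have 2: "(g \<cdot> f) \<cdot> (f' \<cdot> g') = Ident C D"
    by (simp only: f'(3) comp_ident_left[OF g'(1)] g'(3))
  have "inverse_arrows C (g \<cdot> f) (f' \<cdot> g')"
    unfolding inverse_arrows_def using 1 2 gf fg' by (auto simp: Hom_def)
  then show ?thesis
    unfolding Iso_def using gf by blast
qed

lemma (in half_balanced_category) balanced: "balanced_category C (twist C)"
proof
  fix X assume X: "X \<in> Obj C"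
  have "half_twist C (star_obj C X) \<in> Iso C (star_obj C X) X"
    using half_twist_iso[OF star.functor_obj[OF X]] by (simp add: star_obj_involutive X)
  then show "twist C X \<in> Iso C X X"
    unfolding twist_def using iso_comp half_twist_iso[OF X] by blast
next
  fix f X Y assume f: "f \<in> Hom C X Y"
  then have XY: "X \<in> Obj C" "Y \<in> Obj C" and arr: "f \<in> Arr C"
    using dom_obj cod_obj by (auto simp: Hom_def)
  have sf: "star_arr C f \<in> Hom C (star_obj C X) (star_obj C Y)"
    using f by (rule star.functor_hom)
  have h: "half_twist C Z \<in> Hom C Z (star_obj C Z)" if "Z \<in> Obj C" for Z
    using half_twist_iso[OF that] by (simp add: Iso_def)
  have h': "half_twist C (star_obj C Z) \<in> Hom C (star_obj C Z) Z" if "Z \<in> Obj C" for Z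
    using h[OF star.functor_obj[OF that]] by (simp add: star_obj_involutive that)
  have "twist C Y \<cdot> f = half_twist C (star_obj C Y) \<cdot> (half_twist C Y \<cdot> f)"
    unfolding twist_def using comp_assoc[OF f h h'] XY by blast
  also have "\<dots> = half_twist C (star_obj C Y) \<cdot> (star_arr C f \<cdot> half_twist C X)"
    by (simp only: half_twist_natural[OF f])
  also have "\<dots> = (half_twist C (star_obj C Y) \<cdot> star_arr C f) \<cdot> half_twist C X"
    using comp_assoc[OF h sf h'] XY by simp
  also have "\<dots> = (f \<cdot> half_twist C (star_obj C X)) \<cdot> half_twist C X"
    by (simp add: half_twist_natural[OF sf] star_arr_involutive arr)
  also have "\<dots> = f \<cdot> twist C X"
    unfolding twist_def using comp_assoc[OF h h' f] XY by blast
  finally show "twist C Y \<cdot> f = f \<cdot> twist C X" .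
next
  fix X Y assume X: "X \<in> Obj C" and Y: "Y \<in> Obj C"
  let ?s = "star_obj C" and ?h = "half_twist C" and ?b = "braiding C"
  have h: "?h Z \<in> Hom C Z (?s Z)" if "Z \<in> Obj C" for Z
    using half_twist_iso[OF that] by (simp add: Iso_def)
  have h': "?h (?s Z) \<in> Hom C (?s Z) Z" if "Z \<in> Obj C" for Z
    using h[OF star.functor_obj[OF that]] by (simp add: star_obj_involutive that)
  have b: "?b Z W \<in> Hom C (Z \<boxdot> W) (W \<boxdot> Z)" if "Z \<in> Obj C" "W \<in> Obj C" for Z W
    using braiding_iso[OF that] by (simp add: Iso_def)
  note sX = star.functor_obj[OF X] and sY = star.functor_obj[OF Y]
  note t1 = tensor_hom[OF h[OF Y] h[OF X]] and t2 = tensor_hom[OF h'[OF X] h'[OF Y]]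
  note t3 = tensor_hom[OF h[OF X] h[OF Y]]
  have "twist C (X \<boxdot> Y) =
      ((?h (?s X) \<boxtimes> ?h (?s Y)) \<cdot> ?b (?s Y) (?s X)) \<cdot> ((?h Y \<boxtimes> ?h X) \<cdot> ?b X Y)"
    unfolding twist_def
    by (simp add: star_tensor_obj half_twist_tensor X Y sX sY)
  also have "\<dots> = (?h (?s X) \<boxtimes> ?h (?s Y)) \<cdot>
      ((?b (?s Y) (?s X) \<cdot> (?h Y \<boxtimes> ?h X)) \<cdot> ?b X Y)"
    using comp_assoc[OF comp_hom[OF b[OF X Y] t1] b[OF sY sX] t2]
      comp_assoc[OF b[OF X Y] t1 b[OF sY sX]] by simp
  also have "\<dots> = (?h (?s X) \<boxtimes> ?h (?s Y)) \<cdot>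
      (((?h X \<boxtimes> ?h Y) \<cdot> ?b Y X) \<cdot> ?b X Y)"
    by (simp add: braiding_natural[OF h[OF Y] h[OF X]])
  also have "\<dots> = ((?h (?s X) \<boxtimes> ?h (?s Y)) \<cdot> (?h X \<boxtimes> ?h Y)) \<cdot> (?b Y X \<cdot> ?b X Y)"
    using comp_assoc[OF b[OF X Y] b[OF Y X] t3]
      comp_assoc[OF comp_hom[OF b[OF X Y] b[OF Y X]] t3 t2] by simp
  also have "\<dots> = (twist C X \<boxtimes> twist C Y) \<cdot> (?b Y X \<cdot> ?b X Y)"
    unfolding twist_def
    using tensor_comp[OF h[OF X] h'[OF X] h[OF Y] h'[OF Y]] by simp
  finally show "twist C (X \<boxdot> Y) = (twist C X \<boxtimes> twist C Y) \<cdot> (?b Y X \<cdot> ?b X Y)" .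
qed


section \<open>Contractions\<close>

locale balanced_contraction =
  balanced_category C \<theta> + cat_functor C D Fo Fa
  for C :: "('o, 'a, 'c) bmcat_scheme" and \<theta> :: "'o \<Rightarrow> 'a"
    and D :: "('p, 'b, 'd) cat_scheme" and Fo :: "'o \<Rightarrow> 'p" and Fa :: "'a \<Rightarrow> 'b" +
  assumes contract_swap: "X \<in> Obj C \<Longrightarrow> Y \<in> Obj C \<Longrightarrow>
      Fo (Y \<boxdot>\<^bsub>C\<^esub> X) = Fo (X \<boxdot>\<^bsub>C\<^esub> Y)"
    and contract_braiding: "X \<in> Obj C \<Longrightarrow> Y \<in> Obj C \<Longrightarrow>
      Fa ((\<theta> Y \<boxtimes>\<^bsub>C\<^esub> Ident C X) \<cdot>\<^bsub>C\<^esub> braiding C X Y) = Ident D (Fo (X \<boxdot>\<^bsub>C\<^esub> Y))"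
    and contract_assoc: "X \<in> Obj C \<Longrightarrow> Y \<in> Obj C \<Longrightarrow> Z \<in> Obj C \<Longrightarrow>
      Fo ((X \<boxdot>\<^bsub>C\<^esub> Y) \<boxdot>\<^bsub>C\<^esub> Z) = Fo (X \<boxdot>\<^bsub>C\<^esub> (Y \<boxdot>\<^bsub>C\<^esub> Z))"
    and contract_associator: "X \<in> Obj C \<Longrightarrow> Y \<in> Obj C \<Longrightarrow> Z \<in> Obj C \<Longrightarrow>
      Fa (associator C X Y Z) = Ident D (Fo ((X \<boxdot>\<^bsub>C\<^esub> Y) \<boxdot>\<^bsub>C\<^esub> Z))"

locale half_balanced_contraction =
  half_balanced_category C + balanced_contraction C "twist C" D Fo Fa
  for C :: "('o, 'a, 'c) hbmcat_scheme"
    and D :: "('p, 'b, 'd) cat_scheme" and Fo :: "'o \<Rightarrow> 'p" and Fa :: "'a \<Rightarrow> 'b" +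
  assumes contract_star: "X \<in> Obj C \<Longrightarrow> Fo X = Fo (star_obj C X)"
    and contract_half_twist: "X \<in> Obj C \<Longrightarrow> Fa (half_twist C X) = Ident D (Fo X)"


section \<open>Group presentations, braid groups and their quotients\<close>

text \<open>A letter \<open>(s, True)\<close> stands for the generator \<open>s\<close>, and \<open>(s, False)\<close> for its formal inverse.\<close>

type_synonym 's group_word = "('s \<times> bool) list"

inductive pres_equiv ::
  "'s set \<Rightarrow> ('s group_word \<times> 's group_word) set \<Rightarrow> 's group_word \<Rightarrow> 's group_word \<Rightarrow> bool"
  for S R where
  refl: "w \<in> lists (S \<times> UNIV) \<Longrightarrow> pres_equiv S R w w"
| sym: "pres_equiv S R u v \<Longrightarrow> pres_equiv S R v u"
| trans: "pres_equiv S R u v \<Longrightarrow> pres_equiv S R v w \<Longrightarrow> pres_equiv S R u w"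
| append: "pres_equiv S R u u' \<Longrightarrow> pres_equiv S R v v' \<Longrightarrow> pres_equiv S R (u @ v) (u' @ v')"
| cancel: "s \<in> S \<Longrightarrow> pres_equiv S R [(s, b), (s, \<not> b)] []"
| relation: "(u, v) \<in> R \<Longrightarrow> u \<in> lists (S \<times> UNIV) \<Longrightarrow> v \<in> lists (S \<times> UNIV) \<Longrightarrow>
    pres_equiv S R u v"

definition pres_class ::
  "'s set \<Rightarrow> ('s group_word \<times> 's group_word) set \<Rightarrow> 's group_word \<Rightarrow> 's group_word set" where
  "pres_class S R w = {v. pres_equiv S R w v}"

definition presented_group ::
  "'s set \<Rightarrow> ('s group_word \<times> 's group_word) set \<Rightarrow> 's group_word set monoid" where
  "presented_group S R =
     \<lparr>carrier = pres_class S R ` lists (S \<times> UNIV),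
      monoid.mult = (\<lambda>A B. \<Union>u\<in>A. \<Union>v\<in>B. pres_class S R (u @ v)),
      one = pres_class S R []\<rparr>"

definition braid_relations :: "nat \<Rightarrow> (nat group_word \<times> nat group_word) set" where
  "braid_relations n =
     {([(i, True), (i + 1, True), (i, True)], [(i + 1, True), (i, True), (i + 1, True)])
        | i. 1 \<le> i \<and> i + 1 < n} \<union>
     {([(i, True), (j, True)], [(j, True), (i, True)]) | i j. 1 \<le> i \<and> i + 1 < j \<and> j < n}"

definition braid_group :: "nat \<Rightarrow> nat group_word set monoid" where
  "braid_group n = presented_group {1..<n} (braid_relations n)"

definition braid_gen :: "nat \<Rightarrow> nat \<Rightarrow> nat group_word set" where
  "braid_gen n i = pres_class {1..<n} (braid_relations n) [(i, True)]"

text \<open>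
  The homomorphism from the braid group to the symmetric group (acting on \<open>{1..n}\<close>, composed as
  functions), evaluated on representing words.
\<close>

definition word_perm :: "nat group_word \<Rightarrow> nat \<Rightarrow> nat" where
  "word_perm w = foldr (\<lambda>(i, b) p. transpose i (i + 1) \<circ> p) w id"

definition braid_perm :: "nat group_word set \<Rightarrow> nat \<Rightarrow> nat" where
  "braid_perm A = the_elem (word_perm ` A)"

definition semidirect ::
  "('g, 'c) monoid_scheme \<Rightarrow> ('h, 'd) monoid_scheme \<Rightarrow> ('h \<Rightarrow> 'g \<Rightarrow> 'g) \<Rightarrow> ('g \<times> 'h) monoid" where
  "semidirect N H \<phi> =
     \<lparr>carrier = carrier N \<times> carrier H,
      monoid.mult = (\<lambda>(a, g) (b, h). (a \<otimes>\<^bsub>N\<^esub> \<phi> g b, g \<otimes>\<^bsub>H\<^esub> h)),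
      one = (\<one>\<^bsub>N\<^esub>, \<one>\<^bsub>H\<^esub>)\<rparr>"

abbreviation int_power_group :: "nat \<Rightarrow> (nat \<Rightarrow> int) monoid" where
  "int_power_group n \<equiv> product_group {1..n} (\<lambda>_. integer_group)"

text \<open>The action for which the braid \<open>b\<close> sends the \<open>i\<close>-th basis vector to the \<open>braid_perm b i\<close>-th one.\<close>

definition braid_action :: "nat \<Rightarrow> nat group_word set \<Rightarrow> (nat \<Rightarrow> int) \<Rightarrow> nat \<Rightarrow> int" where
  "braid_action n b d = (\<lambda>i\<in>{1..n}. d (inv_into UNIV (braid_perm b) i))"

type_synonym framed_braid = "(nat \<Rightarrow> int) \<times> nat group_word set"

definition framed_braid_group :: "nat \<Rightarrow> framed_braid monoid" where
  "framed_braid_group n = semidirect (int_power_group n) (braid_group n) (braid_action n)"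

definition framed_delta :: "nat \<Rightarrow> nat \<Rightarrow> framed_braid" where
  "framed_delta n i = ((\<lambda>j\<in>{1..n}. if j = i then 1 else 0), \<one>\<^bsub>braid_group n\<^esub>)"

definition framed_sigma :: "nat \<Rightarrow> nat \<Rightarrow> framed_braid" where
  "framed_sigma n i = (\<one>\<^bsub>int_power_group n\<^esub>, braid_gen n i)"

definition list_prod :: "('g, 'c) monoid_scheme \<Rightarrow> 'g list \<Rightarrow> 'g" where
  "list_prod G xs = foldr (\<lambda>x y. x \<otimes>\<^bsub>G\<^esub> y) xs \<one>\<^bsub>G\<^esub>"

text \<open>
  The words \<open>(\<sigma>\<^sub>1 \<dots> \<sigma>\<^bsub>n-1\<^esub>)\<^sup>n\<close> and \<open>\<sigma>\<^sub>1 \<dots> \<sigma>\<^bsub>n-1\<^esub>\<^sup>2 \<dots> \<sigma>\<^sub>1\<close>,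
  for given elements \<open>s 1, \<dots>, s (n - 1)\<close> of a group.
\<close>

definition full_twist :: "('g, 'c) monoid_scheme \<Rightarrow> nat \<Rightarrow> (nat \<Rightarrow> 'g) \<Rightarrow> 'g" where
  "full_twist G n s = list_prod G (map s [1..<n]) [^]\<^bsub>G\<^esub> n"

definition first_strand_loop :: "('g, 'c) monoid_scheme \<Rightarrow> nat \<Rightarrow> (nat \<Rightarrow> 'g) \<Rightarrow> 'g" where
  "first_strand_loop G n s = list_prod G (map s [1..<n] @ map s (rev [1..<n]))"

definition normal_closure :: "('g, 'c) monoid_scheme \<Rightarrow> 'g set \<Rightarrow> 'g set" where
  "normal_closure G S = \<Inter> {N. N \<lhd> G \<and> S \<subseteq> N}"

definition quotient_group :: "('g, 'c) monoid_scheme \<Rightarrow> 'g set \<Rightarrow> 'g set monoid" where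
  "quotient_group G S = G Mod normal_closure G S"

definition quotient_map :: "('g, 'c) monoid_scheme \<Rightarrow> 'g set \<Rightarrow> 'g \<Rightarrow> 'g set" where
  "quotient_map G S g = normal_closure G S #>\<^bsub>G\<^esub> g"

definition sphere_relators :: "nat \<Rightarrow> nat group_word set set" where
  "sphere_relators n =
     {full_twist (braid_group n) n (braid_gen n),
      first_strand_loop (braid_group n) n (braid_gen n)}"

definition framed_sphere_relators :: "nat \<Rightarrow> framed_braid set" where
  "framed_sphere_relators n =
     (let G = framed_braid_group n in
      {list_prod G (map (framed_delta n) [1..<n + 1]) \<otimes>\<^bsub>G\<^esub> full_twist G n (framed_sigma n),
       (framed_delta n 1 [^]\<^bsub>G\<^esub> (2::nat)) \<otimes>\<^bsub>G\<^esub> first_strand_loop G n (framed_sigma n)})"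

abbreviation Gamma0 :: "nat \<Rightarrow> nat group_word set set monoid" where
  "Gamma0 n \<equiv> quotient_group (braid_group n) (sphere_relators n)"

abbreviation Gamma0_proj :: "nat \<Rightarrow> nat group_word set \<Rightarrow> nat group_word set set" where
  "Gamma0_proj n \<equiv> quotient_map (braid_group n) (sphere_relators n)"

abbreviation framed_Gamma0 :: "nat \<Rightarrow> framed_braid set monoid" where
  "framed_Gamma0 n \<equiv> quotient_group (framed_braid_group n) (framed_sphere_relators n)"

abbreviation framed_Gamma0_proj :: "nat \<Rightarrow> framed_braid \<Rightarrow> framed_braid set" where
  "framed_Gamma0_proj n \<equiv> quotient_map (framed_braid_group n) (framed_sphere_relators n)"


section \<open>Parenthesized tensor powers and the canonical representation\<close>

datatype paren = Leaf | Node paren paren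

fun leaves :: "paren \<Rightarrow> nat" where
  "leaves Leaf = 1"
| "leaves (Node P Q) = leaves P + leaves Q"

fun tensor_power :: "('o, 'a, 'c) bmcat_scheme \<Rightarrow> 'o \<Rightarrow> paren \<Rightarrow> 'o" where
  "tensor_power C X Leaf = X"
| "tensor_power C X (Node P Q) = tensor_power C X P \<boxdot>\<^bsub>C\<^esub> tensor_power C X Q"

text \<open>
  \<open>reassoc C X P Q f\<close>: the arrow \<open>f\<close> between the \<open>P\<close>- and the \<open>Q\<close>-parenthesized power of \<open>X\<close>
  is composed of associativity constraints. By Mac Lane coherence there is at most one such \<open>f\<close>.
\<close>

inductive reassoc :: "('o, 'a, 'c) bmcat_scheme \<Rightarrow> 'o \<Rightarrow> paren \<Rightarrow> paren \<Rightarrow> 'a \<Rightarrow> bool"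
  for C X where
  ident: "reassoc C X P P (Ident C (tensor_power C X P))"
| associator: "reassoc C X (Node (Node P Q) R) (Node P (Node Q R))
    (associator C (tensor_power C X P) (tensor_power C X Q) (tensor_power C X R))"
| inverse: "reassoc C X P Q f \<Longrightarrow> reassoc C X Q P (inv_arrow C f)"
| comp: "reassoc C X P Q f \<Longrightarrow> reassoc C X Q R g \<Longrightarrow> reassoc C X P R (g \<cdot>\<^bsub>C\<^esub> f)"
| tensor: "reassoc C X P P' f \<Longrightarrow> reassoc C X Q Q' g \<Longrightarrow>
    reassoc C X (Node P Q) (Node P' Q') (f \<boxtimes>\<^bsub>C\<^esub> g)"

text \<open>\<open>twist_at\<close> applies \<open>t\<close> to the \<open>i\<close>-th factor, counted from 1, and the identity to the others.\<close>

fun twist_at :: "('o, 'a, 'c) bmcat_scheme \<Rightarrow> 'o \<Rightarrow> 'a \<Rightarrow> nat \<Rightarrow> paren \<Rightarrow> 'a" where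
  "twist_at C X t i Leaf = t"
| "twist_at C X t i (Node P Q) =
     (if i \<le> leaves P
      then twist_at C X t i P \<boxtimes>\<^bsub>C\<^esub> Ident C (tensor_power C X Q)
      else Ident C (tensor_power C X P) \<boxtimes>\<^bsub>C\<^esub> twist_at C X t (i - leaves P) Q)"

text \<open>
  \<open>braid_at C X i P h\<close>: in the parenthesization \<open>P\<close> the factors \<open>i\<close> and \<open>i + 1\<close> are bracketed
  together, and \<open>h\<close> is the braiding on these two, tensored with the identity on all others.
\<close>

inductive braid_at :: "('o, 'a, 'c) bmcat_scheme \<Rightarrow> 'o \<Rightarrow> nat \<Rightarrow> paren \<Rightarrow> 'a \<Rightarrow> bool"
  for C X where
  here: "braid_at C X 1 (Node Leaf Leaf) (braiding C X X)"
| left: "braid_at C X i P h \<Longrightarrow>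
    braid_at C X i (Node P Q) (h \<boxtimes>\<^bsub>C\<^esub> Ident C (tensor_power C X Q))"
| right: "braid_at C X i Q h \<Longrightarrow>
    braid_at C X (leaves P + i) (Node P Q) (Ident C (tensor_power C X P) \<boxtimes>\<^bsub>C\<^esub> h)"

definition canonical_rep ::
  "('o, 'a, 'c) bmcat_scheme \<Rightarrow> ('o \<Rightarrow> 'a) \<Rightarrow> 'o \<Rightarrow> paren \<Rightarrow> (framed_braid \<Rightarrow> 'a) \<Rightarrow> bool" where
  "canonical_rep C \<theta> X P \<rho> \<longleftrightarrow>
     group_hom (framed_braid_group (leaves P)) (Aut C (tensor_power C X P)) \<rho> \<and>
     (\<forall>i\<in>{1..leaves P}. \<rho> (framed_delta (leaves P) i) = twist_at C X (\<theta> X) i P) \<and>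
     (\<forall>i\<in>{1..<leaves P}. \<exists>Q f h. reassoc C X P Q f \<and> braid_at C X i Q h \<and>
        \<rho> (framed_sigma (leaves P) i) = inv_arrow C f \<cdot>\<^bsub>C\<^esub> (h \<cdot>\<^bsub>C\<^esub> f))"

end

theory Submission
  imports Defs
begin

text \<open>
  The idea is to let the parenthesized powers act by tensoring from the left. Collecting the factors of
  \<open>X\<^bsup>P\<^esup> \<otimes> Y\<close> one by one gives isomorphisms \<open>X\<^bsup>P\<^esup> \<otimes> Y \<rightarrow> X \<otimes> (\<dots> \<otimes> (X \<otimes> Y))\<close>, and an arrow
  \<open>h : X\<^bsup>P\<^esup> \<rightarrow> X\<^bsup>Q\<^esup>\<close> becomes an endomorphism of \<open>X \<otimes> (\<dots> \<otimes> (X \<otimes> Y))\<close>, natural in \<open>Y\<close>. By the pentagon the associativity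
  constraints become identities, which is the coherence needed here; for \<open>Y\<close> the unit object, \<open>h\<close> can be
  recovered. The braid relations, the canonical representation and the images of the two
  relators are computed on this side.

  The word \<open>(\<Prod>\<delta>\<^sub>i) z\<^sub>n\<close> is sent to the twist of \<open>X\<^bsup>P\<^esup>\<close>, by induction on \<open>n\<close> from the twist of a tensor product and
  \<open>z\<^bsub>n+1\<^esub> = (\<sigma>\<^sub>2 \<dots> \<sigma>\<^sub>n)\<^sup>n \<sigma>\<^sub>1 \<dots> \<sigma>\<^sub>n\<^sup>2 \<dots> \<sigma>\<^sub>1\<close>; the contraction kills it, since it kills the two half-twists composing it.
  The other relator is conjugate to \<open>(\<theta>\<^sub>X\<^sup>2 \<otimes> id) \<beta>\<^bsub>A,X\<^esub> \<beta>\<^bsub>X,A\<^esub>\<close> with \<open>A = X\<^bsup>n-1\<^esup>\<close>. After contraction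
  \<open>\<theta>\<^sub>X \<otimes> id\<close> and \<open>id \<otimes> \<theta>\<^sub>A\<close> agree, which turns this arrow into \<open>\<theta>\<^bsub>X \<otimes> A\<^esub>\<close>.
\<close>

section \<open>Presented groups\<close>

text \<open>The base object \<open>Y\<close> is kept variable for two reasons. In a tensor product
  one family is evaluated at a tower over \<open>Y\<close>, so an induction on bracketings needs all
  bases at once; and naturality in \<open>Y\<close> is what makes arrows on disjoint strands
  commute. The representation is specified only up to a choice of bracketing and reassociation for
  each crossing; the choice drops out because every such conjugate acts on the tower as the same
  crossing. The identity for \<open>z\<close> concerns positive words, so it is proved for arbitrary
  elements of a monoid subject to the braid relations and then applied to automorphisms of towers.
  For the second relator, the twist of \<open>X \<boxdot> A\<close> involves one twist on each
  factor, while the square of \<open>\<delta>\<^sub>1\<close> puts both on the first. The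
  half-twists bridge this: a tensor product of half-twists contracts to the same arrow as a twist on
  its first factor, and the involution, which reverses the factors, moves that twist to the
  second.\<close>

definition words :: "'s set \<Rightarrow> 's group_word set" where
  "words S = lists (S \<times> UNIV)"

lemma words_simps [simp]:
  "[] \<in> words S"
  "(s, b) # w \<in> words S \<longleftrightarrow> s \<in> S \<and> w \<in> words S"
  "u @ v \<in> words S \<longleftrightarrow> u \<in> words S \<and> v \<in> words S"
  by (auto simp: words_def)

lemma words_induct [consumes 1, case_names Nil Cons]:
  assumes "w \<in> words S" "Q []"
    and "\<And>s b w. s \<in> S \<Longrightarrow> w \<in> words S \<Longrightarrow> Q w \<Longrightarrow> Q ((s, b) # w)"
  shows "Q w"
  using assms(1)
proof (induction w)
  case (Cons a w)
  then show ?case by (cases a) (auto intro: assms(3))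
qed (simp add: assms(2))

lemma pres_equiv_words:
  assumes "pres_equiv S R u v"
  shows "u \<in> words S" "v \<in> words S"
  using assms by (induction rule: pres_equiv.induct) (auto simp: words_def)

lemma pres_equiv_refl: "w \<in> words S \<Longrightarrow> pres_equiv S R w w"
  by (simp add: words_def pres_equiv.refl)

lemma pres_class_eq_iff:
  assumes "u \<in> words S"
  shows "pres_class S R u = pres_class S R v \<longleftrightarrow> pres_equiv S R u v"
  unfolding pres_class_def
  using assms by (auto intro: pres_equiv_refl pres_equiv.sym pres_equiv.trans)

text \<open>The product is a union over all pairs of representatives. Concatenation respects the
  congruence, so every member of the union is the same class, and reflexivity shows that the union
  is not empty.\<close>

lemma presented_group_mult:
  assumes "u \<in> words S" "v \<in> words S"
  shows "pres_class S R u \<otimes>\<^bsub>presented_group S R\<^esub> pres_class S R v = pres_class S R (u @ v)"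
proof -
  have "pres_class S R (u' @ v') = pres_class S R (u @ v)"
    if "u' \<in> pres_class S R u" "v' \<in> pres_class S R v" for u' v'
    using that pres_equiv_words pres_class_eq_iff[of "u' @ v'" S R "u @ v"]
    unfolding pres_class_def
    by (metis mem_Collect_eq pres_equiv.append pres_equiv.sym)
  moreover have "u \<in> pres_class S R u" "v \<in> pres_class S R v"
    using assms by (simp_all add: pres_class_def pres_equiv_refl)
  ultimately show ?thesis
    unfolding presented_group_def monoid.simps by blast
qed

lemma presented_group_one: "\<one>\<^bsub>presented_group S R\<^esub> = pres_class S R []"
  by (simp add: presented_group_def)

lemma presented_group_carrier:
  "carrier (presented_group S R) = pres_class S R ` words S"
  by (simp add: presented_group_def words_def)

text \<open>The witness is the reversed word with all signs flipped, built letter by letter. A left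
  inverse is what \<open>groupI\<close> asks for.\<close>

lemma pres_equiv_inverse_word:
  assumes "w \<in> words S"
  shows "\<exists>v\<in>words S. pres_equiv S R (v @ w) []"
  using assms
proof (induction rule: words_induct)
  case Nil
  have "pres_equiv S R ([] @ []) []" by (simp add: pres_equiv_refl)
  then show ?case by (intro bexI[of _ "[]"]) simp_all
next
  case (Cons s b w)
  then obtain v where v: "v \<in> words S" "pres_equiv S R (v @ w) []" by blast
  have "pres_equiv S R [(s, \<not> b), (s, b)] []"
    using pres_equiv.cancel[OF Cons(1), of R "\<not> b"] by simp
  from pres_equiv.append[OF pres_equiv_refl[OF v(1)]
      pres_equiv.append[OF this pres_equiv_refl[OF Cons(2)]]]
  have "pres_equiv S R ((v @ [(s, \<not> b)]) @ (s, b) # w) (v @ w)" by simp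
  then show ?case
    using v Cons(1) by (intro bexI[of _ "v @ [(s, \<not> b)]"]) (auto intro: pres_equiv.trans)
qed

lemma group_presented_group: "group (presented_group S R)"
proof (rule groupI)
  show "\<one>\<^bsub>presented_group S R\<^esub> \<in> carrier (presented_group S R)"
    by (auto simp: presented_group_one presented_group_carrier)
next
  fix x y assume "x \<in> carrier (presented_group S R)" "y \<in> carrier (presented_group S R)"
  then show "x \<otimes>\<^bsub>presented_group S R\<^esub> y \<in> carrier (presented_group S R)"
    by (auto simp: presented_group_carrier presented_group_mult)
next
  fix x y z assume "x \<in> carrier (presented_group S R)" "y \<in> carrier (presented_group S R)"
    "z \<in> carrier (presented_group S R)"
  then show "x \<otimes>\<^bsub>presented_group S R\<^esub> y \<otimes>\<^bsub>presented_group S R\<^esub> z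
    = x \<otimes>\<^bsub>presented_group S R\<^esub> (y \<otimes>\<^bsub>presented_group S R\<^esub> z)"
    unfolding presented_group_carrier
    by (elim imageE) (simp add: presented_group_mult)
next
  fix x assume "x \<in> carrier (presented_group S R)"
  then show "\<one>\<^bsub>presented_group S R\<^esub> \<otimes>\<^bsub>presented_group S R\<^esub> x = x"
    unfolding presented_group_carrier presented_group_one
    by (elim imageE) (simp add: presented_group_mult)
next
  fix x assume "x \<in> carrier (presented_group S R)"
  then obtain w where w: "w \<in> words S" "x = pres_class S R w"
    by (auto simp: presented_group_carrier)
  from pres_equiv_inverse_word[OF w(1)]
  obtain v where v: "v \<in> words S" "pres_equiv S R (v @ w) []" by blast
  have "pres_class S R v \<otimes>\<^bsub>presented_group S R\<^esub> x = \<one>\<^bsub>presented_group S R\<^esub>"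
    using v w by (simp add: presented_group_mult presented_group_one pres_class_eq_iff)
  then show "\<exists>y\<in>carrier (presented_group S R). y \<otimes>\<^bsub>presented_group S R\<^esub> x = \<one>\<^bsub>presented_group S R\<^esub>"
    using v by (auto simp: presented_group_carrier)
qed

definition word_eval :: "('g, 'c) monoid_scheme \<Rightarrow> ('s \<Rightarrow> 'g) \<Rightarrow> 's group_word \<Rightarrow> 'g" where
  "word_eval G h w = foldr (\<lambda>(s, b) g. (if b then h s else inv\<^bsub>G\<^esub> (h s)) \<otimes>\<^bsub>G\<^esub> g) w \<one>\<^bsub>G\<^esub>"

context group
begin

lemma word_eval_Nil: "word_eval G h [] = \<one>"
  by (simp add: word_eval_def)

lemma word_eval_Cons:
  "word_eval G h ((s, b) # w) = (if b then h s else inv (h s)) \<otimes> word_eval G h w"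
  by (simp add: word_eval_def)

lemma word_eval_closed:
  assumes "h \<in> S \<rightarrow> carrier G" "w \<in> words S"
  shows "word_eval G h w \<in> carrier G"
  using assms(2) by (induction rule: words_induct) (use assms(1) in \<open>auto simp: word_eval_Nil word_eval_Cons\<close>)

lemma word_eval_append:
  assumes "h \<in> S \<rightarrow> carrier G" "u \<in> words S" "v \<in> words S"
  shows "word_eval G h (u @ v) = word_eval G h u \<otimes> word_eval G h v"
  using assms(2)
proof (induction rule: words_induct)
  case Nil
  then show ?case by (simp add: word_eval_Nil word_eval_closed[OF assms(1,3)])
next
  case (Cons s b u)
  have "h s \<in> carrier G" using Cons assms(1) by auto
  then show ?case
    using Cons word_eval_closed[OF assms(1)] assms(3) by (simp add: word_eval_Cons m_assoc)
qed

lemma word_eval_pres_equiv: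
  assumes "h \<in> S \<rightarrow> carrier G"
    and "\<And>u v. (u, v) \<in> R \<Longrightarrow> word_eval G h u = word_eval G h v"
    and "pres_equiv S R u v"
  shows "word_eval G h u = word_eval G h v"
  using assms(3)
proof (induction rule: pres_equiv.induct)
  case (append u u' v v')
  then show ?case using word_eval_append[OF assms(1)] pres_equiv_words by metis
next
  case (cancel s b)
  then have "h s \<in> carrier G" using assms(1) by auto
  then show ?case by (simp add: word_eval_Cons word_eval_Nil)
qed (simp_all add: assms(2))

text \<open>The universal property of a presentation. Evaluation is constant on each class, so
  \<open>the_elem\<close> picks the common value.\<close>

lemma presented_group_lift:
  assumes "h \<in> S \<rightarrow> carrier G"
    and "\<And>u v. (u, v) \<in> R \<Longrightarrow> word_eval G h u = word_eval G h v"
  obtains k where "k \<in> hom (presented_group S R) G"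
    and "\<And>w. w \<in> words S \<Longrightarrow> k (pres_class S R w) = word_eval G h w"
proof
  let ?k = "\<lambda>A. the_elem (word_eval G h ` A)"
  show k: "?k (pres_class S R w) = word_eval G h w" if "w \<in> words S" for w
  proof -
    have "w \<in> pres_class S R w"
      using that by (simp add: pres_class_def pres_equiv_refl)
    then show ?thesis
      by (intro the_elem_image_unique)
        (auto simp: pres_class_def intro: word_eval_pres_equiv[OF assms, symmetric])
  qed
  show "?k \<in> hom (presented_group S R) G"
    unfolding presented_group_carrier hom_def
    by (auto simp: k word_eval_closed[OF assms(1)] presented_group_mult word_eval_append[OF assms(1)])
qed

end


section \<open>The braid group and its framed version\<close>

lemma group_braid_group: "group (braid_group n)"
  unfolding braid_group_def by (rule group_presented_group)

lemma word_perm_append: "word_perm (u @ v) = word_perm u \<circ> word_perm v"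
  by (induction u) (auto simp: word_perm_def)

text \<open>Signs are ignored by \<open>word_perm\<close> because a transposition is its own
  inverse; the braid relations become identities between transpositions.\<close>

lemma word_perm_pres_equiv:
  assumes "pres_equiv S (braid_relations n) u v"
  shows "word_perm u = word_perm v"
  using assms
proof (induction rule: pres_equiv.induct)
  case (append u u' v v')
  then show ?case by (simp add: word_perm_append)
next
  case (cancel s b)
  then show ?case by (simp add: word_perm_def)
next
  case (relation u v)
  then show ?case
    by (auto simp: braid_relations_def word_perm_def fun_eq_iff transpose_def)
qed auto

lemma braid_perm_class:
  assumes "w \<in> words {1..<n}"
  shows "braid_perm (pres_class {1..<n} (braid_relations n) w) = word_perm w"
proof -
  have "w \<in> pres_class {1..<n} (braid_relations n) w"
    using assms by (simp add: pres_class_def pres_equiv_refl)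
  then show ?thesis
    unfolding braid_perm_def
    by (intro the_elem_image_unique) (auto simp: pres_class_def intro: word_perm_pres_equiv[symmetric])
qed

lemma bij_word_perm: "bij (word_perm w)"
  by (induction w) (auto simp: word_perm_def bij_id[unfolded id_def] intro: bij_comp)

lemma word_perm_range:
  assumes "w \<in> words {1..<n}" "i \<in> {1..n}"
  shows "word_perm w i \<in> {1..n}"
  using assms(1)
proof (induction rule: words_induct)
  case (Cons s b w)
  then show ?case by (auto simp: word_perm_def transpose_def)
qed (use assms(2) in \<open>simp add: word_perm_def\<close>)

lemma word_perm_image:
  assumes "w \<in> words {1..<n}"
  shows "word_perm w ` {1..n} = {1..n}"
  by (rule endo_inj_surj)
    (use word_perm_range[OF assms] in \<open>auto intro: inj_on_subset[OF bij_is_inj[OF bij_word_perm]]\<close>)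

text \<open>Vectors are undefined outside \<open>{1..n}\<close>, and the action reads them at the
  inverse permutation. Staying inside the range is what makes the action additive and
  multiplicative.\<close>

lemma inv_word_perm_range:
  assumes "w \<in> words {1..<n}" "i \<in> {1..n}"
  shows "inv_into UNIV (word_perm w) i \<in> {1..n}"
  using word_perm_image[OF assms(1)] assms(2) inv_f_f[OF bij_is_inj[OF bij_word_perm[of w]]]
  by (metis imageE)

lemma braid_carrier:
  "carrier (braid_group n) = pres_class {1..<n} (braid_relations n) ` words {1..<n}"
  by (simp add: braid_group_def presented_group_carrier)

lemma bij_braid_perm: "b \<in> carrier (braid_group n) \<Longrightarrow> bij (braid_perm b)"
  unfolding braid_carrier by (elim imageE) (simp only: braid_perm_class bij_word_perm)

lemma inv_braid_perm_range:
  "b \<in> carrier (braid_group n) \<Longrightarrow> i \<in> {1..n} \<Longrightarrow> inv_into UNIV (braid_perm b) i \<in> {1..n}"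
  unfolding braid_carrier by (elim imageE) (simp only: braid_perm_class inv_word_perm_range)

lemma braid_perm_mult:
  assumes "b \<in> carrier (braid_group n)" "c \<in> carrier (braid_group n)"
  shows "braid_perm (b \<otimes>\<^bsub>braid_group n\<^esub> c) = braid_perm b \<circ> braid_perm c"
proof -
  obtain u v where u: "u \<in> words {1..<n}" "b = pres_class {1..<n} (braid_relations n) u"
    and v: "v \<in> words {1..<n}" "c = pres_class {1..<n} (braid_relations n) v"
    using assms by (auto simp: braid_carrier)
  have "u @ v \<in> words {1..<n}" using u v by auto
  from braid_perm_class[OF this] show ?thesis
    using u v by (simp add: braid_group_def presented_group_mult braid_perm_class word_perm_append
        del: One_nat_def)
qed

lemma braid_perm_one: "braid_perm \<one>\<^bsub>braid_group n\<^esub> = id"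
  using braid_perm_class[of "[]" n] by (simp add: braid_group_def presented_group_one word_perm_def)

section \<open>Semidirect products and the framed braid group as a group\<close>

lemma group_semidirect:
  assumes N: "group N" and H: "group H"
    and hom: "\<And>g. g \<in> carrier H \<Longrightarrow> \<phi> g \<in> hom N N"
    and mult: "\<And>g h a. g \<in> carrier H \<Longrightarrow> h \<in> carrier H \<Longrightarrow> a \<in> carrier N \<Longrightarrow>
      \<phi> (g \<otimes>\<^bsub>H\<^esub> h) a = \<phi> g (\<phi> h a)"
    and one: "\<And>a. a \<in> carrier N \<Longrightarrow> \<phi> \<one>\<^bsub>H\<^esub> a = a"
  shows "group (semidirect N H \<phi>)"
proof -
  interpret N: group N by fact
  interpret H: group H by fact
  note closed = hom_in_carrier[OF hom]
  show ?thesis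
  proof (rule groupI)
    fix x assume "x \<in> carrier (semidirect N H \<phi>)"
    then obtain a g where x: "x = (a, g)" and ag: "a \<in> carrier N" "g \<in> carrier H"
      by (auto simp: semidirect_def)
    let ?y = "(\<phi> (inv\<^bsub>H\<^esub> g) (inv\<^bsub>N\<^esub> a), inv\<^bsub>H\<^esub> g)"
    have "\<phi> (inv\<^bsub>H\<^esub> g) (inv\<^bsub>N\<^esub> a) \<otimes>\<^bsub>N\<^esub> \<phi> (inv\<^bsub>H\<^esub> g) a = \<phi> (inv\<^bsub>H\<^esub> g) \<one>\<^bsub>N\<^esub>"
      using hom_mult[OF hom[of "inv\<^bsub>H\<^esub> g"], of "inv\<^bsub>N\<^esub> a" a] ag by simp
    also have "\<dots> = \<one>\<^bsub>N\<^esub>"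
      using hom_one[OF hom N N, of "inv\<^bsub>H\<^esub> g"] ag by simp
    finally show "\<exists>y\<in>carrier (semidirect N H \<phi>). y \<otimes>\<^bsub>semidirect N H \<phi>\<^esub> x = \<one>\<^bsub>semidirect N H \<phi>\<^esub>"
      using ag x closed by (intro bexI[of _ ?y]) (auto simp: semidirect_def)
  qed (auto simp: semidirect_def one mult closed N.m_assoc H.m_assoc hom_mult[OF hom])
qed

text \<open>The universal property of a semidirect product: \<open>conj\<close> moves
  \<open>k g\<close> past \<open>f b\<close> when two values are multiplied.\<close>

lemma semidirect_lift:
  assumes G: "group G" and f: "f \<in> hom N G" and k: "k \<in> hom H G"
    and act: "\<And>h a. h \<in> carrier H \<Longrightarrow> a \<in> carrier N \<Longrightarrow> \<phi> h a \<in> carrier N"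
    and conj: "\<And>h a. h \<in> carrier H \<Longrightarrow> a \<in> carrier N \<Longrightarrow> k h \<otimes>\<^bsub>G\<^esub> f a = f (\<phi> h a) \<otimes>\<^bsub>G\<^esub> k h"
  shows "(\<lambda>(a, h). f a \<otimes>\<^bsub>G\<^esub> k h) \<in> hom (semidirect N H \<phi>) G"
proof -
  interpret G: group G by fact
  note closed = hom_in_carrier[OF f] hom_in_carrier[OF k]
  have "f (a \<otimes>\<^bsub>N\<^esub> \<phi> g b) \<otimes>\<^bsub>G\<^esub> k (g \<otimes>\<^bsub>H\<^esub> h) = f a \<otimes>\<^bsub>G\<^esub> k g \<otimes>\<^bsub>G\<^esub> (f b \<otimes>\<^bsub>G\<^esub> k h)"
    if "a \<in> carrier N" "b \<in> carrier N" "g \<in> carrier H" "h \<in> carrier H" for a b g h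
  proof -
    have "f a \<otimes>\<^bsub>G\<^esub> k g \<otimes>\<^bsub>G\<^esub> (f b \<otimes>\<^bsub>G\<^esub> k h) = f a \<otimes>\<^bsub>G\<^esub> (k g \<otimes>\<^bsub>G\<^esub> f b) \<otimes>\<^bsub>G\<^esub> k h"
      using that closed by (simp add: G.m_assoc)
    also have "\<dots> = f a \<otimes>\<^bsub>G\<^esub> f (\<phi> g b) \<otimes>\<^bsub>G\<^esub> (k g \<otimes>\<^bsub>G\<^esub> k h)"
      using that closed act by (simp add: conj G.m_assoc)
    finally show ?thesis
      using that act by (simp add: hom_mult[OF f] hom_mult[OF k])
  qed
  then show ?thesis
    by (intro homI) (auto simp: semidirect_def closed)
qed

lemma int_power_group_carrier: "carrier (int_power_group n) = (\<Pi>\<^sub>E i\<in>{1..n}. UNIV)"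
  by (simp add: carrier_product_group)

lemma braid_action_closed: "braid_action n b d \<in> carrier (int_power_group n)"
  by (simp add: int_power_group_carrier braid_action_def)

lemma group_int_power_group: "group (int_power_group n)"
  by (intro product_group) simp

lemma group_framed_braid_group: "group (framed_braid_group n)"
  unfolding framed_braid_group_def
proof (rule group_semidirect[OF group_int_power_group group_braid_group])
  fix b assume b: "b \<in> carrier (braid_group n)"
  show "braid_action n b \<in> hom (int_power_group n) (int_power_group n)"
  proof (rule homI)
    fix d e
    show "braid_action n b (d \<otimes>\<^bsub>int_power_group n\<^esub> e)
      = braid_action n b d \<otimes>\<^bsub>int_power_group n\<^esub> braid_action n b e"
      using inv_braid_perm_range[OF b]
      by (auto simp: braid_action_def mult_product_group restrict_def fun_eq_iff)
  qed (rule braid_action_closed)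
next
  fix b c d
  assume b: "b \<in> carrier (braid_group n)" and c: "c \<in> carrier (braid_group n)"
  show "braid_action n (b \<otimes>\<^bsub>braid_group n\<^esub> c) d = braid_action n b (braid_action n c d)"
    using inv_braid_perm_range[OF b] o_inv_distrib[OF bij_braid_perm[OF b] bij_braid_perm[OF c]]
    by (auto simp: braid_action_def braid_perm_mult[OF b c] restrict_def fun_eq_iff)
next
  fix d assume "d \<in> carrier (int_power_group n)"
  then show "braid_action n \<one>\<^bsub>braid_group n\<^esub> d = d"
    by (auto simp: int_power_group_carrier braid_action_def braid_perm_one PiE_def extensional_def
        restrict_def fun_eq_iff)
qed


section \<open>Ordered products, the Coxeter element and the full twist\<close>

lemma list_prod_simps [simp]:
  "list_prod G [] = \<one>\<^bsub>G\<^esub>" "list_prod G (x # xs) = x \<otimes>\<^bsub>G\<^esub> list_prod G xs"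
  by (simp_all add: list_prod_def)

lemma (in monoid) list_prod_closed [simp]: "set xs \<subseteq> carrier G \<Longrightarrow> list_prod G xs \<in> carrier G"
  by (induction xs) auto

lemma (in monoid) list_prod_append:
  "set xs \<subseteq> carrier G \<Longrightarrow> set ys \<subseteq> carrier G \<Longrightarrow>
    list_prod G (xs @ ys) = list_prod G xs \<otimes> list_prod G ys"
  by (induction xs) (auto simp: m_assoc)

lemma (in group_hom) hom_list_prod:
  "set xs \<subseteq> carrier G \<Longrightarrow> h (list_prod G xs) = list_prod H (map h xs)"
  by (induction xs) auto

text \<open>Used with \<open>g = f\<close> to commute a letter past a word, and with
  \<open>g\<close> the shifted letters to pass the Coxeter element through a word.\<close>

lemma (in monoid) list_prod_intertwine:
  assumes "x \<in> carrier G" "f \<in> set is \<rightarrow> carrier G" "g \<in> set is \<rightarrow> carrier G"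
    and "\<And>i. i \<in> set is \<Longrightarrow> x \<otimes> f i = g i \<otimes> x"
  shows "x \<otimes> list_prod G (map f is) = list_prod G (map g is) \<otimes> x"
  using assms(2-)
proof (induction "is")
  case (Cons i js)
  have fg: "f i \<in> carrier G" "g i \<in> carrier G" "list_prod G (map f js) \<in> carrier G"
    "list_prod G (map g js) \<in> carrier G"
    using Cons by (auto intro!: list_prod_closed)
  have "x \<otimes> list_prod G (map f (i # js)) = g i \<otimes> (x \<otimes> list_prod G (map f js))"
    using fg assms(1) Cons.prems(3)[of i] by (simp add: m_assoc[symmetric])
  also have "\<dots> = list_prod G (map g (i # js)) \<otimes> x"
    using fg assms(1) Cons by (simp add: m_assoc)
  finally show ?case .
qed (simp add: assms(1))

text \<open>The setting is a monoid because the identities below relate positive words only.\<close>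

locale braid_system = monoid G for G (structure) +
  fixes n :: nat and s :: "nat \<Rightarrow> 'a"
  assumes s_closed: "1 \<le> i \<Longrightarrow> i < n \<Longrightarrow> s i \<in> carrier G"
    and s_braid: "1 \<le> i \<Longrightarrow> i + 1 < n \<Longrightarrow>
      s i \<otimes> (s (i + 1) \<otimes> s i) = s (i + 1) \<otimes> (s i \<otimes> s (i + 1))"
    and s_far: "1 \<le> i \<Longrightarrow> i + 1 < j \<Longrightarrow> j < n \<Longrightarrow> s i \<otimes> s j = s j \<otimes> s i"
begin

abbreviation sprod :: "nat list \<Rightarrow> 'a" where
  "sprod is \<equiv> list_prod G (map s is)"

lemma s_list_closed: "set is \<subseteq> {1..<n} \<Longrightarrow> set (map s is) \<subseteq> carrier G"
  using s_closed by auto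

lemma sprod_closed [simp]: "set is \<subseteq> {1..<n} \<Longrightarrow> sprod is \<in> carrier G"
  by (intro list_prod_closed s_list_closed)

lemma sprod_append:
  "set is \<subseteq> {1..<n} \<Longrightarrow> set js \<subseteq> {1..<n} \<Longrightarrow> sprod (is @ js) = sprod is \<otimes> sprod js"
  by (simp only: map_append list_prod_append s_list_closed)

lemma s_commutes_sprod:
  assumes "1 \<le> i" "i < n" "set js \<subseteq> {1..<n}" "\<And>j. j \<in> set js \<Longrightarrow> j + 1 < i \<or> i + 1 < j"
  shows "s i \<otimes> sprod js = sprod js \<otimes> s i"
proof (rule list_prod_intertwine)
  fix j assume "j \<in> set js"
  then show "s i \<otimes> s j = s j \<otimes> s i"
    using assms(1-3) assms(4)[of j] s_far[of i j] s_far[of j i] by fastforce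
qed (use assms s_closed in auto)

text \<open>Write the product as \<open>a \<otimes> s i \<otimes> s (i + 1) \<otimes> b\<close>. The
  letter \<open>s i\<close> on the right passes \<open>b\<close>, the braid relation rewrites the
  middle, and the resulting \<open>s (i + 1)\<close> passes \<open>a\<close>.\<close>

lemma coxeter_shift:
  assumes "1 \<le> i" "i + 1 < n"
  shows "sprod [1..<n] \<otimes> s i = s (i + 1) \<otimes> sprod [1..<n]"
proof -
  let ?a = "sprod [1..<i]" and ?b = "sprod [i + 2..<n]"
  have closed: "?a \<in> carrier G" "?b \<in> carrier G" "s i \<in> carrier G" "s (i + 1) \<in> carrier G"
    using assms by (auto intro!: sprod_closed s_closed)
  have "[1..<n] = [1..<i] @ [i..<n]"
    using assms upt_add_eq_append[of 1 i "n - i"] by simp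
  also have "[i..<n] = [i, i + 1] @ [i + 2..<n]"
    using assms by (simp add: upt_rec)
  finally have c: "sprod [1..<n] = ?a \<otimes> (s i \<otimes> (s (i + 1) \<otimes> ?b))"
    using assms closed sprod_append[of "[1..<i]" "[i, i + 1] @ [i + 2..<n]"] by simp
  have b: "s i \<otimes> ?b = ?b \<otimes> s i"
    using assms by (intro s_commutes_sprod) auto
  have a: "s (i + 1) \<otimes> ?a = ?a \<otimes> s (i + 1)"
    using assms by (intro s_commutes_sprod) auto
  have "sprod [1..<n] \<otimes> s i = ?a \<otimes> (s i \<otimes> (s (i + 1) \<otimes> (?b \<otimes> s i)))"
    using closed by (simp only: c m_assoc m_closed)
  also have "\<dots> = ?a \<otimes> ((s i \<otimes> (s (i + 1) \<otimes> s i)) \<otimes> ?b)"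
    using closed by (simp only: b[symmetric] m_assoc m_closed)
  also have "\<dots> = (?a \<otimes> s (i + 1)) \<otimes> (s i \<otimes> (s (i + 1) \<otimes> ?b))"
    using closed by (simp only: s_braid[OF assms] m_assoc m_closed)
  also have "\<dots> = s (i + 1) \<otimes> sprod [1..<n]"
    using closed by (simp only: a[symmetric] c m_assoc m_closed)
  finally show ?thesis .
qed

text \<open>With c = s_1 ... s_m and d = s_2 ... s_m this reads c^(j+1) = d^j c s_m ... s_(m-j+1). A
  further factor c is pulled to the left through the descending tail, lowering its indices by one;
  then c c = d c s_m supplies one more d and the missing top letter. For j = m the tail is all of
  s_m ... s_1, which gives the full twist.\<close>

lemma coxeter_power:
  assumes n: "n = Suc m" and "j \<le> m"
  shows "sprod [1..<n] [^] Suc j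
    = list_prod G (map (s \<circ> Suc) [1..<m]) [^] j \<otimes> (sprod [1..<n] \<otimes> sprod (rev [Suc m - j..<n]))"
  using assms(2)
proof (induction j)
  case 0
  then show ?case using sprod_closed[of "[1..<n]"] n by (simp del: upt_Suc)
next
  case (Suc j)
  let ?c = "sprod [1..<n]" and ?d = "list_prod G (map (s \<circ> Suc) [1..<m])"
  let ?r = "sprod (rev [Suc m - j..<n])"
  have d: "?d \<in> carrier G"
    using n s_closed by (intro list_prod_closed) auto
  have m: "1 \<le> m" "s m \<in> carrier G" using Suc s_closed[of m] n by auto
  have cl: "?c \<in> carrier G" "?r \<in> carrier G" "sprod (rev [m - j..<m]) \<in> carrier G"
    "sprod [1..<m] \<in> carrier G"
    by (rule sprod_closed; use Suc n in force)+
  have c: "?c = sprod [1..<m] \<otimes> s m"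
    using n m sprod_append[of "[1..<m]" "[m]"] by simp
  have shift: "?c \<otimes> s i = s (Suc i) \<otimes> ?c" if "1 \<le> i" "i < m" for i
    using coxeter_shift[of i] that n by simp
  have cd: "?c \<otimes> sprod [1..<m] = ?d \<otimes> ?c"
    using n cl s_closed shift by (intro list_prod_intertwine) auto
  have "?c \<otimes> sprod (rev [m - j..<m]) = list_prod G (map (s \<circ> Suc) (rev [m - j..<m])) \<otimes> ?c"
    using n cl s_closed shift Suc by (intro list_prod_intertwine) auto
  also have "map (s \<circ> Suc) (rev [m - j..<m]) = map s (rev [Suc m - j..<n])"
    using n Suc by (simp only: map_map[symmetric] rev_map[symmetric] map_Suc_upt Suc_diff_le)
  finally have rc: "?r \<otimes> ?c = ?c \<otimes> sprod (rev [m - j..<m])" by simp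
  have cc: "?c \<otimes> ?c = ?d \<otimes> (?c \<otimes> s m)"
    using cl d m by (subst (2) c) (simp only: m_assoc[symmetric] m_closed cd)
  have "rev [Suc m - Suc j..<n] = m # rev [m - j..<m]"
    using n by simp
  then have r: "sprod (rev [Suc m - Suc j..<n]) = s m \<otimes> sprod (rev [m - j..<m])"
    by simp
  have "?c [^] Suc j = ?d [^] j \<otimes> (?c \<otimes> ?r)"
    using Suc.prems by (intro Suc.IH) simp
  then have "?c [^] Suc (Suc j) = ?d [^] j \<otimes> (?c \<otimes> (?r \<otimes> ?c))"
    using cl d by (subst nat_pow_Suc) (simp only: m_assoc m_closed nat_pow_closed)
  also have "\<dots> = ?d [^] j \<otimes> ((?c \<otimes> ?c) \<otimes> sprod (rev [m - j..<m]))"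
    using cl by (simp only: rc m_assoc)
  also have "\<dots> = ?d [^] Suc j \<otimes> (?c \<otimes> sprod (rev [Suc m - Suc j..<n]))"
    unfolding nat_pow_Suc cc r using cl d m(2) by (simp only: m_assoc m_closed nat_pow_closed)
  finally show ?case .
qed

lemma full_twist_Suc:
  assumes "n = Suc m"
  shows "full_twist G n s = full_twist G m (s \<circ> Suc) \<otimes> first_strand_loop G n s"
  using coxeter_power[OF assms, of m] sprod_append[of "[1..<n]" "rev [1..<n]"] assms
  by (simp add: full_twist_def first_strand_loop_def del: upt_Suc)

end

section \<open>Homomorphisms out of the framed braid group\<close>

lemma (in group) int_pow_intertwine:
  assumes "x \<in> carrier G" "y \<in> carrier G" "z \<in> carrier G" "x \<otimes> y = z \<otimes> x"
  shows "x \<otimes> y [^] (k :: int) = z [^] k \<otimes> x"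
proof -
  have nat: "x \<otimes> y [^] m = z [^] m \<otimes> x" for m :: nat
  proof (induction m)
    case (Suc m)
    have "x \<otimes> y [^] Suc m = (x \<otimes> y [^] m) \<otimes> y" using assms by (simp add: m_assoc)
    also have "\<dots> = z [^] m \<otimes> (x \<otimes> y)" using assms by (simp add: Suc m_assoc)
    finally show ?case using assms by (simp add: m_assoc)
  qed (use assms in simp)
  have inv: "x \<otimes> inv a = inv b \<otimes> x"
    if "x \<otimes> a = b \<otimes> x" "a \<in> carrier G" "b \<in> carrier G" for a b
  proof -
    have "inv b \<otimes> x = inv b \<otimes> ((x \<otimes> a) \<otimes> inv a)"
      using that(2,3) assms(1) by (simp add: m_assoc)
    also have "\<dots> = (inv b \<otimes> b) \<otimes> (x \<otimes> inv a)"
      using that assms(1) by (simp only: that(1) m_assoc m_closed inv_closed)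
    also have "\<dots> = x \<otimes> inv a" using that assms(1) by simp
    finally show ?thesis by simp
  qed
  show ?thesis
  proof (cases k)
    case (nonneg m)
    then show ?thesis using nat by (simp add: int_pow_int)
  next
    case (neg m)
    then show ?thesis
      using inv[OF nat[of "Suc m"]] assms by (simp only: int_pow_neg int_pow_int nat_pow_closed)
  qed
qed

text \<open>The relations between the \<open>\<delta>\<close> and \<open>\<sigma>\<close>
  generators, imposed on arbitrary elements; \<open>framed_braid_group_lift\<close> shows that they
  suffice to define a homomorphism.\<close>

locale framed_braid_system = group G + braid_system G n s
  for G (structure) and n :: nat and s :: "nat \<Rightarrow> 'a" +
  fixes t :: "nat \<Rightarrow> 'a"
  assumes t_closed: "1 \<le> i \<Longrightarrow> i \<le> n \<Longrightarrow> t i \<in> carrier G"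
    and t_comm: "1 \<le> i \<Longrightarrow> i < j \<Longrightarrow> j \<le> n \<Longrightarrow> t i \<otimes> t j = t j \<otimes> t i"
    and s_t: "1 \<le> i \<Longrightarrow> i < n \<Longrightarrow> 1 \<le> j \<Longrightarrow> j \<le> n \<Longrightarrow>
      s i \<otimes> t j = t (transpose i (i + 1) j) \<otimes> s i"
begin

primrec tprod :: "(nat \<Rightarrow> int) \<Rightarrow> nat \<Rightarrow> 'a" where
  "tprod d 0 = \<one>"
| "tprod d (Suc k) = tprod d k \<otimes> t (Suc k) [^] d (Suc k)"

lemma tprod_closed [simp]: "k \<le> n \<Longrightarrow> tprod d k \<in> carrier G"
  by (induction k) (simp_all add: t_closed)

lemma tprod_cong: "(\<And>i. 1 \<le> i \<Longrightarrow> i \<le> k \<Longrightarrow> d i = e i) \<Longrightarrow> tprod d k = tprod e k"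
  by (induction k) auto

lemma t_comm': "1 \<le> i \<Longrightarrow> i \<le> n \<Longrightarrow> 1 \<le> j \<Longrightarrow> j \<le> n \<Longrightarrow> t i \<otimes> t j = t j \<otimes> t i"
  using t_comm[of i j] t_comm[of j i] by (cases i j rule: linorder_cases) auto

lemma t_pow_comm:
  assumes "1 \<le> i" "i \<le> n" "1 \<le> j" "j \<le> n"
  shows "t i [^] (a :: int) \<otimes> t j [^] (b :: int) = t j [^] b \<otimes> t i [^] a"
  by (intro int_pow_intertwine[symmetric] int_pow_intertwine int_pow_closed t_closed t_comm' assms)

lemma t_pow_tprod:
  assumes "1 \<le> i" "i \<le> n" "k \<le> n"
  shows "t i [^] (a :: int) \<otimes> tprod d k = tprod d k \<otimes> t i [^] a"
  using assms(3)
proof (induction k)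
  case 0
  then show ?case using assms t_closed by simp
next
  case (Suc k)
  have cl: "t i [^] a \<in> carrier G" "t (Suc k) [^] d (Suc k) \<in> carrier G" "tprod d k \<in> carrier G"
    using assms Suc t_closed by auto
  have "t i [^] a \<otimes> tprod d (Suc k) = (t i [^] a \<otimes> tprod d k) \<otimes> t (Suc k) [^] d (Suc k)"
    using cl by (simp add: m_assoc)
  also have "\<dots> = tprod d k \<otimes> (t i [^] a \<otimes> t (Suc k) [^] d (Suc k))"
    using Suc cl by (simp add: m_assoc)
  also have "\<dots> = tprod d (Suc k) \<otimes> t i [^] a"
    using assms Suc.prems cl t_pow_comm[of i "Suc k"] by (simp add: m_assoc)
  finally show ?case .
qed

lemma tprod_add: "k \<le> n \<Longrightarrow> tprod (\<lambda>i. d i + e i) k = tprod d k \<otimes> tprod e k"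
proof (induction k)
  case (Suc k)
  have cl: "t (Suc k) \<in> carrier G" "tprod d k \<in> carrier G" "tprod e k \<in> carrier G"
    using Suc t_closed by auto
  have "tprod (\<lambda>i. d i + e i) (Suc k)
      = tprod d k \<otimes> (tprod e k \<otimes> t (Suc k) [^] d (Suc k)) \<otimes> t (Suc k) [^] e (Suc k)"
    using Suc cl by (simp add: int_pow_mult[symmetric] m_assoc)
  also have "tprod e k \<otimes> t (Suc k) [^] d (Suc k) = t (Suc k) [^] d (Suc k) \<otimes> tprod e k"
    using t_pow_tprod[of "Suc k" k] Suc.prems by simp
  also have "tprod d k \<otimes> (t (Suc k) [^] d (Suc k) \<otimes> tprod e k) \<otimes> t (Suc k) [^] e (Suc k)
    = tprod d (Suc k) \<otimes> tprod e (Suc k)"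
    using cl by (simp add: m_assoc)
  finally show ?case .
qed simp

lemma s_t_pow:
  assumes "1 \<le> i" "i < n" "1 \<le> j" "j \<le> n"
  shows "s i \<otimes> t j [^] (a :: int) = t (transpose i (i + 1) j) [^] a \<otimes> s i"
  using assms by (intro int_pow_intertwine t_closed s_closed s_t) (auto simp: transpose_def)

text \<open>Since \<open>s i\<close> exchanges \<open>t i\<close> and \<open>t (i + 1)\<close>, the
  claim fails in general for the prefix ending at \<open>i\<close>. Prefixes below \<open>i\<close>
  come first, the factors \<open>i\<close> and \<open>i + 1\<close> are passed together, and all
  later factors are fixed.\<close>

lemma s_tprod:
  assumes "1 \<le> i" "i < n"
  shows "s i \<otimes> tprod d n = tprod (d \<circ> transpose i (i + 1)) n \<otimes> s i"
proof -
  have extend: "s i \<otimes> tprod d (Suc k) = tprod (d \<circ> transpose i (i + 1)) (Suc k) \<otimes> s i"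
    if k: "Suc k \<le> n" "Suc k \<noteq> i" "Suc k \<noteq> i + 1"
      and IH: "s i \<otimes> tprod d k = tprod (d \<circ> transpose i (i + 1)) k \<otimes> s i" for k
  proof -
    have cl: "tprod d k \<in> carrier G" "tprod (d \<circ> transpose i (i + 1)) k \<in> carrier G"
      "t (Suc k) [^] d (Suc k) \<in> carrier G" "s i \<in> carrier G"
      using k assms t_closed s_closed by auto
    have fix': "transpose i (i + 1) (Suc k) = Suc k" using k by (simp add: transpose_def)
    have "s i \<otimes> tprod d (Suc k) = (s i \<otimes> tprod d k) \<otimes> t (Suc k) [^] d (Suc k)"
      using cl by (simp add: m_assoc)
    also have "\<dots> = tprod (d \<circ> transpose i (i + 1)) k \<otimes> (s i \<otimes> t (Suc k) [^] d (Suc k))"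
      using cl by (simp only: IH m_assoc)
    also have "s i \<otimes> t (Suc k) [^] d (Suc k) = t (Suc k) [^] d (Suc k) \<otimes> s i"
      using s_t_pow[OF assms, of "Suc k"] k fix' by simp
    also have "tprod (d \<circ> transpose i (i + 1)) k \<otimes> (t (Suc k) [^] d (Suc k) \<otimes> s i)
      = tprod (d \<circ> transpose i (i + 1)) (Suc k) \<otimes> s i"
      using cl fix' by (simp add: m_assoc)
    finally show ?thesis .
  qed
  have low: "s i \<otimes> tprod d k = tprod (d \<circ> transpose i (i + 1)) k \<otimes> s i" if "k < i" for k
    using that
  proof (induction k)
    case 0
    then show ?case using s_closed assms by simp
  next
    case (Suc k)
    have "s i \<otimes> tprod d k = tprod (d \<circ> transpose i (i + 1)) k \<otimes> s i"
      using Suc.prems by (intro Suc.IH) simp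
    then show ?case by (rule extend[rotated -1]) (use Suc.prems assms in auto)
  qed
  have "s i \<otimes> tprod d k = tprod (d \<circ> transpose i (i + 1)) k \<otimes> s i" if "i + 1 \<le> k" "k \<le> n" for k
    using that
  proof (induction k rule: dec_induct)
    case base
    let ?e = "d \<circ> transpose i (i + 1)"
    obtain l where l: "i = Suc l" using assms by (cases i) auto
    have cl: "tprod d l \<in> carrier G" "tprod ?e l \<in> carrier G"
      "t i [^] a \<in> carrier G" "t (i + 1) [^] a \<in> carrier G" "s i \<in> carrier G" for a :: int
      using l assms t_closed s_closed by auto
    have "s i \<otimes> tprod d (i + 1) = (s i \<otimes> tprod d l) \<otimes> t i [^] d i \<otimes> t (i + 1) [^] d (i + 1)"
      using cl by (simp add: l m_assoc)
    also have "\<dots> = tprod ?e l \<otimes> (s i \<otimes> t i [^] d i) \<otimes> t (i + 1) [^] d (i + 1)"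
      using cl low[of l] l by (simp add: m_assoc)
    also have "s i \<otimes> t i [^] d i = t (i + 1) [^] d i \<otimes> s i"
      using s_t_pow[OF assms, of i] assms by simp
    also have "tprod ?e l \<otimes> (t (i + 1) [^] d i \<otimes> s i) \<otimes> t (i + 1) [^] d (i + 1)
      = tprod ?e l \<otimes> (t (i + 1) [^] d i \<otimes> (s i \<otimes> t (i + 1) [^] d (i + 1)))"
      using cl by (simp only: m_assoc m_closed)
    also have "s i \<otimes> t (i + 1) [^] d (i + 1) = t i [^] d (i + 1) \<otimes> s i"
      using s_t_pow[OF assms, of "i + 1"] assms by simp
    also have "tprod ?e l \<otimes> (t (i + 1) [^] d i \<otimes> (t i [^] d (i + 1) \<otimes> s i))
      = tprod ?e l \<otimes> (t (i + 1) [^] d i \<otimes> t i [^] d (i + 1)) \<otimes> s i"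
      using cl by (simp only: m_assoc m_closed)
    \<comment> \<open>The exchange leaves the two factors in the wrong order; their commutation
      restores the increasing order of \<open>tprod\<close>.\<close>
    also have "t (i + 1) [^] d i \<otimes> t i [^] d (i + 1) = t i [^] d (i + 1) \<otimes> t (i + 1) [^] d i"
      using assms by (intro t_pow_comm) auto
    also have "tprod ?e l \<otimes> (t i [^] d (i + 1) \<otimes> t (i + 1) [^] d i) \<otimes> s i
      = tprod ?e (i + 1) \<otimes> s i"
      using cl by (simp add: l m_assoc)
    finally show ?case .
  next
    case (step k)
    have "s i \<otimes> tprod d k = tprod (d \<circ> transpose i (i + 1)) k \<otimes> s i"
      using step.prems by (intro step.IH) simp
    then show ?case by (rule extend[rotated -1]) (use step in auto)
  qed
  then show ?thesis using assms by simp
qed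

lemma word_tprod:
  assumes "w \<in> words {1..<n}"
  shows "word_eval G s w \<otimes> tprod d n
    = tprod (\<lambda>j. d (inv_into UNIV (word_perm w) j)) n \<otimes> word_eval G s w"
  using assms
proof (induction rule: words_induct)
  case Nil
  then show ?case by (simp add: word_eval_Nil word_perm_def inv_id[unfolded id_def] id_def)
next
  case (Cons i b w)
  let ?\<tau> = "transpose i (i + 1)" and ?x = "if b then s i else inv (s i)"
  let ?e = "\<lambda>j. d (inv_into UNIV (word_perm w) j)" and ?w = "word_eval G s w"
  have i: "1 \<le> i" "i < n" using Cons by auto
  have cl: "s i \<in> carrier G" "?x \<in> carrier G" "?w \<in> carrier G"
    using i s_closed word_eval_closed[of s "{1..<n}" w] Cons by auto
  have x: "?x \<otimes> tprod e n = tprod (e \<circ> ?\<tau>) n \<otimes> ?x" for e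
  proof (cases b)
    case False
    \<comment> \<open>An inverse letter acts by the same transposition: the positive case is applied
      to \<open>e \<circ> ?\<tau>\<close>, and \<open>?\<tau>\<close> is an involution.\<close>
    have "s i \<otimes> tprod (e \<circ> ?\<tau>) n = tprod e n \<otimes> s i"
      using s_tprod[OF i, of "e \<circ> ?\<tau>"] by (simp add: comp_assoc)
    then have "inv (s i) \<otimes> (tprod e n \<otimes> s i) \<otimes> inv (s i)
      = inv (s i) \<otimes> (s i \<otimes> tprod (e \<circ> ?\<tau>) n) \<otimes> inv (s i)" by simp
    then have "inv (s i) \<otimes> tprod e n \<otimes> (s i \<otimes> inv (s i))
      = (inv (s i) \<otimes> s i) \<otimes> tprod (e \<circ> ?\<tau>) n \<otimes> inv (s i)"
      using cl by (simp only: m_assoc m_closed inv_closed tprod_closed order_refl)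
    then show ?thesis using False cl by simp
  qed (simp add: s_tprod[OF i])
  have "word_perm ((i, b) # w) = ?\<tau> \<circ> word_perm w"
    by (simp add: word_perm_def)
  then have "inv_into UNIV (word_perm ((i, b) # w)) = inv_into UNIV (word_perm w) \<circ> ?\<tau>"
    using o_inv_distrib[OF bij_transpose[of i "i + 1"] bij_word_perm[of w]] by simp
  then have e: "(\<lambda>j. d (inv_into UNIV (word_perm ((i, b) # w)) j)) = ?e \<circ> ?\<tau>"
    by (simp add: fun_eq_iff)
  have "word_eval G s ((i, b) # w) \<otimes> tprod d n = ?x \<otimes> (?w \<otimes> tprod d n)"
    using cl by (simp add: word_eval_Cons m_assoc)
  also have "\<dots> = (?x \<otimes> tprod ?e n) \<otimes> ?w"
    using cl by (simp only: Cons.IH m_assoc tprod_closed order_refl)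
  also have "\<dots> = tprod (?e \<circ> ?\<tau>) n \<otimes> (?x \<otimes> ?w)"
    using cl by (simp only: x m_assoc tprod_closed order_refl)
  finally show ?case unfolding e word_eval_Cons .
qed

text \<open>The presentation of the braid group gives \<open>k\<close>, the commuting elements
  \<open>t i\<close> give a homomorphism on integer vectors, and \<open>word_tprod\<close> is the
  compatibility that \<open>semidirect_lift\<close> demands.\<close>

theorem framed_braid_group_lift:
  obtains \<rho> where "\<rho> \<in> hom (framed_braid_group n) G"
    and "\<And>i. i \<in> {1..n} \<Longrightarrow> \<rho> (framed_delta n i) = t i"
    and "\<And>i. i \<in> {1..<n} \<Longrightarrow> \<rho> (framed_sigma n i) = s i"
proof -
  have s: "s \<in> {1..<n} \<rightarrow> carrier G" using s_closed by auto
  have rel: "word_eval G s u = word_eval G s v" if "(u, v) \<in> braid_relations n" for u v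
    using that s_closed s_braid s_far
    by (auto simp: braid_relations_def word_eval_Cons word_eval_Nil)
  obtain k where k: "k \<in> hom (braid_group n) G"
    and kw: "\<And>w. w \<in> words {1..<n} \<Longrightarrow> k (pres_class {1..<n} (braid_relations n) w) = word_eval G s w"
    using presented_group_lift[OF s rel] unfolding braid_group_def by metis
  have f: "(\<lambda>d. tprod d n) \<in> hom (int_power_group n) G"
  proof (rule homI)
    fix d e
    have "tprod (d \<otimes>\<^bsub>int_power_group n\<^esub> e) n = tprod (\<lambda>i. d i + e i) n"
      by (rule tprod_cong) simp
    then show "tprod (d \<otimes>\<^bsub>int_power_group n\<^esub> e) n = tprod d n \<otimes> tprod e n"
      by (simp add: tprod_add)
  qed simp
  let ?\<rho> = "\<lambda>(d, b). tprod d n \<otimes> k b"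
  have hom: "?\<rho> \<in> hom (framed_braid_group n) G"
    unfolding framed_braid_group_def
  proof (rule semidirect_lift[OF is_group f k])
    fix b d assume "b \<in> carrier (braid_group n)"
    then obtain w where w: "w \<in> words {1..<n}" "b = pres_class {1..<n} (braid_relations n) w"
      unfolding braid_carrier by auto
    have "tprod (braid_action n b d) n = tprod (\<lambda>j. d (inv_into UNIV (word_perm w) j)) n"
      unfolding w(2) braid_action_def by (rule tprod_cong) (simp only: braid_perm_class[OF w(1)], simp)
    then show "k b \<otimes> tprod d n = tprod (braid_action n b d) n \<otimes> k b"
      using word_tprod[OF w(1)] kw[OF w(1)] w(2) by simp
  qed (rule braid_action_closed)
  have k1: "k \<one>\<^bsub>braid_group n\<^esub> = \<one>"
    using hom_one[OF k group_braid_group is_group] .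
  have f1: "tprod \<one>\<^bsub>int_power_group n\<^esub> n = \<one>"
    using hom_one[OF f group_int_power_group is_group] .
  have "?\<rho> (framed_delta n i) = t i" if "i \<in> {1..n}" for i
  proof -
    \<comment> \<open>Generalized to all prefixes for the induction: the product stays trivial until
      the index \<open>i\<close> is reached.\<close>
    have "tprod (\<lambda>j\<in>{1..n}. if j = i then 1 else 0) j = (if i \<le> j then t i else \<one>)"
      if "j \<le> n" for j
      using that
    proof (induction j)
      case 0
      then show ?case using \<open>i \<in> {1..n}\<close> by simp
    next
      case (Suc j)
      then show ?case using \<open>i \<in> {1..n}\<close> t_closed[of i] by (auto simp: not_le le_Suc_eq)
    qed
    then show ?thesis using that t_closed[of i] by (simp add: framed_delta_def k1)
  qed
  moreover have "?\<rho> (framed_sigma n i) = s i" if "i \<in> {1..<n}" for i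
    using that s_closed[of i] kw[of "[(i, True)]"]
    by (simp add: framed_sigma_def f1 braid_gen_def word_eval_Cons word_eval_Nil
        del: one_product_group One_nat_def)
  ultimately show ?thesis using that hom by blast
qed

end


section \<open>Quotients by normal closures\<close>

text \<open>The intersected family is nonempty, because the whole group is normal and contains
  \<open>S\<close>.\<close>

lemma (in group) normal_closure_normal:
  assumes "S \<subseteq> carrier G"
  shows "normal_closure G S \<lhd> G"
proof -
  have ne: "{N. N \<lhd> G \<and> S \<subseteq> N} \<noteq> {}" using normal_self assms by blast
  show ?thesis
    unfolding normal_closure_def
  proof (rule normal_invI)
    show "subgroup (\<Inter> {N. N \<lhd> G \<and> S \<subseteq> N}) G"
      by (rule subgroups_Inter) (use ne in \<open>auto simp: normal_imp_subgroup\<close>)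
  qed (auto intro: normal.inv_op_closed2)
qed

lemma (in group) group_hom_quotient_map:
  assumes "S \<subseteq> carrier G"
  shows "group_hom G (quotient_group G S) (quotient_map G S)"
proof -
  interpret N: normal "normal_closure G S" G
    by (rule normal_closure_normal[OF assms])
  have "quotient_map G S = (\<lambda>g. normal_closure G S #> g)"
    by (simp add: fun_eq_iff quotient_map_def)
  then show ?thesis
    unfolding group_hom_def group_hom_axioms_def quotient_group_def
    using N.r_coset_hom_Mod N.factorgroup_is_group is_group by simp
qed

text \<open>The kernel is one of the normal subgroups being intersected, hence contains the closure,
  and so \<open>h\<close> is constant on cosets.\<close>

lemma (in group_hom) quotient_lift:
  assumes "S \<subseteq> carrier G" and "\<And>x. x \<in> S \<Longrightarrow> h x = \<one>\<^bsub>H\<^esub>"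
  obtains r where "group_hom (quotient_group G S) H r"
    and "\<And>g. g \<in> carrier G \<Longrightarrow> r (quotient_map G S g) = h g"
proof
  let ?N = "normal_closure G S"
  let ?r = "\<lambda>A. the_elem (h ` A)"
  interpret N: normal ?N G
    by (rule G.normal_closure_normal[OF assms(1)])
  interpret q: group_hom G "quotient_group G S" "quotient_map G S"
    by (rule G.group_hom_quotient_map[OF assms(1)])
  have "?N \<subseteq> kernel G H h"
    unfolding normal_closure_def
    using assms normal_kernel by (intro Inter_lower) (auto simp: kernel_def)
  then have N: "x \<in> carrier G" "h x = \<one>\<^bsub>H\<^esub>" if "x \<in> ?N" for x
    using that by (auto simp: kernel_def)
  show r: "?r (quotient_map G S g) = h g" if g: "g \<in> carrier G" for g
  proof (rule the_elem_image_unique)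
    have "\<one> \<otimes> g \<in> quotient_map G S g"
      unfolding quotient_map_def r_coset_def
      by (intro UN_I[of \<one>]) (simp_all add: subgroup.one_closed[OF normal_imp_subgroup[OF N.normal_axioms]])
    then show "quotient_map G S g \<noteq> {}" by blast
    show "h x = h g" if "x \<in> quotient_map G S g" for x
      using that g N by (auto simp: quotient_map_def r_coset_def)
  qed
  have c: "carrier (quotient_group G S) = quotient_map G S ` carrier G"
    by (auto simp: quotient_group_def quotient_map_def FactGroup_def RCOSETS_def)
  have "?r \<in> hom (quotient_group G S) H"
  proof (rule homI)
    fix A B assume "A \<in> carrier (quotient_group G S)" "B \<in> carrier (quotient_group G S)"
    then obtain a b where "a \<in> carrier G" "A = quotient_map G S a"
      "b \<in> carrier G" "B = quotient_map G S b"
      by (auto simp: c)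
    then show "?r (A \<otimes>\<^bsub>quotient_group G S\<^esub> B) = ?r A \<otimes>\<^bsub>H\<^esub> ?r B"
      by (simp add: r del: q.hom_mult flip: q.hom_mult)
  qed (auto simp: c r)
  then show "group_hom (quotient_group G S) H ?r"
    by (simp add: group_hom_def group_hom_axioms_def q.H.is_group H.is_group)
qed


section \<open>Arrow calculus\<close>

context category
begin

text \<open>Membership in hom-sets is traded for equations on \<open>Dom\<close> and
  \<open>Cod\<close>, and composites are nested to the right, so that \<open>simp\<close> can check
  composability by itself.\<close>

lemma Hom_iff: "f \<in> Hom C A B \<longleftrightarrow> f \<in> Arr C \<and> Dom C f = A \<and> Cod C f = B"
  by (auto simp: Hom_def)

lemma dom_cod_obj [simp]:
  "f \<in> Arr C \<Longrightarrow> Dom C f \<in> Obj C" "f \<in> Arr C \<Longrightarrow> Cod C f \<in> Obj C"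
  by (rule dom_obj, assumption, rule cod_obj)

lemma ident_simps [simp]:
  assumes "A \<in> Obj C"
  shows "Ident C A \<in> Arr C" "Dom C (Ident C A) = A" "Cod C (Ident C A) = A"
  using ident_hom[OF assms] by (auto simp: Hom_iff)

lemma comp_simps [simp]:
  assumes "f \<in> Arr C" "g \<in> Arr C" "Dom C g = Cod C f"
  shows "g \<cdot> f \<in> Arr C" "Dom C (g \<cdot> f) = Dom C f" "Cod C (g \<cdot> f) = Cod C g"
  using comp_hom[of f "Dom C f" "Cod C f" g "Cod C g"] assms by (auto simp: Hom_iff)

lemma comp_ident_simps [simp]:
  "f \<in> Arr C \<Longrightarrow> Cod C f = A \<Longrightarrow> Ident C A \<cdot> f = f"
  "f \<in> Arr C \<Longrightarrow> Dom C f = A \<Longrightarrow> f \<cdot> Ident C A = f"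
  using comp_ident_left[of f _ A] comp_ident_right[of f A] by (auto simp: Hom_iff)

lemma comp_assoc_simp [simp]:
  "f \<in> Arr C \<Longrightarrow> g \<in> Arr C \<Longrightarrow> h \<in> Arr C \<Longrightarrow> Dom C g = Cod C f \<Longrightarrow> Dom C h = Cod C g \<Longrightarrow>
    (h \<cdot> g) \<cdot> f = h \<cdot> (g \<cdot> f)"
  by (rule comp_assoc) (auto simp: Hom_iff)

text \<open>A law \<open>g \<cdot> f = e\<close> does not match inside a right-nested composite;
  this is its form with a tail \<open>x\<close>.\<close>

lemma comp_reduce:
  "g \<cdot> f = e \<Longrightarrow> f \<in> Arr C \<Longrightarrow> g \<in> Arr C \<Longrightarrow> Dom C g = Cod C f \<Longrightarrow> x \<in> Arr C \<Longrightarrow>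
    Cod C x = Dom C f \<Longrightarrow> g \<cdot> (f \<cdot> x) = e \<cdot> x"
  by (metis comp_assoc_simp)

definition iso :: "'a \<Rightarrow> bool" where
  "iso f \<longleftrightarrow> f \<in> Arr C \<and> (\<exists>g. inverse_arrows C f g)"

lemma Iso_iff: "f \<in> Iso C A B \<longleftrightarrow> iso f \<and> Dom C f = A \<and> Cod C f = B"
  by (auto simp: Iso_def iso_def Hom_iff)

text \<open>Inverses are unique, so exhibiting one also identifies the arrow chosen by
  \<open>inv_arrow\<close>.\<close>

lemma isoI:
  assumes "f \<in> Arr C" "g \<in> Arr C" "Dom C g = Cod C f" "Cod C g = Dom C f"
    and "g \<cdot> f = Ident C (Dom C f)" "f \<cdot> g = Ident C (Cod C f)"
  shows "iso f" "inv_arrow C f = g"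
proof -
  have g: "inverse_arrows C f g"
    using assms by (simp add: inverse_arrows_def Hom_iff)
  then show "iso f" using assms by (auto simp: iso_def)
  have "h = g" if "inverse_arrows C f h" for h
  proof -
    have h: "h \<in> Arr C" "Dom C h = Cod C f" "Cod C h = Dom C f" "h \<cdot> f = Ident C (Dom C f)"
      using that by (auto simp: inverse_arrows_def Hom_iff)
    have "h = h \<cdot> (f \<cdot> g)" using assms h by simp
    also have "\<dots> = (h \<cdot> f) \<cdot> g" using assms(1-4) h(1-3) by simp
    also have "\<dots> = g" using assms by (simp add: h(4) del: comp_assoc_simp)
    finally show ?thesis .
  qed
  then show "inv_arrow C f = g"
    unfolding inv_arrow_def using g by blast
qed

lemma iso_arr [simp]: "iso f \<Longrightarrow> f \<in> Arr C"
  by (simp add: iso_def)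

lemma inv_simps [simp]:
  assumes "iso f"
  shows "inv_arrow C f \<in> Arr C" "Dom C (inv_arrow C f) = Cod C f" "Cod C (inv_arrow C f) = Dom C f"
    "inv_arrow C f \<cdot> f = Ident C (Dom C f)" "f \<cdot> inv_arrow C f = Ident C (Cod C f)"
proof -
  obtain g where "inverse_arrows C f g" "f \<in> Arr C"
    using assms unfolding iso_def by blast
  then have g: "g \<in> Arr C" "Dom C g = Cod C f" "Cod C g = Dom C f"
    "g \<cdot> f = Ident C (Dom C f)" "f \<cdot> g = Ident C (Cod C f)" "f \<in> Arr C"
    unfolding inverse_arrows_def Hom_iff by blast+
  then have "inv_arrow C f = g" by (intro isoI(2))
  then show "inv_arrow C f \<in> Arr C" "Dom C (inv_arrow C f) = Cod C f"
    "Cod C (inv_arrow C f) = Dom C f"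
    "inv_arrow C f \<cdot> f = Ident C (Dom C f)" "f \<cdot> inv_arrow C f = Ident C (Cod C f)"
    using g by simp_all
qed

lemma inv_reduce [simp]:
  assumes "iso f" "x \<in> Arr C"
  shows "Cod C x = Dom C f \<Longrightarrow> inv_arrow C f \<cdot> (f \<cdot> x) = x"
    "Cod C x = Cod C f \<Longrightarrow> f \<cdot> (inv_arrow C f \<cdot> x) = x"
  using assms comp_reduce[OF inv_simps(4)[OF assms(1)], of x]
    comp_reduce[OF inv_simps(5)[OF assms(1)], of x] by simp_all

lemma iso_inv [simp]: "iso f \<Longrightarrow> iso (inv_arrow C f)"
  by (rule isoI(1)[of _ f]) simp_all

lemma inv_inv [simp]: "iso f \<Longrightarrow> inv_arrow C (inv_arrow C f) = f"
  by (rule isoI(2)) simp_all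

lemma iso_ident [simp]: "A \<in> Obj C \<Longrightarrow> iso (Ident C A)"
  by (rule isoI(1)[of _ "Ident C A"]) simp_all

lemma inv_ident [simp]: "A \<in> Obj C \<Longrightarrow> inv_arrow C (Ident C A) = Ident C A"
  by (rule isoI(2)) simp_all

lemma iso_comp_simp [simp]:
  assumes "iso f" "iso g" "Dom C g = Cod C f"
  shows "iso (g \<cdot> f)" "inv_arrow C (g \<cdot> f) = inv_arrow C f \<cdot> inv_arrow C g"
  by (rule isoI[of _ "inv_arrow C f \<cdot> inv_arrow C g"]; use assms in simp)+

lemma iso_cancel_left:
  assumes "iso f" "f \<cdot> g = f \<cdot> h" "g \<in> Arr C" "h \<in> Arr C" "Cod C g = Dom C f" "Cod C h = Dom C f"
  shows "g = h"
  by (metis assms inv_reduce(1))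

lemma iso_cancel_right:
  assumes "iso f" "g \<cdot> f = h \<cdot> f" "g \<in> Arr C" "h \<in> Arr C" "Dom C g = Cod C f" "Dom C h = Cod C f"
  shows "g = h"
proof -
  have "(g \<cdot> f) \<cdot> inv_arrow C f = (h \<cdot> f) \<cdot> inv_arrow C f" by (simp only: assms(2))
  then show ?thesis using assms(1,3-) by simp
qed

lemma comp_eq_iso_left:
  assumes "iso f" "f \<cdot> g = h" "g \<in> Arr C" "Cod C g = Dom C f"
  shows "g = inv_arrow C f \<cdot> h"
  using assms by auto

lemma Aut_carrier: "f \<in> carrier (Aut C A) \<longleftrightarrow> iso f \<and> Dom C f = A \<and> Cod C f = A"
  by (simp add: Aut_def Iso_iff)

lemma Aut_mult: "g \<otimes>\<^bsub>Aut C A\<^esub> f = g \<cdot> f" and Aut_one: "\<one>\<^bsub>Aut C A\<^esub> = Ident C A"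
  by (simp_all add: Aut_def)

lemma group_Aut:
  assumes "A \<in> Obj C"
  shows "group (Aut C A)"
proof (rule groupI)
  fix x assume "x \<in> carrier (Aut C A)"
  then show "\<exists>y\<in>carrier (Aut C A). y \<otimes>\<^bsub>Aut C A\<^esub> x = \<one>\<^bsub>Aut C A\<^esub>"
    by (intro bexI[of _ "inv_arrow C x"]) (auto simp: Aut_carrier Aut_mult Aut_one)
qed (use assms in \<open>auto simp: Aut_carrier Aut_mult Aut_one\<close>)

lemma conj_hom:
  assumes "iso w" "Dom C w = A" "Cod C w = B"
  shows "(\<lambda>f. inv_arrow C w \<cdot> (f \<cdot> w)) \<in> hom (Aut C B) (Aut C A)"
  using assms by (intro homI) (auto simp: Aut_carrier Aut_mult)

end

context cat_functor
begin

lemma functor_simps [simp]: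
  assumes "f \<in> Arr C"
  shows "Fa f \<in> Arr D" "Dom D (Fa f) = Fo (Dom C f)" "Cod D (Fa f) = Fo (Cod C f)"
  using functor_hom[of f "Dom C f" "Cod C f"] assms by (auto simp: C.Hom_iff D.Hom_iff)

lemma functor_comp_simp:
  "f \<in> Arr C \<Longrightarrow> g \<in> Arr C \<Longrightarrow> Dom C g = Cod C f \<Longrightarrow> Fa (g \<cdot>\<^bsub>C\<^esub> f) = Fa g \<cdot>\<^bsub>D\<^esub> Fa f"
  by (rule functor_comp) (auto simp: C.Hom_iff)

lemma functor_iso:
  assumes "C.iso f"
  shows "D.iso (Fa f)" "inv_arrow D (Fa f) = Fa (inv_arrow C f)"
  by (rule D.isoI[of _ "Fa (inv_arrow C f)"];
      use assms in \<open>simp add: functor_comp_simp[symmetric] functor_ident functor_obj\<close>)+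

lemma Aut_group_hom:
  assumes "A \<in> Obj C"
  shows "group_hom (Aut C A) (Aut D (Fo A)) Fa"
  unfolding group_hom_def group_hom_axioms_def
  using assms
  by (auto simp: C.group_Aut D.group_Aut functor_obj C.Aut_carrier D.Aut_carrier C.Aut_mult
      D.Aut_mult functor_iso functor_comp_simp intro!: homI)

end


context monoidal_category
begin

abbreviation assoc ("\<a>") where "\<a> \<equiv> associator C"
abbreviation ide ("\<i>") where "\<i> \<equiv> Ident C"

declare tensor_obj [simp] unit_obj [simp]

lemma tensor_simps [simp]:
  assumes "f \<in> Arr C" "g \<in> Arr C"
  shows "f \<boxtimes> g \<in> Arr C" "Dom C (f \<boxtimes> g) = Dom C f \<boxdot> Dom C g"
    "Cod C (f \<boxtimes> g) = Cod C f \<boxdot> Cod C g"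
  using tensor_hom[of f "Dom C f" "Cod C f" g "Dom C g" "Cod C g"] assms by (auto simp: Hom_iff)

declare tensor_ident [simp]

lemma tensor_comp_merge:
  "f \<in> Arr C \<Longrightarrow> f' \<in> Arr C \<Longrightarrow> g \<in> Arr C \<Longrightarrow> g' \<in> Arr C \<Longrightarrow>
    Dom C f' = Cod C f \<Longrightarrow> Dom C g' = Cod C g \<Longrightarrow>
    (f' \<boxtimes> g') \<cdot> (f \<boxtimes> g) = (f' \<cdot> f) \<boxtimes> (g' \<cdot> g)"
  by (rule tensor_comp[symmetric]) (auto simp: Hom_iff)

lemma iso_tensor [simp]:
  assumes "iso f" "iso g"
  shows "iso (f \<boxtimes> g)" "inv_arrow C (f \<boxtimes> g) = inv_arrow C f \<boxtimes> inv_arrow C g"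
  by (rule isoI[of _ "inv_arrow C f \<boxtimes> inv_arrow C g"]; use assms in \<open>simp add: tensor_comp_merge\<close>)+

lemma assoc_simps [simp]:
  assumes "X \<in> Obj C" "Y \<in> Obj C" "Z \<in> Obj C"
  shows "iso (\<a> X Y Z)" "Dom C (\<a> X Y Z) = (X \<boxdot> Y) \<boxdot> Z" "Cod C (\<a> X Y Z) = X \<boxdot> (Y \<boxdot> Z)"
  using associator_iso[OF assms] by (auto simp: Iso_iff)

lemma assoc_natural:
  "f \<in> Arr C \<Longrightarrow> g \<in> Arr C \<Longrightarrow> h \<in> Arr C \<Longrightarrow> X' = Cod C f \<Longrightarrow> Y' = Cod C g \<Longrightarrow> Z' = Cod C h \<Longrightarrow>
    \<a> X' Y' Z' \<cdot> ((f \<boxtimes> g) \<boxtimes> h) = (f \<boxtimes> (g \<boxtimes> h)) \<cdot> \<a> (Dom C f) (Dom C g) (Dom C h)"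
  by (rule associator_natural) (auto simp: Hom_iff)

lemma runitor_simps [simp]:
  assumes "X \<in> Obj C"
  shows "iso (runitor C X)" "Dom C (runitor C X) = X \<boxdot> unit_obj C" "Cod C (runitor C X) = X"
  using runitor_iso[OF assms] by (auto simp: Iso_iff)

lemma runitor_natural_simp:
  "f \<in> Arr C \<Longrightarrow>
    runitor C (Cod C f) \<cdot> (f \<boxtimes> \<i> (unit_obj C)) = f \<cdot> runitor C (Dom C f)"
  by (rule runitor_natural) (auto simp: Hom_iff)

end


section \<open>Parenthesized powers acting on iterated tensor products\<close>

locale monoidal_power = monoidal_category C
  for C :: "('o, 'a, 'c) bmcat_scheme" (structure) +
  fixes X :: 'o
  assumes X_obj [simp]: "X \<in> Obj C"
begin

abbreviation pow :: "paren \<Rightarrow> 'o" where "pow \<equiv> tensor_power C X"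

lemma pow_obj [simp]: "pow P \<in> Obj C"
  by (induction P) simp_all

primrec tower :: "nat \<Rightarrow> 'o \<Rightarrow> 'o" where
  "tower 0 Y = Y"
| "tower (Suc k) Y = X \<boxdot> tower k Y"

primrec tower_arr :: "nat \<Rightarrow> 'a \<Rightarrow> 'a" where
  "tower_arr 0 f = f"
| "tower_arr (Suc k) f = \<i> X \<boxtimes> tower_arr k f"

lemma tower_add: "tower (k + l) Y = tower k (tower l Y)"
  by (induction k) simp_all

lemma tower_arr_add: "tower_arr (k + l) f = tower_arr k (tower_arr l f)"
  by (induction k) simp_all

lemma tower_obj [simp]: "Y \<in> Obj C \<Longrightarrow> tower k Y \<in> Obj C"
  by (induction k) simp_all

lemma tower_arr_simps [simp]:
  assumes "f \<in> Arr C"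
  shows "tower_arr k f \<in> Arr C" "Dom C (tower_arr k f) = tower k (Dom C f)"
    "Cod C (tower_arr k f) = tower k (Cod C f)"
proof -
  have "tower_arr k f \<in> Arr C \<and> Dom C (tower_arr k f) = tower k (Dom C f)
    \<and> Cod C (tower_arr k f) = tower k (Cod C f)"
    using assms by (induction k) simp_all
  then show "tower_arr k f \<in> Arr C" "Dom C (tower_arr k f) = tower k (Dom C f)"
    "Cod C (tower_arr k f) = tower k (Cod C f)" by auto
qed

lemma tower_arr_ident [simp]: "Y \<in> Obj C \<Longrightarrow> tower_arr k (\<i> Y) = \<i> (tower k Y)"
  by (induction k) simp_all

lemma tower_arr_comp:
  "f \<in> Arr C \<Longrightarrow> g \<in> Arr C \<Longrightarrow> Dom C g = Cod C f \<Longrightarrow>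
    tower_arr k (g \<cdot> f) = tower_arr k g \<cdot> tower_arr k f"
  by (induction k) (simp_all add: tensor_comp_merge)

lemma tower_arr_iso [simp]: "iso f \<Longrightarrow> iso (tower_arr k f)"
  by (induction k) simp_all

text \<open>The factors of \<open>Q\<close> are gathered onto \<open>Y\<close> first, so those of
  \<open>P\<close> meet the base \<open>tower (leaves Q) Y\<close>. This is why the base varies in
  the recursion.\<close>

primrec collect :: "paren \<Rightarrow> 'o \<Rightarrow> 'a" where
  "collect Leaf Y = \<i> (X \<boxdot> Y)"
| "collect (Node P Q) Y =
     collect P (tower (leaves Q) Y) \<cdot> ((\<i> (pow P) \<boxtimes> collect Q Y) \<cdot> \<a> (pow P) (pow Q) Y)"

lemma collect_simps [simp]:
  assumes "Y \<in> Obj C"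
  shows "iso (collect P Y)" "Dom C (collect P Y) = pow P \<boxdot> Y" 
    "Cod C (collect P Y) = tower (leaves P) Y"
proof -
  have "iso (collect P Y) \<and> Dom C (collect P Y) = pow P \<boxdot> Y
    \<and> Cod C (collect P Y) = tower (leaves P) Y"
    using assms by (induction P arbitrary: Y) (simp_all add: tower_add)
  then show "iso (collect P Y)" "Dom C (collect P Y) = pow P \<boxdot> Y" 
    "Cod C (collect P Y) = tower (leaves P) Y" by auto
qed

lemma collect_natural:
  assumes "f \<in> Arr C"
  shows "tower_arr (leaves P) f \<cdot> collect P (Dom C f) = collect P (Cod C f) \<cdot> (\<i> (pow P) \<boxtimes> f)"
  using assms
proof (induction P arbitrary: f)
  case (Node P Q)
  let ?A = "Dom C f" and ?B = "Cod C f" and ?P = "pow P" and ?Q = "pow Q"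
  let ?g = "tower_arr (leaves Q) f"
  have "tower_arr (leaves (Node P Q)) f \<cdot> collect (Node P Q) ?A
    = (tower_arr (leaves P) ?g \<cdot> collect P (Dom C ?g)) \<cdot> ((\<i> ?P \<boxtimes> collect Q ?A) \<cdot> \<a> ?P ?Q ?A)"
    using Node.prems by (simp add: tower_arr_add)
  also have "\<dots> = collect P (Cod C ?g) \<cdot> (((\<i> ?P \<boxtimes> ?g) \<cdot> (\<i> ?P \<boxtimes> collect Q ?A)) \<cdot> \<a> ?P ?Q ?A)"
    using Node.prems by (subst Node.IH(1)) simp_all
  also have "(\<i> ?P \<boxtimes> ?g) \<cdot> (\<i> ?P \<boxtimes> collect Q ?A) = (\<i> ?P \<boxtimes> collect Q ?B) \<cdot> (\<i> ?P \<boxtimes> (\<i> ?Q \<boxtimes> f))"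
    using Node.prems by (simp add: tensor_comp_merge Node.IH(2))
  also have "collect P (Cod C ?g) \<cdot> (((\<i> ?P \<boxtimes> collect Q ?B) \<cdot> (\<i> ?P \<boxtimes> (\<i> ?Q \<boxtimes> f))) \<cdot> \<a> ?P ?Q ?A)
    = collect P (Cod C ?g) \<cdot> ((\<i> ?P \<boxtimes> collect Q ?B) \<cdot> ((\<i> ?P \<boxtimes> (\<i> ?Q \<boxtimes> f)) \<cdot> \<a> ?P ?Q ?A))"
    using Node.prems by simp
  also have "(\<i> ?P \<boxtimes> (\<i> ?Q \<boxtimes> f)) \<cdot> \<a> ?P ?Q ?A = \<a> ?P ?Q ?B \<cdot> ((\<i> ?P \<boxtimes> \<i> ?Q) \<boxtimes> f)"
    using Node.prems assoc_natural[of "\<i> ?P" "\<i> ?Q" f] by simp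
  finally show ?case
    using Node.prems by simp
qed simp

text \<open>Both ends of \<open>E Y\<close> are the same tower, whatever the bracketings
  \<open>P\<close> and \<open>Q\<close>, so arrows between different powers become comparable
  endomorphisms. Naturality in \<open>Y\<close> is a consequence, see
  \<open>realizes_natural\<close>.\<close>

definition realizes :: "paren \<Rightarrow> paren \<Rightarrow> 'a \<Rightarrow> ('o \<Rightarrow> 'a) \<Rightarrow> bool" where
  "realizes P Q h E \<longleftrightarrow> leaves P = leaves Q \<and> h \<in> Hom C (pow P) (pow Q) \<and>
     (\<forall>Y\<in>Obj C. E Y \<in> Hom C (tower (leaves P) Y) (tower (leaves P) Y) \<and>
        collect Q Y \<cdot> (h \<boxtimes> \<i> Y) = E Y \<cdot> collect P Y)"

lemma realizesD:
  assumes "realizes P Q h E"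
  shows "leaves P = leaves Q" "h \<in> Arr C" "Dom C h = pow P" "Cod C h = pow Q"
    "Y \<in> Obj C \<Longrightarrow> E Y \<in> Arr C"
    "Y \<in> Obj C \<Longrightarrow> Dom C (E Y) = tower (leaves P) Y"
    "Y \<in> Obj C \<Longrightarrow> Cod C (E Y) = tower (leaves P) Y"
    "Y \<in> Obj C \<Longrightarrow> collect Q Y \<cdot> (h \<boxtimes> \<i> Y) = E Y \<cdot> collect P Y"
  using assms by (auto simp: realizes_def Hom_iff)

lemma realizesI:
  assumes "leaves P = leaves Q" "h \<in> Arr C" "Dom C h = pow P" "Cod C h = pow Q"
    and "\<And>Y. Y \<in> Obj C \<Longrightarrow> E Y \<in> Arr C"
    "\<And>Y. Y \<in> Obj C \<Longrightarrow> Dom C (E Y) = tower (leaves P) Y"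
    "\<And>Y. Y \<in> Obj C \<Longrightarrow> Cod C (E Y) = tower (leaves P) Y"
    "\<And>Y. Y \<in> Obj C \<Longrightarrow> collect Q Y \<cdot> (h \<boxtimes> \<i> Y) = E Y \<cdot> collect P Y"
  shows "realizes P Q h E"
  using assms by (auto simp: realizes_def Hom_iff)

lemma realizes_cong:
  "realizes P Q h E \<Longrightarrow> (\<And>Y. Y \<in> Obj C \<Longrightarrow> E Y = F Y) \<Longrightarrow> realizes P Q h F"
  unfolding realizes_def by metis

text \<open>Turns an equation between arrows of \<open>C\<close> into one between endomorphisms of
  towers: both families realize the same arrow, and \<open>collect P Y\<close> cancels.\<close>

lemma realizes_unique:
  assumes "realizes P Q h E" "realizes P Q h F" "Y \<in> Obj C"
  shows "E Y = F Y"
proof (rule iso_cancel_right[of "collect P Y"])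
  show "E Y \<cdot> collect P Y = F Y \<cdot> collect P Y"
    using realizesD(8)[OF assms(1,3)] realizesD(8)[OF assms(2,3)] by simp
qed (use realizesD(1-7)[OF assms(1)] realizesD(1-7)[OF assms(2)] assms(3) in simp_all)

text \<open>The arrow \<open>f\<close> slides through \<open>collect P\<close>, past
  \<open>h\<close> by bifunctoriality, and back out of \<open>collect Q\<close>. This is later the
  source of the commutations between disjoint strands.\<close>

lemma realizes_natural:
  assumes "realizes P Q h E" "f \<in> Arr C"
  shows "E (Cod C f) \<cdot> tower_arr (leaves P) f = tower_arr (leaves P) f \<cdot> E (Dom C f)"
proof -
  note h = realizesD[OF assms(1)]
  let ?A = "Dom C f" and ?B = "Cod C f" and ?f = "tower_arr (leaves P) f"
  have "(E ?B \<cdot> ?f) \<cdot> collect P ?A = E ?B \<cdot> (?f \<cdot> collect P ?A)"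
    using h assms(2) by simp
  also have "\<dots> = (E ?B \<cdot> collect P ?B) \<cdot> (\<i> (pow P) \<boxtimes> f)"
    using h(2-7) assms(2) by (simp add: collect_natural)
  also have "\<dots> = collect Q ?B \<cdot> ((h \<boxtimes> \<i> ?B) \<cdot> (\<i> (pow P) \<boxtimes> f))"
    using h assms(2) by (simp add: h(8)[symmetric])
  also have "(h \<boxtimes> \<i> ?B) \<cdot> (\<i> (pow P) \<boxtimes> f) = (\<i> (pow Q) \<boxtimes> f) \<cdot> (h \<boxtimes> \<i> ?A)"
    using h assms(2) by (simp add: tensor_comp_merge)
  also have "collect Q ?B \<cdot> ((\<i> (pow Q) \<boxtimes> f) \<cdot> (h \<boxtimes> \<i> ?A)) = (collect Q ?B \<cdot> (\<i> (pow Q) \<boxtimes> f)) \<cdot> (h \<boxtimes> \<i> ?A)"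
    using h assms(2) by simp
  also have "\<dots> = ?f \<cdot> (collect Q ?A \<cdot> (h \<boxtimes> \<i> ?A))"
    using h assms(2) by (simp add: collect_natural[symmetric] del: h(8))
  also have "\<dots> = (?f \<cdot> E ?A) \<cdot> collect P ?A"
    using h assms(2) by (simp add: h(8))
  finally show ?thesis
    by (rule iso_cancel_right[rotated]) (use h assms(2) in simp_all)
qed

lemma realizes_ident: "realizes P P (\<i> (pow P)) (\<lambda>Y. \<i> (tower (leaves P) Y))"
  by (rule realizesI) simp_all

lemma realizes_comp:
  assumes "realizes P Q h E" "realizes Q R k F"
  shows "realizes P R (k \<cdot> h) (\<lambda>Y. F Y \<cdot> E Y)"
proof (rule realizesI)
  note h = realizesD[OF assms(1)] and k = realizesD[OF assms(2)]
  fix Y assume Y: "Y \<in> Obj C"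
  have "collect R Y \<cdot> ((k \<cdot> h) \<boxtimes> \<i> Y) = collect R Y \<cdot> ((k \<boxtimes> \<i> Y) \<cdot> (h \<boxtimes> \<i> Y))"
    using h k Y by (simp add: tensor_comp_merge)
  also have "\<dots> = (collect R Y \<cdot> (k \<boxtimes> \<i> Y)) \<cdot> (h \<boxtimes> \<i> Y)"
    using h(1-7) k(1-7) Y by simp
  also have "\<dots> = F Y \<cdot> (collect Q Y \<cdot> (h \<boxtimes> \<i> Y))"
    using h(1-7) k Y by simp
  also have "\<dots> = (F Y \<cdot> E Y) \<cdot> collect P Y"
    using h k Y by simp
  finally show "collect R Y \<cdot> ((k \<cdot> h) \<boxtimes> \<i> Y) = (F Y \<cdot> E Y) \<cdot> collect P Y" .
qed (use realizesD[OF assms(1)] realizesD[OF assms(2)] in simp_all)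

lemma realizes_inv:
  assumes "realizes P Q h E" "iso h"
  shows "\<And>Y. Y \<in> Obj C \<Longrightarrow> iso (E Y)" "realizes Q P (inv_arrow C h) (\<lambda>Y. inv_arrow C (E Y))"
proof -
  note h = realizesD[OF assms(1)]
  have E: "E Y = collect Q Y \<cdot> ((h \<boxtimes> \<i> Y) \<cdot> inv_arrow C (collect P Y))" if "Y \<in> Obj C" for Y
  proof -
    have "E Y = (E Y \<cdot> collect P Y) \<cdot> inv_arrow C (collect P Y)" using h(1-7) that by simp
    also have "\<dots> = collect Q Y \<cdot> ((h \<boxtimes> \<i> Y) \<cdot> inv_arrow C (collect P Y))"
      using h(1-7) that by (simp add: h(8)[symmetric])
    finally show ?thesis .
  qed
  show "iso (E Y)" if "Y \<in> Obj C" for Y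
    unfolding E[OF that] using h that assms(2) by simp
  then show "realizes Q P (inv_arrow C h) (\<lambda>Y. inv_arrow C (E Y))"
    using h(1-7) assms(2)
    by (intro realizesI) (simp_all, simp add: E tensor_comp_merge)
qed

text \<open>The arrow \<open>k\<close> acts on the factors next to \<open>Y\<close>, hence below
  \<open>leaves P\<close> further factors; \<open>h\<close> acts on the outer factors and sees those
  of \<open>Q\<close>, stacked over \<open>Y\<close>, as its base.\<close>

lemma realizes_tensor:
  assumes "realizes P P' h E" "realizes Q Q' k F"
  shows "realizes (Node P Q) (Node P' Q') (h \<boxtimes> k)
    (\<lambda>Y. E (tower (leaves Q) Y) \<cdot> tower_arr (leaves P) (F Y))"
proof (rule realizesI)
  note h = realizesD[OF assms(1)] and k = realizesD[OF assms(2)]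
  fix Y assume Y: "Y \<in> Obj C"
  let ?T = "tower (leaves Q) Y" and ?P = "pow P" and ?Q = "pow Q" and ?P' = "pow P'" and ?Q' = "pow Q'"
  have "collect (Node P' Q') Y \<cdot> ((h \<boxtimes> k) \<boxtimes> \<i> Y)
    = collect P' ?T \<cdot> ((\<i> ?P' \<boxtimes> collect Q' Y) \<cdot> (\<a> ?P' ?Q' Y \<cdot> ((h \<boxtimes> k) \<boxtimes> \<i> Y)))"
    using h(1-7) k(1-7) Y by simp
  also have "\<a> ?P' ?Q' Y \<cdot> ((h \<boxtimes> k) \<boxtimes> \<i> Y) = (h \<boxtimes> (k \<boxtimes> \<i> Y)) \<cdot> \<a> ?P ?Q Y"
    using h(1-7) k(1-7) Y by (simp add: assoc_natural)
  also have "collect P' ?T \<cdot> ((\<i> ?P' \<boxtimes> collect Q' Y) \<cdot> ((h \<boxtimes> (k \<boxtimes> \<i> Y)) \<cdot> \<a> ?P ?Q Y))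
    = collect P' ?T \<cdot> (((\<i> ?P' \<boxtimes> collect Q' Y) \<cdot> (h \<boxtimes> (k \<boxtimes> \<i> Y))) \<cdot> \<a> ?P ?Q Y)"
    using h(1-7) k(1-7) Y by simp
  also have "(\<i> ?P' \<boxtimes> collect Q' Y) \<cdot> (h \<boxtimes> (k \<boxtimes> \<i> Y)) = h \<boxtimes> (F Y \<cdot> collect Q Y)"
    using h(1-7) k Y by (simp add: tensor_comp_merge)
  also have "\<dots> = (h \<boxtimes> \<i> ?T) \<cdot> ((\<i> ?P \<boxtimes> F Y) \<cdot> (\<i> ?P \<boxtimes> collect Q Y))"
    using h(1-7) k(1-7) Y by (simp add: tensor_comp_merge)
  also have "collect P' ?T \<cdot> (((h \<boxtimes> \<i> ?T) \<cdot> ((\<i> ?P \<boxtimes> F Y) \<cdot> (\<i> ?P \<boxtimes> collect Q Y))) \<cdot> \<a> ?P ?Q Y)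
    = (collect P' ?T \<cdot> (h \<boxtimes> \<i> ?T)) \<cdot> ((\<i> ?P \<boxtimes> F Y) \<cdot> ((\<i> ?P \<boxtimes> collect Q Y) \<cdot> \<a> ?P ?Q Y))"
    using h(1-7) k(1-7) Y by simp
  also have "\<dots> = E ?T \<cdot> ((collect P ?T \<cdot> (\<i> ?P \<boxtimes> F Y)) \<cdot> ((\<i> ?P \<boxtimes> collect Q Y) \<cdot> \<a> ?P ?Q Y))"
    using h k(1-7) Y by simp
  also have "collect P ?T \<cdot> (\<i> ?P \<boxtimes> F Y) = tower_arr (leaves P) (F Y) \<cdot> collect P ?T"
    using collect_natural[of "F Y" P] k(1-7) Y by simp
  also have "E ?T \<cdot> ((tower_arr (leaves P) (F Y) \<cdot> collect P ?T) \<cdot> ((\<i> ?P \<boxtimes> collect Q Y) \<cdot> \<a> ?P ?Q Y))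
    = (E ?T \<cdot> tower_arr (leaves P) (F Y)) \<cdot> collect (Node P Q) Y"
    using h(1-7) k(1-7) Y by simp
  finally show "collect (Node P' Q') Y \<cdot> ((h \<boxtimes> k) \<boxtimes> \<i> Y)
    = (E ?T \<cdot> tower_arr (leaves P) (F Y)) \<cdot> collect (Node P Q) Y" .
qed (use realizesD[OF assms(1)] realizesD[OF assms(2)] in \<open>simp_all add: tower_add\<close>)

lemma realizes_assoc:
  "realizes (Node (Node P Q) R) (Node P (Node Q R)) (\<a> (pow P) (pow Q) (pow R))
    (\<lambda>Y. \<i> (tower (leaves P + leaves Q + leaves R) Y))"
proof (rule realizesI)
  fix Y assume Y [simp]: "Y \<in> Obj C"
  let ?P = "pow P" and ?Q = "pow Q" and ?R = "pow R"
  let ?T = "tower (leaves R) Y" and ?cP = "collect P (tower (leaves Q + leaves R) Y)"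
  let ?cQ = "collect Q ?T" and ?cR = "collect R Y"
  have "collect (Node P (Node Q R)) Y \<cdot> (\<a> ?P ?Q ?R \<boxtimes> \<i> Y)
    = ?cP \<cdot> ((\<i> ?P \<boxtimes> (?cQ \<cdot> ((\<i> ?Q \<boxtimes> ?cR) \<cdot> \<a> ?Q ?R Y))) \<cdot> (\<a> ?P (?Q \<boxdot> ?R) Y \<cdot> (\<a> ?P ?Q ?R \<boxtimes> \<i> Y)))"
    by (simp add: tower_add)
  also have "\<i> ?P \<boxtimes> (?cQ \<cdot> ((\<i> ?Q \<boxtimes> ?cR) \<cdot> \<a> ?Q ?R Y))
    = (\<i> ?P \<boxtimes> ?cQ) \<cdot> ((\<i> ?P \<boxtimes> (\<i> ?Q \<boxtimes> ?cR)) \<cdot> (\<i> ?P \<boxtimes> \<a> ?Q ?R Y))"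
    by (simp add: tensor_comp_merge)
  also have "?cP \<cdot> (((\<i> ?P \<boxtimes> ?cQ) \<cdot> ((\<i> ?P \<boxtimes> (\<i> ?Q \<boxtimes> ?cR)) \<cdot> (\<i> ?P \<boxtimes> \<a> ?Q ?R Y)))
      \<cdot> (\<a> ?P (?Q \<boxdot> ?R) Y \<cdot> (\<a> ?P ?Q ?R \<boxtimes> \<i> Y)))
    = ?cP \<cdot> ((\<i> ?P \<boxtimes> ?cQ) \<cdot> ((\<i> ?P \<boxtimes> (\<i> ?Q \<boxtimes> ?cR)) \<cdot>
      ((\<i> ?P \<boxtimes> \<a> ?Q ?R Y) \<cdot> (\<a> ?P (?Q \<boxdot> ?R) Y \<cdot> (\<a> ?P ?Q ?R \<boxtimes> \<i> Y)))))"
    by (simp add: tower_add)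
  \<comment> \<open>The pentagon turns the three associators into the two that occur in collecting
    \<open>Node (Node P Q) R\<close>, up to naturality in the last argument.\<close>
  also have "(\<i> ?P \<boxtimes> \<a> ?Q ?R Y) \<cdot> (\<a> ?P (?Q \<boxdot> ?R) Y \<cdot> (\<a> ?P ?Q ?R \<boxtimes> \<i> Y))
    = \<a> ?P ?Q (?R \<boxdot> Y) \<cdot> \<a> (?P \<boxdot> ?Q) ?R Y"
    by (rule pentagon) simp_all
  also have "(\<i> ?P \<boxtimes> (\<i> ?Q \<boxtimes> ?cR)) \<cdot> (\<a> ?P ?Q (?R \<boxdot> Y) \<cdot> \<a> (?P \<boxdot> ?Q) ?R Y)
    = ((\<i> ?P \<boxtimes> (\<i> ?Q \<boxtimes> ?cR)) \<cdot> \<a> ?P ?Q (?R \<boxdot> Y)) \<cdot> \<a> (?P \<boxdot> ?Q) ?R Y"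
    by simp
  also have "(\<i> ?P \<boxtimes> (\<i> ?Q \<boxtimes> ?cR)) \<cdot> \<a> ?P ?Q (?R \<boxdot> Y) = \<a> ?P ?Q ?T \<cdot> ((\<i> ?P \<boxtimes> \<i> ?Q) \<boxtimes> ?cR)"
    using assoc_natural[of "\<i> ?P" "\<i> ?Q" ?cR] by simp
  finally show "collect (Node P (Node Q R)) Y \<cdot> (\<a> ?P ?Q ?R \<boxtimes> \<i> Y)
    = \<i> (tower (leaves P + leaves Q + leaves R) Y) \<cdot> collect (Node (Node P Q) R) Y"
    by (simp add: tower_add)
qed (simp_all add: tower_add)

lemma realizes_reassoc:
  assumes "reassoc C X P Q f"
  shows "iso f \<and> realizes P Q f (\<lambda>Y. \<i> (tower (leaves P) Y))"
  using assms
proof (induction rule: reassoc.induct)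
  case (ident P)
  then show ?case using realizes_ident by simp
next
  case (associator P Q R)
  then show ?case using realizes_assoc by simp
next
  case (inverse P Q f)
  then show ?case
    by (auto intro!: realizes_cong[OF realizes_inv(2)] dest: realizesD(1))
next
  case (comp P Q f R g)
  then have "leaves P = leaves Q" by (auto dest: realizesD(1))
  then show ?case
    using comp realizesD[of P Q f] realizesD[of Q R g]
    by (auto intro!: realizes_cong[OF realizes_comp])
next
  case (tensor P P' f Q Q' g)
  then have "leaves P = leaves P'" "leaves Q = leaves Q'" by (auto dest: realizesD(1))
  then show ?case
    using tensor by (auto simp: tower_add intro!: realizes_cong[OF realizes_tensor])
qed

end


lemma full_twist_cong:
  "(\<And>i. 1 \<le> i \<Longrightarrow> i < n \<Longrightarrow> s i = s' i) \<Longrightarrow> full_twist G n s = full_twist G n s'"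
  unfolding full_twist_def by (metis (no_types, lifting) atLeastLessThan_iff map_cong set_upt)

lemma (in group_hom) hom_full_twist:
  assumes "\<And>i. 1 \<le> i \<Longrightarrow> i < n \<Longrightarrow> s i \<in> carrier G"
  shows "h (full_twist G n s) = full_twist H n (h \<circ> s)"
  using assms hom_list_prod[of "map s [1..<n]"] G.list_prod_closed[of "map s [1..<n]"]
  by (auto simp: full_twist_def hom_nat_pow image_subset_iff comp_def)

lemma (in group_hom) hom_first_strand_loop:
  assumes "\<And>i. 1 \<le> i \<Longrightarrow> i < n \<Longrightarrow> s i \<in> carrier G"
  shows "h (first_strand_loop G n s) = first_strand_loop H n (h \<circ> s)"
  using assms hom_list_prod[of "map s [1..<n] @ map s (rev [1..<n])"]
  by (auto simp: first_strand_loop_def image_subset_iff comp_def)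

section \<open>Braidings on iterated tensor products\<close>

context braided_monoidal_category
begin

lemma braiding_simps [simp]:
  assumes "X \<in> Obj C" "Y \<in> Obj C"
  shows "iso (braiding C X Y)" "Dom C (braiding C X Y) = X \<boxdot> Y" "Cod C (braiding C X Y) = Y \<boxdot> X"
  using braiding_iso[OF assms] by (auto simp: Iso_iff)

lemma braiding_natural_simp:
  "f \<in> Arr C \<Longrightarrow> g \<in> Arr C \<Longrightarrow> X = Cod C f \<Longrightarrow> Y = Cod C g \<Longrightarrow>
    braiding C X Y \<cdot> (f \<boxtimes> g) = (g \<boxtimes> f) \<cdot> braiding C (Dom C f) (Dom C g)"
  by (rule braiding_natural) (auto simp: Hom_iff)

end

text \<open>The right-nested bracketing with \<open>m + 1\<close> leaves; the shift by one avoids an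
  empty power.\<close>

primrec comb :: "nat \<Rightarrow> paren" where
  "comb 0 = Leaf"
| "comb (Suc m) = Node Leaf (comb m)"

lemma upt_shift: "[Suc 0..<Suc (Suc (Suc m))] = Suc 0 # map Suc [Suc 0..<Suc (Suc m)]"
  by (subst upt_conv_Cons) (simp_all add: map_Suc_upt del: upt_Suc)

lemma leaves_comb [simp]: "leaves (comb m) = Suc m"
  by (induction m) simp_all

lemma leaves_pos [simp]: "0 < leaves P"
  by (induction P) simp_all

locale braided_power = monoidal_power C X + braided_monoidal_category C
  for C :: "('o, 'a, 'c) bmcat_scheme" (structure) and X :: 'o
begin

abbreviation br where "br \<equiv> braiding C"

definition crossing :: "'o \<Rightarrow> 'a" where
  "crossing Y = \<a> X X Y \<cdot> ((br X X \<boxtimes> \<i> Y) \<cdot> inv_arrow C (\<a> X X Y))"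

text \<open>There are \<open>i - 1\<close> strands before the crossing and
  \<open>m - (i + 1)\<close> after it; the latter are absorbed into the base of
  \<open>crossing\<close>.\<close>

definition sigma :: "nat \<Rightarrow> nat \<Rightarrow> 'o \<Rightarrow> 'a" where
  "sigma m i Y = tower_arr (i - 1) (crossing (tower (m - 1 - i) Y))"

definition delta :: "'a \<Rightarrow> nat \<Rightarrow> nat \<Rightarrow> 'o \<Rightarrow> 'a" where
  "delta t m i Y = tower_arr (i - 1) (t \<boxtimes> \<i> (tower (m - i) Y))"

lemma crossing_simps [simp]:
  assumes "Y \<in> Obj C"
  shows "iso (crossing Y)" "Dom C (crossing Y) = X \<boxdot> X \<boxdot> Y" "Cod C (crossing Y) = X \<boxdot> X \<boxdot> Y"
  using assms by (simp_all add: crossing_def)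

lemma tower_merge: "k + l = m \<Longrightarrow> tower k (tower l Y) = tower m Y"
  using tower_add[of k l Y] by simp

lemma sigma_simps [simp]:
  assumes "Y \<in> Obj C" "1 \<le> i" "i < m"
  shows "iso (sigma m i Y)" "Dom C (sigma m i Y) = tower m Y" "Cod C (sigma m i Y) = tower m Y"
proof -
  have "tower (i - 1) (X \<boxdot> X \<boxdot> tower (m - 1 - i) Y) = tower m Y"
    using assms tower_merge[of "i - 1" "Suc (Suc (m - 1 - i))" m Y] by simp
  then show "iso (sigma m i Y)" "Dom C (sigma m i Y) = tower m Y" "Cod C (sigma m i Y) = tower m Y"
    using assms by (simp_all add: sigma_def)
qed

lemma delta_simps [simp]:
  assumes "iso t" "Dom C t = X" "Cod C t = X" "Y \<in> Obj C" "1 \<le> i" "i \<le> m"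
  shows "iso (delta t m i Y)" "Dom C (delta t m i Y) = tower m Y" "Cod C (delta t m i Y) = tower m Y"
proof -
  have "tower (i - 1) (X \<boxdot> tower (m - i) Y) = tower m Y"
    using assms tower_merge[of "i - 1" "Suc (m - i)" m Y] by simp
  then show "iso (delta t m i Y)" "Dom C (delta t m i Y) = tower m Y"
    "Cod C (delta t m i Y) = tower m Y"
    using assms by (simp_all add: delta_def)
qed

lemma tower_arr_merge: "k + l = m \<Longrightarrow> tower_arr k (tower_arr l f) = tower_arr m f"
  using tower_arr_add[of k l f] by simp

text \<open>Strands added on the left raise the index, whereas strands added on the right only
  enlarge the base and keep the index (\<open>sigma_tower\<close>).\<close>

lemma sigma_shift: "1 \<le> i \<Longrightarrow> i < m \<Longrightarrow> tower_arr k (sigma m i Y) = sigma (k + m) (k + i) Y"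
  by (simp add: sigma_def tower_arr_merge)

lemma sigma_tower: "i < m \<Longrightarrow> sigma m i (tower l Y) = sigma (m + l) i Y"
  by (simp add: sigma_def tower_merge)

lemma delta_shift: "1 \<le> i \<Longrightarrow> i \<le> m \<Longrightarrow> tower_arr k (delta t m i Y) = delta t (k + m) (k + i) Y"
  by (simp add: delta_def tower_arr_merge)

lemma delta_tower: "i \<le> m \<Longrightarrow> delta t m i (tower l Y) = delta t (m + l) i Y"
  by (simp add: delta_def tower_merge)

lemma realizes_crossing: "realizes (Node Leaf Leaf) (Node Leaf Leaf) (br X X) crossing"
  by (rule realizesI) (simp_all add: numeral_2_eq_2, simp add: crossing_def)

lemma realizes_strand:
  assumes "iso t" "Dom C t = X" "Cod C t = X"
  shows "realizes Leaf Leaf t (\<lambda>Y. t \<boxtimes> \<i> Y)"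
  by (rule realizesI) (use assms in simp_all)

lemma realizes_braid_at:
  assumes "braid_at C X i P h"
  shows "1 \<le> i \<and> i < leaves P \<and> iso h \<and> realizes P P h (sigma (leaves P) i)"
  using assms
proof (induction rule: braid_at.induct)
  case here
  then show ?case
    using realizes_crossing by (auto simp: sigma_def fun_eq_iff intro: realizes_cong)
next
  case (left i P h Q)
  have "realizes (Node P Q) (Node P Q) (h \<boxtimes> \<i> (pow Q)) (sigma (leaves (Node P Q)) i)"
    by (rule realizes_cong[OF realizes_tensor[OF _ realizes_ident]])
      (use left in \<open>auto simp: sigma_tower tower_merge\<close>)
  then show ?case using left by simp
next
  case (right i Q h P)
  have "realizes (Node P Q) (Node P Q) (\<i> (pow P) \<boxtimes> h) (sigma (leaves (Node P Q)) (leaves P + i))"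
    by (rule realizes_cong[OF realizes_tensor[OF realizes_ident]])
      (use right in \<open>auto simp: sigma_shift tower_merge\<close>)
  then show ?case using right by simp
qed

lemma realizes_twist_at:
  assumes "iso t" "Dom C t = X" "Cod C t = X" "1 \<le> i" "i \<le> leaves P"
  shows "iso (twist_at C X t i P) \<and> realizes P P (twist_at C X t i P) (delta t (leaves P) i)"
  using assms(4,5)
proof (induction P arbitrary: i)
  case Leaf
  then have "i = 1" by simp
  then show ?case
    using assms(1-3) realizes_strand[OF assms(1-3)]
    by (auto simp: delta_def fun_eq_iff intro: realizes_cong)
next
  case (Node P Q)
  show ?case
  proof (cases "i \<le> leaves P")
    case True
    then have P: "iso (twist_at C X t i P)" "realizes P P (twist_at C X t i P) (delta t (leaves P) i)"
      using Node by auto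
    have "realizes (Node P Q) (Node P Q) (twist_at C X t i P \<boxtimes> \<i> (pow Q)) (delta t (leaves (Node P Q)) i)"
      by (rule realizes_cong[OF realizes_tensor[OF P(2) realizes_ident]])
        (use assms(1-3) Node.prems True in \<open>auto simp: delta_tower tower_merge\<close>)
    then show ?thesis using True P by simp
  next
    case False
    let ?j = "i - leaves P"
    have j: "1 \<le> ?j" "?j \<le> leaves Q" "leaves P + ?j = i" using False Node.prems by auto
    then have Q: "iso (twist_at C X t ?j Q)" "realizes Q Q (twist_at C X t ?j Q) (delta t (leaves Q) ?j)"
      using Node by auto
    have "realizes (Node P Q) (Node P Q) (\<i> (pow P) \<boxtimes> twist_at C X t ?j Q) (delta t (leaves (Node P Q)) i)"
      by (rule realizes_cong[OF realizes_tensor[OF realizes_ident Q(2)]])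
        (use assms(1-3) j in \<open>auto simp: delta_shift tower_merge\<close>)
    then show ?thesis using False Q by simp
  qed
qed

section \<open>Words in the crossings and the braiding of one strand past a power\<close>

abbreviation tower_aut :: "nat \<Rightarrow> 'o \<Rightarrow> 'a monoid" where
  "tower_aut m Y \<equiv> Aut C (tower m Y)"

lemma group_hom_tower_arr:
  assumes "Y \<in> Obj C" "k + m = n"
  shows "group_hom (tower_aut m Y) (tower_aut n Y) (tower_arr k)"
  unfolding group_hom_def group_hom_axioms_def
  using assms(1) tower_merge[OF assms(2)]
  by (auto simp: group_Aut Aut_carrier Aut_mult tower_arr_comp intro!: homI)

lemma sigma_aut: "Y \<in> Obj C \<Longrightarrow> 1 \<le> i \<Longrightarrow> i < m \<Longrightarrow> sigma m i Y \<in> carrier (tower_aut m Y)"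
  by (simp add: Aut_carrier)

definition sigma_prod :: "nat \<Rightarrow> 'o \<Rightarrow> nat list \<Rightarrow> 'a" where
  "sigma_prod m Y is = list_prod (tower_aut m Y) (map (\<lambda>i. sigma m i Y) is)"

lemma sigma_prod_aut:
  assumes "Y \<in> Obj C" "set is \<subseteq> {1..<m}"
  shows "sigma_prod m Y is \<in> carrier (tower_aut m Y)"
proof -
  interpret group "tower_aut m Y" using assms by (simp add: group_Aut)
  show ?thesis
    unfolding sigma_prod_def using assms sigma_aut by (intro list_prod_closed) auto
qed

lemma sigma_prod_simps [simp]:
  assumes "Y \<in> Obj C" "set is \<subseteq> {1..<m}"
  shows "iso (sigma_prod m Y is)" "Dom C (sigma_prod m Y is) = tower m Y"
    "Cod C (sigma_prod m Y is) = tower m Y"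
  using sigma_prod_aut[OF assms] by (simp_all add: Aut_carrier)

lemma sigma_prod_append:
  assumes "Y \<in> Obj C" "set is \<subseteq> {1..<m}" "set js \<subseteq> {1..<m}"
  shows "sigma_prod m Y (is @ js) = sigma_prod m Y is \<cdot> sigma_prod m Y js"
proof -
  interpret group "tower_aut m Y" using assms by (simp add: group_Aut)
  show ?thesis
    unfolding sigma_prod_def map_append using assms sigma_aut
    by (subst list_prod_append) (auto simp: Aut_mult)
qed

lemma sigma_prod_single: "Y \<in> Obj C \<Longrightarrow> 1 \<le> i \<Longrightarrow> i < m \<Longrightarrow> sigma_prod m Y [i] = sigma m i Y"
  by (simp add: sigma_prod_def Aut_mult Aut_one)

lemma tower_arr_sigma_prod:
  assumes "Y \<in> Obj C" "set is \<subseteq> {1..<m}"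
  shows "tower_arr 1 (sigma_prod m Y is) = sigma_prod (Suc m) Y (map Suc is)"
proof -
  interpret h: group_hom "tower_aut m Y" "tower_aut (Suc m) Y" "tower_arr 1"
    by (rule group_hom_tower_arr) (use assms in simp_all)
  have "tower_arr 1 (sigma_prod m Y is)
    = list_prod (tower_aut (Suc m) Y) (map (tower_arr 1) (map (\<lambda>i. sigma m i Y) is))"
    unfolding sigma_prod_def using assms sigma_aut by (intro h.hom_list_prod) auto
  also have "map (tower_arr 1) (map (\<lambda>i. sigma m i Y) is) = map (\<lambda>i. sigma (Suc m) i Y) (map Suc is)"
    using assms(2) sigma_shift[of _ m 1 Y] by auto
  finally show ?thesis by (simp only: sigma_prod_def)
qed

text \<open>
  The two hexagons reduce the braiding of \<open>X\<close> past \<open>X \<otimes> K\<close> to the one past \<open>K\<close>; the associativity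
  constraints disappear because they are realized by identities.
\<close>

lemma realizes_braid_comb:
  "realizes (Node Leaf (comb m)) (Node (comb m) Leaf) (br X (pow (comb m)))
    (\<lambda>Y. sigma_prod (m + 2) Y (rev [1..<m + 2]))"
proof (induction m)
  case 0
  then show ?case
    by (auto intro!: realizes_cong[OF realizes_crossing] simp: sigma_prod_def Aut_mult Aut_one
        sigma_def numeral_2_eq_2)
next
  case (Suc m)
  let ?K = "comb m" and ?E = "\<lambda>Y. sigma_prod (m + 2) Y (rev [1..<m + 2])"
  have a: "realizes (Node Leaf (Node Leaf ?K)) (Node (Node Leaf Leaf) ?K) (inv_arrow C (\<a> X X (pow ?K)))
      (\<lambda>Y. \<i> (tower (m + 3) Y))"
    using realizes_assoc[of Leaf Leaf ?K]
    by (intro realizes_cong[OF realizes_inv(2)]) (auto simp: numeral_3_eq_3)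
  have b: "realizes (Node (Node Leaf Leaf) ?K) (Node (Node Leaf Leaf) ?K) (br X X \<boxtimes> \<i> (pow ?K))
      (sigma (m + 3) 1)"
    by (rule realizes_cong[OF realizes_tensor[OF realizes_crossing realizes_ident]])
      (auto simp: sigma_def numeral_3_eq_3)
  have c: "realizes (Node (Node Leaf Leaf) ?K) (Node Leaf (Node Leaf ?K)) (\<a> X X (pow ?K))
      (\<lambda>Y. \<i> (tower (m + 3) Y))"
    using realizes_assoc[of Leaf Leaf ?K] by (auto simp: numeral_3_eq_3)
  have d: "realizes (Node Leaf (Node Leaf ?K)) (Node Leaf (Node ?K Leaf)) (\<i> X \<boxtimes> br X (pow ?K))
      (\<lambda>Y. tower_arr 1 (?E Y))"
    using realizesD(5-7)[OF Suc]
    by (intro realizes_cong[OF realizes_tensor[OF realizes_ident[of Leaf, simplified] Suc]])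
      (auto simp: numeral_3_eq_3)
  have e: "realizes (Node Leaf (Node ?K Leaf)) (Node (Node Leaf ?K) Leaf) (inv_arrow C (\<a> X (pow ?K) X))
      (\<lambda>Y. \<i> (tower (m + 3) Y))"
    using realizes_assoc[of Leaf ?K Leaf]
    by (intro realizes_cong[OF realizes_inv(2)]) (auto simp: numeral_3_eq_3)
  have "\<a> X (pow ?K) X \<cdot> (br X (X \<boxdot> pow ?K) \<cdot> \<a> X X (pow ?K))
      = (\<i> X \<boxtimes> br X (pow ?K)) \<cdot> (\<a> X X (pow ?K) \<cdot> (br X X \<boxtimes> \<i> (pow ?K)))"
    by (rule hexagon_right) simp_all
  then have "inv_arrow C (\<a> X (pow ?K) X) \<cdot> ((\<a> X (pow ?K) X \<cdot> (br X (X \<boxdot> pow ?K) \<cdot> \<a> X X (pow ?K)))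
        \<cdot> inv_arrow C (\<a> X X (pow ?K)))
      = inv_arrow C (\<a> X (pow ?K) X) \<cdot> (((\<i> X \<boxtimes> br X (pow ?K)) \<cdot> (\<a> X X (pow ?K) \<cdot> (br X X \<boxtimes> \<i> (pow ?K))))
        \<cdot> inv_arrow C (\<a> X X (pow ?K)))" by simp
  \<comment> \<open>The hexagon solved for the longer braiding, as a chain of the five arrows
    realized in \<open>a\<close> to \<open>e\<close>.\<close>
  then have hex: "br X (pow (Node Leaf ?K)) = inv_arrow C (\<a> X (pow ?K) X) \<cdot> ((\<i> X \<boxtimes> br X (pow ?K)) \<cdot>
      (\<a> X X (pow ?K) \<cdot> ((br X X \<boxtimes> \<i> (pow ?K)) \<cdot> inv_arrow C (\<a> X X (pow ?K)))))"
    by simp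
  \<comment> \<open>The strand \<open>X\<close> crosses its nearest neighbour first and composition
    reads from right to left, so index 1 is the last letter of the decreasing word.\<close>
  have split: "rev [1..<Suc m + 2] = map Suc (rev [1..<m + 2]) @ [1]"
    by (simp add: upt_shift rev_map del: upt_Suc)
  show ?case
    unfolding comb.simps(2) hex
  proof (rule realizes_cong[OF realizes_comp[OF realizes_comp[OF realizes_comp[OF realizes_comp[OF a b] c] d] e]])
    fix Y assume Y: "Y \<in> Obj C"
    have "sigma_prod (Suc m + 2) Y (rev [1..<Suc m + 2])
      = sigma_prod (Suc (m + 2)) Y (map Suc (rev [1..<m + 2])) \<cdot> sigma_prod (Suc (m + 2)) Y [1]"
      unfolding split by (subst sigma_prod_append) (use Y in auto)
    also have "\<dots> = tower_arr 1 (?E Y) \<cdot> sigma (m + 3) 1 Y"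
      using tower_arr_sigma_prod[OF Y, of "rev [1..<m + 2]" "m + 2"] Y
      by (simp add: sigma_prod_single numeral_3_eq_3 del: upt_Suc tower_arr.simps)
    finally show "\<i> (tower (m + 3) Y) \<cdot> (tower_arr 1 (?E Y) \<cdot> (\<i> (tower (m + 3) Y) \<cdot>
        (sigma (m + 3) 1 Y \<cdot> \<i> (tower (m + 3) Y))))
      = sigma_prod (Suc m + 2) Y (rev [1..<Suc m + 2])"
      using Y realizesD(5-7)[OF d] by (simp add: numeral_3_eq_3 del: upt_Suc tower_arr.simps)
  qed
qed

text \<open>The other hexagon: here the strand \<open>X\<close> enters from the right, so its first
  crossing has the highest index and the word increases.\<close>

lemma realizes_braid_comb':
  "realizes (Node (comb m) Leaf) (Node Leaf (comb m)) (br (pow (comb m)) X)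
    (\<lambda>Y. sigma_prod (m + 2) Y [1..<m + 2])"
proof (induction m)
  case 0
  then show ?case
    by (auto intro!: realizes_cong[OF realizes_crossing] simp: sigma_prod_def Aut_mult Aut_one
        sigma_def numeral_2_eq_2)
next
  case (Suc m)
  let ?K = "comb m" and ?E = "\<lambda>Y. sigma_prod (m + 2) Y [1..<m + 2]"
  have a: "realizes (Node (Node Leaf ?K) Leaf) (Node Leaf (Node ?K Leaf)) (\<a> X (pow ?K) X)
      (\<lambda>Y. \<i> (tower (m + 3) Y))"
    using realizes_assoc[of Leaf ?K Leaf] by (auto simp: numeral_3_eq_3)
  have b: "realizes (Node Leaf (Node ?K Leaf)) (Node Leaf (Node Leaf ?K)) (\<i> X \<boxtimes> br (pow ?K) X)
      (\<lambda>Y. tower_arr 1 (?E Y))"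
    using realizesD(5-7)[OF Suc]
    by (intro realizes_cong[OF realizes_tensor[OF realizes_ident[of Leaf, simplified] Suc]])
      (auto simp: numeral_3_eq_3)
  have c: "realizes (Node Leaf (Node Leaf ?K)) (Node (Node Leaf Leaf) ?K) (inv_arrow C (\<a> X X (pow ?K)))
      (\<lambda>Y. \<i> (tower (m + 3) Y))"
    using realizes_assoc[of Leaf Leaf ?K]
    by (intro realizes_cong[OF realizes_inv(2)]) (auto simp: numeral_3_eq_3)
  have d: "realizes (Node (Node Leaf Leaf) ?K) (Node (Node Leaf Leaf) ?K) (br X X \<boxtimes> \<i> (pow ?K))
      (sigma (m + 3) 1)"
    by (rule realizes_cong[OF realizes_tensor[OF realizes_crossing realizes_ident]])
      (auto simp: sigma_def numeral_3_eq_3)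
  have e: "realizes (Node (Node Leaf Leaf) ?K) (Node Leaf (Node Leaf ?K)) (\<a> X X (pow ?K))
      (\<lambda>Y. \<i> (tower (m + 3) Y))"
    using realizes_assoc[of Leaf Leaf ?K] by (auto simp: numeral_3_eq_3)
  have "inv_arrow C (\<a> X X (pow ?K)) \<cdot> (br (X \<boxdot> pow ?K) X \<cdot> inv_arrow C (\<a> X (pow ?K) X))
      = (br X X \<boxtimes> \<i> (pow ?K)) \<cdot> (inv_arrow C (\<a> X X (pow ?K)) \<cdot> (\<i> X \<boxtimes> br (pow ?K) X))"
    by (rule hexagon_left) simp_all
  then have "\<a> X X (pow ?K) \<cdot> ((inv_arrow C (\<a> X X (pow ?K)) \<cdot> (br (X \<boxdot> pow ?K) X \<cdot> inv_arrow C (\<a> X (pow ?K) X)))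
        \<cdot> \<a> X (pow ?K) X)
      = \<a> X X (pow ?K) \<cdot> (((br X X \<boxtimes> \<i> (pow ?K)) \<cdot> (inv_arrow C (\<a> X X (pow ?K)) \<cdot> (\<i> X \<boxtimes> br (pow ?K) X)))
        \<cdot> \<a> X (pow ?K) X)" by simp
  then have hex: "br (pow (Node Leaf ?K)) X = \<a> X X (pow ?K) \<cdot> ((br X X \<boxtimes> \<i> (pow ?K)) \<cdot>
      (inv_arrow C (\<a> X X (pow ?K)) \<cdot> ((\<i> X \<boxtimes> br (pow ?K) X) \<cdot> \<a> X (pow ?K) X)))"
    by simp
  have split: "[1..<Suc m + 2] = [1] @ map Suc [1..<m + 2]"
    by (simp add: upt_shift del: upt_Suc)
  show ?case
    unfolding comb.simps(2) hex
  proof (rule realizes_cong[OF realizes_comp[OF realizes_comp[OF realizes_comp[OF realizes_comp[OF a b] c] d] e]])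
    fix Y assume Y: "Y \<in> Obj C"
    have "sigma_prod (Suc m + 2) Y [1..<Suc m + 2]
      = sigma_prod (Suc (m + 2)) Y [1] \<cdot> sigma_prod (Suc (m + 2)) Y (map Suc [1..<m + 2])"
      unfolding split by (subst sigma_prod_append) (use Y in auto)
    also have "\<dots> = sigma (m + 3) 1 Y \<cdot> tower_arr 1 (?E Y)"
      using tower_arr_sigma_prod[OF Y, of "[1..<m + 2]" "m + 2"] Y
      by (simp add: sigma_prod_single numeral_3_eq_3 del: upt_Suc tower_arr.simps)
    finally show "\<i> (tower (m + 3) Y) \<cdot> (sigma (m + 3) 1 Y \<cdot> (\<i> (tower (m + 3) Y) \<cdot>
        (tower_arr 1 (?E Y) \<cdot> \<i> (tower (m + 3) Y))))
      = sigma_prod (Suc m + 2) Y [1..<Suc m + 2]"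
      using Y realizesD(5-7)[OF b] by (simp add: numeral_3_eq_3 del: upt_Suc tower_arr.simps)
  qed
qed

text \<open>Naturality of the braiding with respect to \<open>br X X\<close>.\<close>

lemma yang_baxter:
  assumes Y: "Y \<in> Obj C"
  shows "sigma 3 2 Y \<cdot> (sigma 3 1 Y \<cdot> sigma 3 2 Y) = sigma 3 1 Y \<cdot> (sigma 3 2 Y \<cdot> sigma 3 1 Y)"
proof -
  let ?E = "\<lambda>Y. sigma_prod 3 Y [2, 1]"
  let ?L = "Node Leaf (Node Leaf Leaf)" and ?R = "Node (Node Leaf Leaf) Leaf"
  have "rev [1..<3] = [2, 1 :: nat]" by (simp add: upt_rec)
  then have c: "realizes ?L ?R (br X (X \<boxdot> X)) ?E"
    using realizes_braid_comb[of 1] by (simp add: numeral_3_eq_3 numeral_2_eq_2)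
  have E: "?E Y = sigma 3 2 Y \<cdot> sigma 3 1 Y"
    using sigma_prod_append[OF Y, of "[2]" 3 "[1]"] Y by (simp add: sigma_prod_single)
  have l: "realizes ?L ?L (\<i> X \<boxtimes> br X X) (sigma 3 2)"
    by (rule realizes_cong[OF realizes_tensor[OF realizes_ident[of Leaf, simplified] realizes_crossing]])
      (auto simp: sigma_def numeral_3_eq_3 numeral_2_eq_2)
  have r: "realizes ?R ?R (br X X \<boxtimes> \<i> X) (sigma 3 1)"
    by (rule realizes_cong[OF realizes_tensor[OF realizes_crossing realizes_ident[of Leaf, simplified]]])
      (auto simp: sigma_def numeral_3_eq_3 numeral_2_eq_2)
  have "br X (X \<boxdot> X) \<cdot> (\<i> X \<boxtimes> br X X) = (br X X \<boxtimes> \<i> X) \<cdot> br X (X \<boxdot> X)"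
    using braiding_natural_simp[of "\<i> X" "br X X"] by simp
  from realizes_unique[OF realizes_comp[OF l c, unfolded this] realizes_comp[OF c r] Y]
  show ?thesis unfolding E using Y by simp
qed

end


section \<open>The framed braid relations on towers\<close>

context braided_power
begin

text \<open>With \<open>p\<close> strands to the left and \<open>q\<close> to the right of a block
  of \<open>l\<close>, a local relation need only be checked for the block, over an arbitrary
  base.\<close>

lemma sigma_block:
  assumes "1 \<le> i" "i < l" "p + l + q = m"
  shows "sigma m (p + i) Y = tower_arr p (sigma l i (tower q Y))"
  using assms(3) by (simp add: sigma_tower[OF assms(2)] sigma_shift[OF assms(1)] assms add.assoc trans_less_add1)

lemma delta_block:
  assumes "1 \<le> i" "i \<le> l" "p + l + q = m"
  shows "delta t m (p + i) Y = tower_arr p (delta t l i (tower q Y))"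
  using assms(3) by (simp add: delta_tower[OF assms(2)] delta_shift[OF assms(1)] assms add.assoc trans_le_add1)

text \<open>Naturality of \<open>E\<close> in its base: \<open>g\<close> acts on the base, hence on
  strands to the right of those moved by \<open>E\<close>.\<close>

lemma disjoint_commute:
  assumes "realizes P P h E" "W \<in> Obj C" "g \<in> Arr C" "Dom C g = W" "Cod C g = W"
  shows "tower_arr p (E W) \<cdot> tower_arr (p + leaves P) g = tower_arr (p + leaves P) g \<cdot> tower_arr p (E W)"
  using realizesD(5-7)[OF assms(1,2)] realizes_natural[OF assms(1,3)] assms(2-)
  by (simp add: tower_arr_add flip: tower_arr_comp)

context
  fixes t :: 'a and Y :: 'o and m :: nat
  assumes t: "iso t" "Dom C t = X" "Cod C t = X" and Y: "Y \<in> Obj C"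
begin

lemma sigma_as_tower_arr: "i < m \<Longrightarrow> sigma m i Y = tower_arr (i - 1) (crossing (tower (m - (i + 1)) Y))"
  by (simp add: sigma_def)

lemma sigma_sigma_far:
  assumes "1 \<le> i" "i + 1 < j" "j < m"
  shows "sigma m i Y \<cdot> sigma m j Y = sigma m j Y \<cdot> sigma m i Y"
proof -
  have "sigma m j Y = tower_arr (i + 1) (sigma (m - (i + 1)) (j - (i + 1)) Y)"
    using sigma_block[of "j - (i + 1)" "m - (i + 1)" "i + 1" 0 m Y] assms by simp
  then show ?thesis
    using disjoint_commute[OF realizes_crossing, of "tower (m - (i + 1)) Y"
        "sigma (m - (i + 1)) (j - (i + 1)) Y" "i - 1"] assms Y
    by (simp add: sigma_as_tower_arr)
qed

lemma sigma_delta_far: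
  assumes "1 \<le> i" "i + 1 < j" "j \<le> m"
  shows "sigma m i Y \<cdot> delta t m j Y = delta t m j Y \<cdot> sigma m i Y"
proof -
  have "delta t m j Y = tower_arr (i + 1) (delta t (m - (i + 1)) (j - (i + 1)) Y)"
    using delta_block[of "j - (i + 1)" "m - (i + 1)" "i + 1" 0 m t Y] assms by simp
  then show ?thesis
    using disjoint_commute[OF realizes_crossing, of "tower (m - (i + 1)) Y"
        "delta t (m - (i + 1)) (j - (i + 1)) Y" "i - 1"] assms Y t
    by (simp add: sigma_as_tower_arr)
qed

lemma delta_sigma_far:
  assumes "1 \<le> j" "j < i" "i < m"
  shows "delta t m j Y \<cdot> sigma m i Y = sigma m i Y \<cdot> delta t m j Y"
proof -
  have "sigma m i Y = tower_arr j (sigma (m - j) (i - j) Y)"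
    using sigma_block[of "i - j" "m - j" j 0 m Y] assms by simp
  then show ?thesis
    using disjoint_commute[OF realizes_strand[OF t], of "tower (m - j) Y"
        "sigma (m - j) (i - j) Y" "j - 1"] assms Y
    by (simp add: delta_def)
qed

lemma delta_delta_far:
  assumes "1 \<le> j" "j < i" "i \<le> m"
  shows "delta t m j Y \<cdot> delta t m i Y = delta t m i Y \<cdot> delta t m j Y"
proof -
  have "delta t m i Y = tower_arr j (delta t (m - j) (i - j) Y)"
    using delta_block[of "i - j" "m - j" j 0 m t Y] assms by simp
  moreover have "tower_arr (j - 1) (t \<boxtimes> \<i> (tower (m - j) Y))
      \<cdot> tower_arr (j - 1 + leaves Leaf) (delta t (m - j) (i - j) Y)
    = tower_arr (j - 1 + leaves Leaf) (delta t (m - j) (i - j) Y)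
      \<cdot> tower_arr (j - 1) (t \<boxtimes> \<i> (tower (m - j) Y))"
    by (rule disjoint_commute[OF realizes_strand[OF t]]) (use assms Y t in simp_all)
  ultimately show ?thesis
    using assms by (simp add: delta_def[of t m j Y])
qed

text \<open>Naturality of the braiding in either argument, transported to the tower by
  \<open>realizes_unique\<close>.\<close>

lemma sigma_delta_two:
  assumes W: "W \<in> Obj C"
  shows "sigma 2 1 W \<cdot> delta t 2 1 W = delta t 2 2 W \<cdot> sigma 2 1 W"
    "sigma 2 1 W \<cdot> delta t 2 2 W = delta t 2 1 W \<cdot> sigma 2 1 W"
proof -
  let ?P = "Node Leaf Leaf"
  have d1: "realizes ?P ?P (t \<boxtimes> \<i> X) (delta t 2 1)"
    using realizes_twist_at[OF t, of 1 ?P] by (simp add: numeral_2_eq_2)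
  have d2: "realizes ?P ?P (\<i> X \<boxtimes> t) (delta t 2 2)"
    using realizes_twist_at[OF t, of 2 ?P] by (simp add: numeral_2_eq_2)
  have s: "realizes ?P ?P (br X X) (sigma 2 1)"
    by (rule realizes_cong[OF realizes_crossing]) (simp add: sigma_def)
  have "br X X \<cdot> (t \<boxtimes> \<i> X) = (\<i> X \<boxtimes> t) \<cdot> br X X" "br X X \<cdot> (\<i> X \<boxtimes> t) = (t \<boxtimes> \<i> X) \<cdot> br X X"
    using braiding_natural_simp[of t "\<i> X"] braiding_natural_simp[of "\<i> X" t] t by simp_all
  then show "sigma 2 1 W \<cdot> delta t 2 1 W = delta t 2 2 W \<cdot> sigma 2 1 W"
    "sigma 2 1 W \<cdot> delta t 2 2 W = delta t 2 1 W \<cdot> sigma 2 1 W"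
    using realizes_unique[OF realizes_comp[OF d1 s] _ W] realizes_comp[OF s d2]
      realizes_unique[OF realizes_comp[OF d2 s] _ W] realizes_comp[OF s d1] by simp_all
qed

lemma sigma_delta_near:
  assumes "1 \<le> i" "i < m"
  shows "sigma m i Y \<cdot> delta t m i Y = delta t m (i + 1) Y \<cdot> sigma m i Y"
    "sigma m i Y \<cdot> delta t m (i + 1) Y = delta t m i Y \<cdot> sigma m i Y"
proof -
  let ?W = "tower (m - (i + 1)) Y"
  have e: "sigma m i Y = tower_arr (i - 1) (sigma 2 1 ?W)"
    "delta t m i Y = tower_arr (i - 1) (delta t 2 1 ?W)"
    "delta t m (i + 1) Y = tower_arr (i - 1) (delta t 2 2 ?W)"
    using sigma_block[of 1 2 "i - 1" "m - (i + 1)" m Y] delta_block[of 1 2 "i - 1" "m - (i + 1)" m t Y]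
      delta_block[of 2 2 "i - 1" "m - (i + 1)" m t Y] assms by simp_all
  show "sigma m i Y \<cdot> delta t m i Y = delta t m (i + 1) Y \<cdot> sigma m i Y"
    "sigma m i Y \<cdot> delta t m (i + 1) Y = delta t m i Y \<cdot> sigma m i Y"
    unfolding e using sigma_delta_two[of ?W] Y t by (simp_all flip: tower_arr_comp)
qed

lemma sigma_braid:
  assumes "1 \<le> i" "i + 1 < m"
  shows "sigma m i Y \<cdot> (sigma m (i + 1) Y \<cdot> sigma m i Y)
    = sigma m (i + 1) Y \<cdot> (sigma m i Y \<cdot> sigma m (i + 1) Y)"
proof -
  let ?W = "tower (m - (i + 2)) Y"
  have e: "sigma m i Y = tower_arr (i - 1) (sigma 3 1 ?W)"
    "sigma m (i + 1) Y = tower_arr (i - 1) (sigma 3 2 ?W)"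
    using sigma_block[of 1 3 "i - 1" "m - (i + 2)" m Y] sigma_block[of 2 3 "i - 1" "m - (i + 2)" m Y]
      assms by simp_all
  show ?thesis
    unfolding e using yang_baxter[of ?W] Y by (simp flip: tower_arr_comp)
qed

lemma framed_braid_system_tower:
  "framed_braid_system (tower_aut m Y) m (\<lambda>i. sigma m i Y) (\<lambda>i. delta t m i Y)"
proof -
  interpret group "tower_aut m Y" using Y by (simp add: group_Aut)
  show ?thesis
  proof (unfold_locales, goal_cases)
    case (2 i)
    then show ?case using sigma_braid by (simp add: Aut_mult)
  next
    case (3 i j)
    then show ?case using sigma_sigma_far[of i j] by (simp add: Aut_mult)
  next
    case (5 i j)
    then show ?case using delta_delta_far[of i j] by (simp add: Aut_mult)
  next
    case (6 i j)
    consider "j < i" | "j = i" | "j = i + 1" | "i + 1 < j" by linarith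
    then show ?case
    proof cases
      case 1
      then show ?thesis
        using delta_sigma_far[of j i] 6 by (simp add: Aut_mult transpose_def)
    next
      case 4
      then show ?thesis
        using sigma_delta_far[of i j] 6 by (simp add: Aut_mult transpose_def)
    qed (use sigma_delta_near[of i] 6 in \<open>simp_all add: Aut_mult transpose_def\<close>)
  qed (use Y t in \<open>simp_all add: Aut_carrier\<close>)
qed

end

end


section \<open>The twist of a tensor power and the recovery of arrows from the tower\<close>

locale balanced_power = braided_power C X + balanced_category C \<theta>
  for C :: "('o, 'a, 'c) bmcat_scheme" (structure) and \<theta> :: "'o \<Rightarrow> 'a" and X :: 'o
begin

lemma twist_simps [simp]:
  assumes "A \<in> Obj C"
  shows "iso (\<theta> A)" "Dom C (\<theta> A) = A" "Cod C (\<theta> A) = A"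
  using twist_iso[OF assms] by (simp_all add: Iso_iff)

lemma framed_braid_system:
  "Y \<in> Obj C \<Longrightarrow>
    framed_braid_system (tower_aut m Y) m (\<lambda>i. sigma m i Y) (\<lambda>i. delta (\<theta> X) m i Y)"
  by (rule framed_braid_system_tower) simp_all

lemma realizes_loop:
  "realizes (Node Leaf (comb m)) (Node Leaf (comb m)) (br (pow (comb m)) X \<cdot> br X (pow (comb m)))
    (\<lambda>Y. first_strand_loop (tower_aut (m + 2) Y) (m + 2) (\<lambda>i. sigma (m + 2) i Y))"
proof (rule realizes_cong[OF realizes_comp[OF realizes_braid_comb realizes_braid_comb']])
  fix Y assume Y: "Y \<in> Obj C"
  show "sigma_prod (m + 2) Y [1..<m + 2] \<cdot> sigma_prod (m + 2) Y (rev [1..<m + 2])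
    = first_strand_loop (tower_aut (m + 2) Y) (m + 2) (\<lambda>i. sigma (m + 2) i Y)"
    unfolding first_strand_loop_def map_append[symmetric] sigma_prod_def[symmetric]
    by (rule sigma_prod_append[symmetric]) (use Y in auto)
qed

definition total_twist :: "nat \<Rightarrow> 'o \<Rightarrow> 'a" where
  "total_twist m Y = list_prod (tower_aut m Y) (map (\<lambda>i. delta (\<theta> X) m i Y) [1..<m + 1])
    \<cdot> full_twist (tower_aut m Y) m (\<lambda>i. sigma m i Y)"

text \<open>Splitting the first \<open>delta\<close> off the product and the loop off the full twist
  leaves the total twist of the last \<open>m\<close> strands. The shape is that of
  \<open>twist_tensor\<close> with \<open>X\<close> as first factor, which drives the induction in
  \<open>realizes_twist_comb\<close>.\<close>

lemma total_twist_Suc: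
  assumes Y: "Y \<in> Obj C" and m: "1 \<le> m"
  shows "total_twist (Suc m) Y = delta (\<theta> X) (Suc m) 1 Y \<cdot> (tower_arr 1 (total_twist m Y) \<cdot>
    first_strand_loop (tower_aut (Suc m) Y) (Suc m) (\<lambda>i. sigma (Suc m) i Y))"
proof -
  let ?G = "tower_aut m Y" and ?H = "tower_aut (Suc m) Y"
  let ?s = "\<lambda>i. sigma (Suc m) i Y" and ?t = "\<lambda>i. delta (\<theta> X) (Suc m) i Y"
  interpret G: framed_braid_system ?G m "\<lambda>i. sigma m i Y" "\<lambda>i. delta (\<theta> X) m i Y"
    by (rule framed_braid_system[OF Y])
  interpret H: framed_braid_system ?H "Suc m" ?s ?t
    by (rule framed_braid_system[OF Y])
  interpret h: group_hom ?G ?H "tower_arr 1"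
    by (rule group_hom_tower_arr) (use Y in simp_all)
  have ft: "full_twist ?G m (\<lambda>i. sigma m i Y) \<in> carrier ?G"
    unfolding full_twist_def by (intro G.nat_pow_closed G.sprod_closed) auto
  have dt: "list_prod ?G (map (\<lambda>i. delta (\<theta> X) m i Y) [1..<m + 1]) \<in> carrier ?G"
    using G.t_closed by (intro G.list_prod_closed) auto
  have "tower_arr 1 (list_prod ?G (map (\<lambda>i. delta (\<theta> X) m i Y) [1..<m + 1]))
    = list_prod ?H (map (tower_arr 1) (map (\<lambda>i. delta (\<theta> X) m i Y) [1..<m + 1]))"
    using G.t_closed by (intro h.hom_list_prod) auto
  also have "map (tower_arr 1) (map (\<lambda>i. delta (\<theta> X) m i Y) [1..<m + 1]) = map ?t (map Suc [1..<m + 1])"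
    using delta_shift[of _ m 1 "\<theta> X" Y] by auto
  finally have d: "tower_arr 1 (list_prod ?G (map (\<lambda>i. delta (\<theta> X) m i Y) [1..<m + 1]))
    = list_prod ?H (map ?t (map Suc [1..<m + 1]))" .
  have "[1..<Suc m + 1] = 1 # map Suc [1..<m + 1]"
    using m by (subst upt_conv_Cons) (simp_all add: map_Suc_upt del: upt_Suc)
  then have d': "list_prod ?H (map ?t [1..<Suc m + 1]) = ?t 1 \<cdot> list_prod ?H (map ?t (map Suc [1..<m + 1]))"
    by (simp add: Aut_mult del: upt_Suc)
  have "tower_arr 1 (full_twist ?G m (\<lambda>i. sigma m i Y)) = full_twist ?H m (tower_arr 1 \<circ> (\<lambda>i. sigma m i Y))"
    by (rule h.hom_full_twist) (rule G.s_closed)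
  also have "\<dots> = full_twist ?H m (?s \<circ> Suc)"
    using sigma_shift[of _ m 1 Y] by (intro full_twist_cong) simp
  finally have f: "full_twist ?H (Suc m) ?s = tower_arr 1 (full_twist ?G m (\<lambda>i. sigma m i Y))
      \<cdot> first_strand_loop ?H (Suc m) ?s"
    using H.full_twist_Suc by (simp add: Aut_mult)
  have loop: "first_strand_loop ?H (Suc m) ?s \<in> carrier ?H"
    unfolding first_strand_loop_def map_append[symmetric] by (rule H.sprod_closed) auto
  have tt: "tower_arr 1 (total_twist m Y) = tower_arr 1 (list_prod ?G (map (\<lambda>i. delta (\<theta> X) m i Y) [1..<m + 1]))
     \<cdot> tower_arr 1 (full_twist ?G m (\<lambda>i. sigma m i Y))"
    unfolding total_twist_def using dt ft by (intro tower_arr_comp) (auto simp: Aut_carrier)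
  show ?thesis
    unfolding total_twist_def[of "Suc m"] tt d' f d[symmetric]
    using h.hom_closed[OF dt] h.hom_closed[OF ft] loop H.t_closed[of 1]
    by (simp add: Aut_carrier del: upt_Suc tower_arr.simps)
qed

lemma realizes_twist_comb: "realizes (comb m) (comb m) (\<theta> (pow (comb m))) (total_twist (Suc m))"
proof (induction m)
  case 0
  then show ?case
    by (auto intro!: realizes_cong[OF realizes_strand]
        simp: total_twist_def delta_def full_twist_def Aut_mult Aut_one nat_pow_def)
next
  case (Suc m)
  let ?K = "comb m"
  have tw: "\<theta> (pow (Node Leaf ?K)) = (\<theta> X \<boxtimes> \<theta> (pow ?K)) \<cdot> (br (pow ?K) X \<cdot> br X (pow ?K))"
    by (simp add: twist_tensor)
  show ?case
    unfolding comb.simps(2) tw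
  proof (rule realizes_cong[OF realizes_comp[OF realizes_loop realizes_tensor[OF realizes_strand Suc]]])
    fix Y assume Y: "Y \<in> Obj C"
    let ?L = "first_strand_loop (tower_aut (m + 2) Y) (m + 2) (\<lambda>i. sigma (m + 2) i Y)"
    have "delta (\<theta> X) (Suc (Suc m)) 1 Y = \<theta> X \<boxtimes> \<i> (tower (leaves ?K) Y)"
      by (simp add: delta_def)
    then show "((\<theta> X \<boxtimes> \<i> (tower (leaves ?K) Y)) \<cdot> tower_arr (leaves Leaf) (total_twist (Suc m) Y)) \<cdot> ?L
      = total_twist (Suc (Suc m)) Y"
      using total_twist_Suc[OF Y, of "Suc m"] Y realizesD(5-7)[OF Suc] realizesD(5-7)[OF realizes_loop[of m]]
      by (simp add: numeral_2_eq_2)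
  qed simp_all
qed

definition flatten :: "paren \<Rightarrow> 'a" where
  "flatten P = collect P (unit_obj C) \<cdot> inv_arrow C (runitor C (pow P))"

abbreviation flat :: "nat \<Rightarrow> 'o" where "flat n \<equiv> tower n (unit_obj C)"

lemma flatten_simps [simp]:
  "iso (flatten P)" "Dom C (flatten P) = pow P" "Cod C (flatten P) = flat (leaves P)"
  by (simp_all add: flatten_def)

text \<open>Naturality of the right unitor identifies \<open>h\<close> tensored with the identity of
  the unit object with \<open>h\<close> itself, so the value of \<open>E\<close> at the unit object
  determines \<open>h\<close>.\<close>

lemma realizes_flatten:
  assumes "realizes P P h E"
  shows "h = inv_arrow C (flatten P) \<cdot> (E (unit_obj C) \<cdot> flatten P)"
proof -
  note h = realizesD[OF assms]
  let ?I = "unit_obj C" and ?r = "runitor C (pow P)"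
  have "?r \<cdot> (h \<boxtimes> \<i> ?I) = h \<cdot> ?r"
    using runitor_natural_simp[of h] h by simp
  then have "inv_arrow C ?r \<cdot> ((h \<cdot> ?r) \<cdot> inv_arrow C ?r) = inv_arrow C ?r \<cdot> ((?r \<cdot> (h \<boxtimes> \<i> ?I)) \<cdot> inv_arrow C ?r)"
    by simp
  then have r: "inv_arrow C ?r \<cdot> h = (h \<boxtimes> \<i> ?I) \<cdot> inv_arrow C ?r"
    using h(1-7) by simp
  have "flatten P \<cdot> h = collect P ?I \<cdot> ((h \<boxtimes> \<i> ?I) \<cdot> inv_arrow C ?r)"
    using h(1-7) by (simp add: flatten_def r)
  also have "\<dots> = (collect P ?I \<cdot> (h \<boxtimes> \<i> ?I)) \<cdot> inv_arrow C ?r"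
    using h(1-7) by simp
  also have "\<dots> = E ?I \<cdot> flatten P"
    using h by (simp add: flatten_def)
  finally show ?thesis
    using h(2-4) by (intro comp_eq_iso_left) simp_all
qed

lemma flatten_hom:
  "(\<lambda>f. inv_arrow C (flatten P) \<cdot> (f \<cdot> flatten P)) \<in> hom (Aut C (flat (leaves P))) (Aut C (pow P))"
  by (rule conj_hom) simp_all

text \<open>The realizing family depends neither on \<open>Q\<close> nor on \<open>f\<close> and
  \<open>h\<close>, which makes the existential choice in \<open>canonical_rep\<close>
  harmless.\<close>

lemma realizes_reassoc_conj:
  assumes "reassoc C X P Q f" "braid_at C X i Q h"
  shows "realizes P P (inv_arrow C f \<cdot> (h \<cdot> f)) (sigma (leaves P) i)"
proof -
  have f: "iso f" "realizes P Q f (\<lambda>Y. \<i> (tower (leaves P) Y))"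
    using realizes_reassoc[OF assms(1)] by auto
  have h: "1 \<le> i" "i < leaves Q" "realizes Q Q h (sigma (leaves Q) i)"
    using realizes_braid_at[OF assms(2)] by auto
  have l: "leaves P = leaves Q" using realizesD(1)[OF f(2)] .
  show ?thesis
    by (rule realizes_cong[OF realizes_comp[OF realizes_comp[OF f(2) h(3)] realizes_inv(2)[OF f(2,1)]]])
      (use h l in simp)
qed

end


section \<open>Existence of reassociations and bracketings; the relators in the braid groups\<close>

lemma ex_reassoc_Node_comb: "\<exists>f. reassoc C X (Node (comb p) (comb q)) (comb (Suc (p + q))) f"
proof (induction p)
  case 0
  show ?case by (auto intro: reassoc.ident)
next
  case (Suc p)
  then obtain f where "reassoc C X (Node (comb p) (comb q)) (comb (Suc (p + q))) f" by blast
  from reassoc.comp[OF reassoc.associator reassoc.tensor[OF reassoc.ident this], of Leaf]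
  show ?case by auto
qed

lemma ex_reassoc_comb: "\<exists>f. reassoc C X P (comb (leaves P - 1)) f"
proof (induction P)
  case Leaf
  show ?case by (auto intro: reassoc.ident)
next
  case (Node P Q)
  then obtain f g where "reassoc C X P (comb (leaves P - 1)) f" "reassoc C X Q (comb (leaves Q - 1)) g"
    by blast
  moreover obtain h where "reassoc C X (Node (comb (leaves P - 1)) (comb (leaves Q - 1)))
      (comb (Suc ((leaves P - 1) + (leaves Q - 1)))) h"
    using ex_reassoc_Node_comb[of C X "leaves P - 1" "leaves Q - 1"] by blast
  moreover have "Suc ((leaves P - 1) + (leaves Q - 1)) = leaves (Node P Q) - 1"
    using leaves_pos[of P] leaves_pos[of Q] unfolding leaves.simps by linarith
  ultimately show ?case
    using reassoc.comp[OF reassoc.tensor] by metis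
qed

text \<open>Both bracketings are connected to the comb with the same number of leaves.\<close>

lemma ex_reassoc: "leaves P = leaves Q \<Longrightarrow> \<exists>f. reassoc C X P Q f"
  using ex_reassoc_comb[of C X P] ex_reassoc_comb[of C X Q] reassoc.comp reassoc.inverse by metis

text \<open>The witness puts single leaves before the pair and a comb after it; \<open>n - 3\<close>
  occurs because \<open>comb k\<close> has \<open>k + 1\<close> leaves.\<close>

lemma ex_braid_at:
  assumes "1 \<le> i" "i < n"
  shows "\<exists>Q h. leaves Q = n \<and> braid_at C X i Q h"
  using assms
proof (induction i arbitrary: n rule: dec_induct)
  case base
  show ?case
  proof (cases "n = 2")
    case True
    then show ?thesis
      using braid_at.here[of C X] by (intro exI[of _ "Node Leaf Leaf"]) auto
  next
    case False
    then show ?thesis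
      using braid_at.left[OF braid_at.here[of C X], of "comb (n - 3)"] base
      by (intro exI[of _ "Node (Node Leaf Leaf) (comb (n - 3))"]) auto
  qed
next
  case (step i)
  have "i < n - 1" using step.prems by simp
  then obtain Q h where "leaves Q = n - 1" "braid_at C X i Q h"
    using step.IH by blast
  then show ?case
    using braid_at.right[of C X i Q h Leaf] step.prems by (intro exI[of _ "Node Leaf Q"]) auto
qed

lemma framed_delta_carrier: "framed_delta n i \<in> carrier (framed_braid_group n)"
  using group.is_monoid[OF group_braid_group[of n]]
  by (simp add: framed_braid_group_def semidirect_def framed_delta_def monoid.one_closed)

lemma braid_gen_carrier: "1 \<le> i \<Longrightarrow> i < n \<Longrightarrow> braid_gen n i \<in> carrier (braid_group n)"
  by (simp add: braid_gen_def braid_carrier)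

lemma framed_sigma_carrier: "1 \<le> i \<Longrightarrow> i < n \<Longrightarrow> framed_sigma n i \<in> carrier (framed_braid_group n)"
  using group.is_monoid[OF group_int_power_group[of n]] braid_gen_carrier[of i n]
  by (simp add: framed_braid_group_def semidirect_def framed_sigma_def)

lemma group_hom_snd: "group_hom (framed_braid_group n) (braid_group n) snd"
proof -
  have "snd \<in> hom (framed_braid_group n) (braid_group n)"
    by (rule homI) (auto simp: framed_braid_group_def semidirect_def)
  then show ?thesis
    by (simp add: group_hom_def group_hom_axioms_def group_framed_braid_group group_braid_group)
qed

lemma (in monoid) full_twist_closed:
  "(\<And>i. 1 \<le> i \<Longrightarrow> i < n \<Longrightarrow> s i \<in> carrier G) \<Longrightarrow> full_twist G n s \<in> carrier G"
  unfolding full_twist_def by (intro nat_pow_closed list_prod_closed) auto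

lemma (in monoid) first_strand_loop_closed:
  "(\<And>i. 1 \<le> i \<Longrightarrow> i < n \<Longrightarrow> s i \<in> carrier G) \<Longrightarrow> first_strand_loop G n s \<in> carrier G"
  unfolding first_strand_loop_def by (intro list_prod_closed) auto

lemma first_strand_loop_cong:
  "(\<And>i. 1 \<le> i \<Longrightarrow> i < n \<Longrightarrow> s i = s' i) \<Longrightarrow> first_strand_loop G n s = first_strand_loop G n s'"
  unfolding first_strand_loop_def
  by (rule arg_cong[of _ _ "list_prod G"]) (auto intro!: map_cong)

lemma sphere_relators_carrier: "sphere_relators n \<subseteq> carrier (braid_group n)"
proof -
  interpret group "braid_group n" by (rule group_braid_group)
  show ?thesis
    using full_twist_closed[OF braid_gen_carrier] first_strand_loop_closed[OF braid_gen_carrier]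
    by (auto simp: sphere_relators_def)
qed

context group
begin

text \<open>The relators are written as expressions in arbitrary elements, so that homomorphisms can
  be pushed through them one after another.\<close>

abbreviation total_relator where
  "total_relator n t s \<equiv> list_prod G (map t [1..<n + 1]) \<otimes> full_twist G n s"

abbreviation loop_relator where
  "loop_relator n t s \<equiv> (t 1 [^] (2 :: nat)) \<otimes> first_strand_loop G n s"

end

lemma framed_sphere_relators_eq:
  "framed_sphere_relators n =
    {group.total_relator (framed_braid_group n) n (framed_delta n) (framed_sigma n),
     group.loop_relator (framed_braid_group n) n (framed_delta n) (framed_sigma n)}"
  by (simp only: framed_sphere_relators_def Let_def)

lemma framed_sphere_relators_carrier: "framed_sphere_relators n \<subseteq> carrier (framed_braid_group n)"
proof -
  interpret group "framed_braid_group n" by (rule group_framed_braid_group)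
  have "list_prod (framed_braid_group n) (map (framed_delta n) [1..<n + 1]) \<in> carrier (framed_braid_group n)"
    using framed_delta_carrier by (intro list_prod_closed) auto
  then show ?thesis
    using full_twist_closed[OF framed_sigma_carrier] first_strand_loop_closed[OF framed_sigma_carrier]
      framed_delta_carrier
    by (auto simp: framed_sphere_relators_eq simp del: upt_Suc)
qed

lemma (in group_hom) hom_total_relator:
  assumes "\<And>i. 1 \<le> i \<Longrightarrow> i \<le> n \<Longrightarrow> t i \<in> carrier G" "\<And>i. 1 \<le> i \<Longrightarrow> i < n \<Longrightarrow> s i \<in> carrier G"
  shows "h (G.total_relator n t s) = H.total_relator n (h \<circ> t) (h \<circ> s)"
proof -
  have t: "set (map t [1..<n + 1]) \<subseteq> carrier G" using assms(1) by auto
  show ?thesis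
    using hom_list_prod[OF t] G.list_prod_closed[OF t] hom_full_twist[OF assms(2)]
      G.full_twist_closed[OF assms(2)] by (simp del: upt_Suc)
qed

lemma (in group_hom) hom_loop_relator:
  assumes "t 1 \<in> carrier G" "\<And>i. 1 \<le> i \<Longrightarrow> i < n \<Longrightarrow> s i \<in> carrier G"
  shows "h (G.loop_relator n t s) = H.loop_relator n (h \<circ> t) (h \<circ> s)"
  using assms(1) hom_first_strand_loop[OF assms(2)] G.first_strand_loop_closed[OF assms(2)]
  by (simp add: hom_nat_pow)

text \<open>Forgetting the framing sends each \<open>framed_delta\<close> to the identity, and the
  sphere relators are what remains. This is what makes the projection descend to the
  quotients.\<close>

lemma snd_framed_sphere_relators:
  assumes "x \<in> framed_sphere_relators n"
  shows "snd x \<in> sphere_relators n"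
proof -
  interpret group_hom "framed_braid_group n" "braid_group n" snd by (rule group_hom_snd)
  have s: "snd \<circ> framed_sigma n = braid_gen n" by (auto simp: framed_sigma_def)
  have t: "snd \<circ> framed_delta n = (\<lambda>i. \<one>\<^bsub>braid_group n\<^esub>)" by (auto simp: framed_delta_def)
  have "list_prod (braid_group n) (map (\<lambda>i. \<one>\<^bsub>braid_group n\<^esub>) is) = \<one>\<^bsub>braid_group n\<^esub>" for "is" :: "nat list"
    by (induction "is") auto
  then have "snd (G.total_relator n (framed_delta n) (framed_sigma n)) = full_twist (braid_group n) n (braid_gen n)"
    using hom_total_relator[of n "framed_delta n" "framed_sigma n"] framed_delta_carrier framed_sigma_carrier
      H.full_twist_closed[OF braid_gen_carrier]
    by (simp add: s t del: upt_Suc)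
  moreover have "snd (G.loop_relator n (framed_delta n) (framed_sigma n)) = first_strand_loop (braid_group n) n (braid_gen n)"
    using hom_loop_relator[of "framed_delta n" n "framed_sigma n"] framed_delta_carrier framed_sigma_carrier
      H.first_strand_loop_closed[OF braid_gen_carrier]
    by (simp add: s t)
  ultimately show ?thesis
    using assms unfolding framed_sphere_relators_eq sphere_relators_def by auto
qed

lemma (in group) quotient_map_relator:
  assumes "S \<subseteq> carrier G" "x \<in> S"
  shows "quotient_map G S x = \<one>\<^bsub>quotient_group G S\<^esub>"
proof -
  have "x \<in> normal_closure G S" using assms(2) by (auto simp: normal_closure_def)
  moreover have "subgroup (normal_closure G S) G"
    using normal_closure_normal[OF assms(1)] by (rule normal_imp_subgroup)
  ultimately show ?thesis
    by (simp add: quotient_map_def quotient_group_def FactGroup_def subgroup.rcos_const)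
qed


section \<open>The canonical representation and its values on the relators\<close>

context balanced_power
begin

lemma pow_aut_hom: "group_hom (Aut C (flat (leaves P))) (Aut C (pow P))
    (\<lambda>f. inv_arrow C (flatten P) \<cdot> (f \<cdot> flatten P))"
  using flatten_hom[of P] by (simp add: group_hom_def group_hom_axioms_def group_Aut)

text \<open>The homomorphism is built on the tower over the unit object, where every crossing has a
  definite place without rebracketing, and is then conjugated by \<open>flatten P\<close>.\<close>

theorem ex_canonical_rep: "\<exists>\<rho>. canonical_rep C \<theta> X P \<rho>"
proof -
  let ?n = "leaves P" and ?I = "unit_obj C"
  let ?\<kappa> = "\<lambda>f. inv_arrow C (flatten P) \<cdot> (f \<cdot> flatten P)"
  interpret T: framed_braid_system "Aut C (flat ?n)" ?n "\<lambda>i. sigma ?n i ?I" "\<lambda>i. delta (\<theta> X) ?n i ?I"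
    by (rule framed_braid_system) simp
  obtain \<rho> where \<rho>: "\<rho> \<in> hom (framed_braid_group ?n) (Aut C (flat ?n))"
    "\<And>i. i \<in> {1..?n} \<Longrightarrow> \<rho> (framed_delta ?n i) = delta (\<theta> X) ?n i ?I"
    "\<And>i. i \<in> {1..<?n} \<Longrightarrow> \<rho> (framed_sigma ?n i) = sigma ?n i ?I"
    using T.framed_braid_group_lift by blast
  have "canonical_rep C \<theta> X P (?\<kappa> \<circ> \<rho>)"
    unfolding canonical_rep_def
  proof (intro conjI ballI)
    have "?\<kappa> \<circ> \<rho> \<in> hom (framed_braid_group ?n) (Aut C (pow P))"
      using \<rho>(1) flatten_hom by (rule hom_compose)
    then show "group_hom (framed_braid_group ?n) (Aut C (pow P)) (?\<kappa> \<circ> \<rho>)"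
      by (simp add: group_hom_def group_hom_axioms_def group_framed_braid_group group_Aut)
  next
    fix i assume "i \<in> {1..?n}"
    then show "(?\<kappa> \<circ> \<rho>) (framed_delta ?n i) = twist_at C X (\<theta> X) i P"
      using realizes_flatten[OF conjunct2[OF realizes_twist_at[of "\<theta> X" i P]]] \<rho>(2)[of i] by simp
  next
    fix i assume i: "i \<in> {1..<?n}"
    then obtain Q h where h: "leaves Q = ?n" "braid_at C X i Q h"
      using ex_braid_at[of i ?n C X] by auto
    then obtain f where f: "reassoc C X P Q f" using ex_reassoc[of P Q C X] by auto
    have "(?\<kappa> \<circ> \<rho>) (framed_sigma ?n i) = inv_arrow C f \<cdot> (h \<cdot> f)"
      using realizes_flatten[OF realizes_reassoc_conj[OF f h(2)]] \<rho>(3)[OF i] by simp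
    then show "\<exists>Q f h. reassoc C X P Q f \<and> braid_at C X i Q h \<and>
        (?\<kappa> \<circ> \<rho>) (framed_sigma ?n i) = inv_arrow C f \<cdot> (h \<cdot> f)"
      using f h by blast
  qed
  then show ?thesis by blast
qed

context
  fixes P \<rho> n
  assumes \<rho>: "canonical_rep C \<theta> X P \<rho>" and n: "leaves P = n"
begin

abbreviation (input) conj_flat :: "'a \<Rightarrow> 'a" where
  "conj_flat f \<equiv> inv_arrow C (flatten P) \<cdot> (f \<cdot> flatten P)"

lemma canonical_rep_delta:
  "1 \<le> i \<Longrightarrow> i \<le> n \<Longrightarrow> \<rho> (framed_delta n i) = conj_flat (delta (\<theta> X) n i (unit_obj C))"
  using \<rho> realizes_flatten realizes_twist_at[of "\<theta> X" i P] n by (auto simp: canonical_rep_def)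

lemma canonical_rep_sigma:
  assumes "1 \<le> i" "i < n"
  shows "\<rho> (framed_sigma n i) = conj_flat (sigma n i (unit_obj C))"
proof -
  obtain Q f h where "reassoc C X P Q f" "braid_at C X i Q h"
    "\<rho> (framed_sigma n i) = inv_arrow C f \<cdot> (h \<cdot> f)"
    using \<rho> assms n unfolding canonical_rep_def by fastforce
  then show ?thesis
    using realizes_flatten[OF realizes_reassoc_conj] n by simp
qed

text \<open>On the tower the relator becomes the total twist, which
  \<open>realizes_twist_comb\<close> identifies with the twist for the comb. Naturality of the twist
  along the comparison \<open>?w\<close> carries this over to the bracketing
  \<open>P\<close>.\<close>

lemma canonical_rep_total_relator:
  "\<rho> (group.total_relator (framed_braid_group n) n (framed_delta n) (framed_sigma n)) = \<theta> (pow P)"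
proof -
  let ?I = "unit_obj C" and ?K = "comb (n - 1)"
  let ?s = "\<lambda>i. sigma n i ?I" and ?t = "\<lambda>i. delta (\<theta> X) n i ?I"
  interpret \<rho>: group_hom "framed_braid_group n" "Aut C (pow P)" \<rho>
    using \<rho> n by (simp add: canonical_rep_def)
  interpret \<kappa>: group_hom "Aut C (flat n)" "Aut C (pow P)" conj_flat
    using pow_aut_hom[of P] n by simp
  interpret T: framed_braid_system "Aut C (flat n)" n ?s ?t
    by (rule framed_braid_system) simp
  have K: "Suc (n - 1) = n" using leaves_pos[of P] n by simp
  have "\<rho> (\<rho>.G.total_relator n (framed_delta n) (framed_sigma n))
    = \<rho>.H.total_relator n (\<rho> \<circ> framed_delta n) (\<rho> \<circ> framed_sigma n)"
    by (rule \<rho>.hom_total_relator) (simp_all add: framed_delta_carrier framed_sigma_carrier)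
  also have "\<dots> = \<rho>.H.total_relator n (conj_flat \<circ> ?t) (conj_flat \<circ> ?s)"
    using canonical_rep_delta canonical_rep_sigma
    by (intro arg_cong2[of _ _ _ _ "\<lambda>x y. x \<otimes>\<^bsub>Aut C (pow P)\<^esub> y"] full_twist_cong arg_cong[of _ _ "list_prod (Aut C (pow P))"])
      (auto intro!: map_cong simp del: upt_Suc)
  also have "\<dots> = conj_flat (\<kappa>.G.total_relator n ?t ?s)"
    by (rule \<kappa>.hom_total_relator[symmetric]) (use T.t_closed T.s_closed in auto)
  also have "\<kappa>.G.total_relator n ?t ?s = total_twist n ?I"
    by (simp only: total_twist_def Aut_mult)
  finally have 1: "\<rho> (\<rho>.G.total_relator n (framed_delta n) (framed_sigma n)) = conj_flat (total_twist n ?I)" .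
  have r: "realizes ?K ?K (\<theta> (pow ?K)) (total_twist n)"
    using realizes_twist_comb[of "n - 1"] K by simp
  have tt: "total_twist n ?I \<in> Arr C" "Dom C (total_twist n ?I) = flat n" "Cod C (total_twist n ?I) = flat n"
    using realizesD(5-7)[OF r, of ?I] K by simp_all
  let ?w = "inv_arrow C (flatten ?K) \<cdot> flatten P"
  have w: "iso ?w" "Dom C ?w = pow P" "Cod C ?w = pow ?K" using n K by simp_all
  have "inv_arrow C ?w \<cdot> (\<theta> (pow ?K) \<cdot> ?w)
    = inv_arrow C ?w \<cdot> ((inv_arrow C (flatten ?K) \<cdot> (total_twist n ?I \<cdot> flatten ?K)) \<cdot> ?w)"
    by (simp only: realizes_flatten[OF r, symmetric])
  also have "\<dots> = conj_flat (total_twist n ?I)"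
    using n K tt by simp
  finally have 2: "inv_arrow C ?w \<cdot> (\<theta> (pow ?K) \<cdot> ?w) = conj_flat (total_twist n ?I)" .
  have "\<theta> (pow ?K) \<cdot> ?w = ?w \<cdot> \<theta> (pow P)"
    by (rule twist_natural) (use w in \<open>simp add: Hom_iff\<close>)
  then have "inv_arrow C ?w \<cdot> (\<theta> (pow ?K) \<cdot> ?w) = inv_arrow C ?w \<cdot> (?w \<cdot> \<theta> (pow P))" by simp
  also have "\<dots> = \<theta> (pow P)"
    by (rule inv_reduce(1)) (use w in simp_all)
  finally show ?thesis using 1 2 by simp
qed

text \<open>The first strand has to stand alone, so \<open>P\<close> is compared with
  \<open>X \<boxdot> A\<close>, where \<open>A\<close> is the power for \<open>comb (n - 2)\<close>,
  that is, on the other \<open>n - 1\<close> strands.\<close>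

lemma canonical_rep_loop_relator:
  assumes "n \<ge> 2"
  obtains w A where "iso w" "Dom C w = pow P" "Cod C w = X \<boxdot> A" "A \<in> Obj C"
    and "\<rho> (group.loop_relator (framed_braid_group n) n (framed_delta n) (framed_sigma n))
      = inv_arrow C w \<cdot> (((\<theta> X \<boxtimes> \<i> A) \<cdot> ((\<theta> X \<boxtimes> \<i> A) \<cdot> (br A X \<cdot> br X A))) \<cdot> w)"
proof
  let ?I = "unit_obj C" and ?K = "comb (n - 2)"
  let ?N = "Node Leaf ?K" and ?A = "pow ?K"
  let ?s = "\<lambda>i. sigma n i ?I" and ?t = "\<lambda>i. delta (\<theta> X) n i ?I"
  let ?w = "inv_arrow C (flatten ?N) \<cdot> flatten P"
  have K: "Suc (Suc (n - 2)) = n" "n - 2 + 2 = n" "leaves ?N = n" using assms by simp_all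
  show w: "iso ?w" "Dom C ?w = pow P" "Cod C ?w = X \<boxdot> ?A" using n K by simp_all
  show "?A \<in> Obj C" by simp
  interpret \<rho>: group_hom "framed_braid_group n" "Aut C (pow P)" \<rho>
    using \<rho> n by (simp add: canonical_rep_def)
  interpret \<kappa>: group_hom "Aut C (flat n)" "Aut C (pow P)" conj_flat
    using pow_aut_hom[of P] n by simp
  interpret T: framed_braid_system "Aut C (flat n)" n ?s ?t
    by (rule framed_braid_system) simp
  let ?L = "\<lambda>Y. first_strand_loop (tower_aut n Y) n (\<lambda>i. sigma n i Y)"
  let ?u = "\<lambda>Y. delta (\<theta> X) n 1 Y \<cdot> (delta (\<theta> X) n 1 Y \<cdot> ?L Y)"
  let ?g = "(\<theta> X \<boxtimes> \<i> ?A) \<cdot> ((\<theta> X \<boxtimes> \<i> ?A) \<cdot> (br ?A X \<cdot> br X ?A))"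
  have l: "realizes ?N ?N (br ?A X \<cdot> br X ?A) ?L"
    using realizes_loop[of "n - 2"] unfolding K(2) .
  have d: "realizes ?N ?N (\<theta> X \<boxtimes> \<i> ?A) (delta (\<theta> X) n 1)"
    using realizes_twist_at[of "\<theta> X" 1 ?N] unfolding K(3) using assms by simp
  have r: "realizes ?N ?N ?g ?u"
    by (rule realizes_comp[OF realizes_comp[OF l d] d])
  have u: "?u ?I \<in> Arr C" "Dom C (?u ?I) = flat n" "Cod C (?u ?I) = flat n"
    using realizesD(5-7)[OF r, of ?I] unfolding K(3) by simp_all
  have "\<rho> (\<rho>.G.loop_relator n (framed_delta n) (framed_sigma n))
    = \<rho>.H.loop_relator n (\<rho> \<circ> framed_delta n) (\<rho> \<circ> framed_sigma n)"
    by (rule \<rho>.hom_loop_relator) (simp_all add: framed_delta_carrier framed_sigma_carrier)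
  also have "\<dots> = \<rho>.H.loop_relator n (conj_flat \<circ> ?t) (conj_flat \<circ> ?s)"
    using canonical_rep_delta canonical_rep_sigma assms
    by (intro arg_cong2[of _ _ _ _ "\<lambda>x y. x \<otimes>\<^bsub>Aut C (pow P)\<^esub> y"] first_strand_loop_cong) simp_all
  also have "\<dots> = conj_flat (\<kappa>.G.loop_relator n ?t ?s)"
    by (rule \<kappa>.hom_loop_relator[symmetric]) (use T.t_closed[of 1] T.s_closed assms in auto)
  also have "\<kappa>.G.loop_relator n ?t ?s = ?u ?I"
    using assms realizesD(5-7)[OF l, of ?I] unfolding K(3)
    by (simp add: numeral_2_eq_2 Aut_mult Aut_one)
  also have "conj_flat (?u ?I)
    = inv_arrow C ?w \<cdot> ((inv_arrow C (flatten ?N) \<cdot> (?u ?I \<cdot> flatten ?N)) \<cdot> ?w)"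
    using n K(3) u by (simp del: leaves.simps)
  also have "inv_arrow C (flatten ?N) \<cdot> (?u ?I \<cdot> flatten ?N) = ?g"
    by (rule realizes_flatten[OF r, symmetric])
  finally show "\<rho> (\<rho>.G.loop_relator n (framed_delta n) (framed_sigma n)) = inv_arrow C ?w \<cdot> (?g \<cdot> ?w)" .
qed

end

end


section \<open>Half-balanced contractions\<close>

context half_balanced_contraction
begin

lemma half_twist_simps [simp]:
  assumes "A \<in> Obj C"
  shows "iso (half_twist C A)" "Dom C (half_twist C A) = A" "Cod C (half_twist C A) = star_obj C A"
  using half_twist_iso[OF assms] by (simp_all add: Iso_iff)

declare star_obj_involutive [simp] star_arr_involutive [simp]

lemma star_obj_simp [simp]: "A \<in> Obj C \<Longrightarrow> star_obj C A \<in> Obj C"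
  by (rule star.functor_obj)

lemma twist_total_simps [simp]:
  assumes "A \<in> Obj C"
  shows "iso (twist C A)" "Dom C (twist C A) = A" "Cod C (twist C A) = A"
  using twist_iso[OF assms] by (simp_all add: Iso_iff)

lemma contract_twist:
  assumes "A \<in> Obj C"
  shows "Fa (twist C A) = Ident D (Fo A)"
  using assms contract_half_twist[OF assms] contract_half_twist[of "star_obj C A"] contract_star[OF assms]
  by (simp add: twist_def functor_comp_simp functor_obj)

text \<open>In the naturality square of the half-twist at \<open>f\<close>, both half-twists
  contract to identities.\<close>

lemma contract_star_arr:
  assumes "f \<in> Arr C"
  shows "Fa (star_arr C f) = Fa f"
proof -
  let ?A = "Dom C f" and ?B = "Cod C f"
  have "half_twist C ?B \<cdot>\<^bsub>C\<^esub> f = star_arr C f \<cdot>\<^bsub>C\<^esub> half_twist C ?A"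
    by (rule half_twist_natural) (simp add: assms Hom_iff)
  then have "Fa (half_twist C ?B \<cdot>\<^bsub>C\<^esub> f) = Fa (star_arr C f \<cdot>\<^bsub>C\<^esub> half_twist C ?A)" by simp
  then show ?thesis
    using assms by (simp add: functor_comp_simp contract_half_twist functor_obj contract_star[symmetric])
qed

text \<open>After composition with the braiding of \<open>B\<close> past \<open>A\<close> either
  side contracts to an identity: one as the half-twist of \<open>B \<boxdot> A\<close>, the other by
  \<open>contract_braiding\<close>. The braiding is invertible and cancels.\<close>

lemma contract_half_twists:
  assumes A: "A \<in> Obj C" and B: "B \<in> Obj C"
  shows "Fa (half_twist C A \<boxtimes>\<^bsub>C\<^esub> half_twist C B) = Fa (twist C A \<boxtimes>\<^bsub>C\<^esub> Ident C B)"
proof -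
  let ?b = "braiding C B A"
  let ?h = "half_twist C A \<boxtimes>\<^bsub>C\<^esub> half_twist C B" and ?t = "twist C A \<boxtimes>\<^bsub>C\<^esub> Ident C B"
  have obj: "Fo (star_obj C A \<boxdot>\<^bsub>C\<^esub> star_obj C B) = Fo (A \<boxdot>\<^bsub>C\<^esub> B)"
    using contract_star[of "B \<boxdot>\<^bsub>C\<^esub> A"] contract_swap[OF A B] A B by (simp add: star_tensor_obj)
  have "Fa (?h \<cdot>\<^bsub>C\<^esub> ?b) = Fa (half_twist C (B \<boxdot>\<^bsub>C\<^esub> A))"
    using half_twist_tensor[OF B A] by simp
  also have "\<dots> = Fa (?t \<cdot>\<^bsub>C\<^esub> ?b)"
    using contract_half_twist[of "B \<boxdot>\<^bsub>C\<^esub> A"] contract_braiding[OF B A] A B by simp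
  finally have "Fa ?h \<cdot>\<^bsub>D\<^esub> Fa ?b = Fa ?t \<cdot>\<^bsub>D\<^esub> Fa ?b"
    using A B by (simp add: functor_comp_simp)
  then show ?thesis
    by (rule D.iso_cancel_right[rotated]) (use A B obj in \<open>simp_all add: functor_iso\<close>)
qed

text \<open>
  The half-twist moves the twist from one tensor factor to the other, because the involution
  reverses the factors and is invisible after contraction.
\<close>

lemma contract_twist_swap:
  assumes A: "A \<in> Obj C" and B: "B \<in> Obj C"
  shows "Fa (twist C A \<boxtimes>\<^bsub>C\<^esub> Ident C B) = Fa (Ident C A \<boxtimes>\<^bsub>C\<^esub> twist C B)"
proof -
  let ?s = "star_obj C"
  have tw: "star_arr C (twist C B) = twist C (?s B)"
    using B by (simp add: twist_def star.functor_comp_simp star_half_twist)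
  have "Fa (half_twist C A \<boxtimes>\<^bsub>C\<^esub> half_twist C B)
    = Fa (star_arr C (half_twist C A \<boxtimes>\<^bsub>C\<^esub> half_twist C B))"
    using A B by (simp add: contract_star_arr)
  also have "\<dots> = Fa (half_twist C (?s B) \<boxtimes>\<^bsub>C\<^esub> half_twist C (?s A))"
    using A B by (simp add: star_tensor_arr star_half_twist)
  \<comment> \<open>This is \<open>contract_half_twists\<close> for the starred pair in reversed
    order, so the twist now belongs to \<open>B\<close>.\<close>
  also have "\<dots> = Fa (twist C (?s B) \<boxtimes>\<^bsub>C\<^esub> Ident C (?s A))"
    using A B by (simp add: contract_half_twists)
  also have "\<dots> = Fa (star_arr C (Ident C A \<boxtimes>\<^bsub>C\<^esub> twist C B))"
    using A B by (simp add: star_tensor_arr tw star.functor_ident)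
  also have "\<dots> = Fa (Ident C A \<boxtimes>\<^bsub>C\<^esub> twist C B)"
    using A B by (simp add: contract_star_arr)
  finally show ?thesis
    using A B by (simp add: contract_half_twists)
qed

lemma contract_loop:
  assumes A: "A \<in> Obj C" and B: "B \<in> Obj C"
  shows "Fa ((twist C A \<boxtimes>\<^bsub>C\<^esub> Ident C B) \<cdot>\<^bsub>C\<^esub> ((twist C A \<boxtimes>\<^bsub>C\<^esub> Ident C B) \<cdot>\<^bsub>C\<^esub>
      (braiding C B A \<cdot>\<^bsub>C\<^esub> braiding C A B))) = Ident D (Fo (A \<boxdot>\<^bsub>C\<^esub> B))"
proof -
  let ?l = "twist C A \<boxtimes>\<^bsub>C\<^esub> Ident C B" and ?r = "Ident C A \<boxtimes>\<^bsub>C\<^esub> twist C B"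
  let ?b = "braiding C B A \<cdot>\<^bsub>C\<^esub> braiding C A B"
  have "Fa (?l \<cdot>\<^bsub>C\<^esub> (?l \<cdot>\<^bsub>C\<^esub> ?b)) = Fa ?l \<cdot>\<^bsub>D\<^esub> (Fa ?l \<cdot>\<^bsub>D\<^esub> Fa ?b)"
    using A B by (simp add: functor_comp_simp)
  \<comment> \<open>Only one of the two twists is traded, so that one twist stands on each factor
    and \<open>twist_tensor\<close> applies.\<close>
  also have "\<dots> = Fa ?l \<cdot>\<^bsub>D\<^esub> (Fa ?r \<cdot>\<^bsub>D\<^esub> Fa ?b)"
    by (simp only: contract_twist_swap[OF A B])
  also have "\<dots> = Fa ((?l \<cdot>\<^bsub>C\<^esub> ?r) \<cdot>\<^bsub>C\<^esub> ?b)"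
    using A B by (simp add: functor_comp_simp)
  also have "?l \<cdot>\<^bsub>C\<^esub> ?r = twist C A \<boxtimes>\<^bsub>C\<^esub> twist C B"
    using A B by (simp add: tensor_comp_merge)
  also have "(twist C A \<boxtimes>\<^bsub>C\<^esub> twist C B) \<cdot>\<^bsub>C\<^esub> ?b = twist C (A \<boxdot>\<^bsub>C\<^esub> B)"
    by (rule twist_tensor[OF A B, symmetric])
  finally show ?thesis
    using A B by (simp add: contract_twist)
qed

end

text \<open>The second conjunct speaks of every homomorphism with the prescribed values on
  generators; the existence conjunct keeps it from being vacuous.\<close>

theorem proposition17:
  fixes C :: "('o, 'a) hbmcat" and D :: "('p, 'b) cat"
    and Fo :: "'o \<Rightarrow> 'p" and Fa :: "'a \<Rightarrow> 'b"
    and X :: 'o and n :: nat and P :: paren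
  assumes "half_balanced_category C"
    and "half_balanced_contraction C D Fo Fa"
    and "X \<in> Obj C"
    and "n \<ge> 2"
    and "leaves P = n"
  shows "(\<exists>\<rho>. canonical_rep C (twist C) X P \<rho>) \<and>
    (\<forall>\<rho>. canonical_rep C (twist C) X P \<rho> \<longrightarrow>
       group_hom (framed_braid_group n) (braid_group n) snd \<and>
       group_hom (framed_braid_group n) (Aut C (tensor_power C X P)) \<rho> \<and>
       group_hom (braid_group n) (Gamma0 n) (Gamma0_proj n) \<and>
       group_hom (framed_braid_group n) (framed_Gamma0 n) (framed_Gamma0_proj n) \<and>
       group_hom (Aut C (tensor_power C X P)) (Aut D (Fo (tensor_power C X P))) Fa \<and>
       (\<exists>p r. group_hom (framed_Gamma0 n) (Gamma0 n) p \<and>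
          group_hom (framed_Gamma0 n) (Aut D (Fo (tensor_power C X P))) r \<and>
          (\<forall>g \<in> carrier (framed_braid_group n).
             p (framed_Gamma0_proj n g) = Gamma0_proj n (snd g) \<and>
             r (framed_Gamma0_proj n g) = Fa (\<rho> g))))"
proof -
  interpret F: half_balanced_contraction C D Fo Fa by fact
  interpret T: balanced_power C "twist C" X
    by (intro balanced_power.intro braided_power.intro monoidal_power.intro monoidal_power_axioms.intro
        F.monoidal_category_axioms F.braided_monoidal_category_axioms F.balanced_category_axioms assms(3))
  let ?A = "tensor_power C X P" and ?R = "framed_sphere_relators n"
  have A: "?A \<in> Obj C" by simp
  note snd = group_hom_snd[of n]
  note proj = group.group_hom_quotient_map[OF group_braid_group sphere_relators_carrier, of n]
  note framed_proj = group.group_hom_quotient_map[OF group_framed_braid_group framed_sphere_relators_carrier, of n]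
  note contract = F.Aut_group_hom[OF A]
  have "group_hom (framed_braid_group n) (Gamma0 n) (Gamma0_proj n \<circ> snd)"
    using snd proj by (auto simp: group_hom_def group_hom_axioms_def intro: hom_compose)
  then obtain p where p: "group_hom (framed_Gamma0 n) (Gamma0 n) p"
    "\<And>g. g \<in> carrier (framed_braid_group n) \<Longrightarrow> p (framed_Gamma0_proj n g) = (Gamma0_proj n \<circ> snd) g"
    by (rule group_hom.quotient_lift[OF _ framed_sphere_relators_carrier])
      (use snd_framed_sphere_relators group.quotient_map_relator[OF group_braid_group sphere_relators_carrier]
        in \<open>auto\<close>)
  have "\<exists>r. group_hom (framed_Gamma0 n) (Aut D (Fo ?A)) r \<and>
      (\<forall>g \<in> carrier (framed_braid_group n). r (framed_Gamma0_proj n g) = Fa (\<rho> g))"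
    if \<rho>: "canonical_rep C (twist C) X P \<rho>" for \<rho>
  proof -
    have hom: "group_hom (framed_braid_group n) (Aut C ?A) \<rho>"
      using \<rho> assms(5) by (simp add: canonical_rep_def)
    have "group_hom (framed_braid_group n) (Aut D (Fo ?A)) (Fa \<circ> \<rho>)"
      using hom contract by (auto simp: group_hom_def group_hom_axioms_def intro: hom_compose)
    moreover have "(Fa \<circ> \<rho>) x = \<one>\<^bsub>Aut D (Fo ?A)\<^esub>" if "x \<in> ?R" for x
    proof -
      have "Fa (\<rho> (group.total_relator (framed_braid_group n) n (framed_delta n) (framed_sigma n)))
        = Ident D (Fo ?A)"
        using T.canonical_rep_total_relator[OF \<rho> assms(5)] F.contract_twist[OF A] by simp
      moreover have "Fa (\<rho> (group.loop_relator (framed_braid_group n) n (framed_delta n) (framed_sigma n)))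
        = Ident D (Fo ?A)"
      proof -
        obtain w B where w: "F.iso w" "Dom C w = ?A" "Cod C w = X \<boxdot>\<^bsub>C\<^esub> B" "B \<in> Obj C"
          and rel: "\<rho> (group.loop_relator (framed_braid_group n) n (framed_delta n) (framed_sigma n))
            = inv_arrow C w \<cdot>\<^bsub>C\<^esub> (((twist C X \<boxtimes>\<^bsub>C\<^esub> Ident C B) \<cdot>\<^bsub>C\<^esub> ((twist C X \<boxtimes>\<^bsub>C\<^esub> Ident C B) \<cdot>\<^bsub>C\<^esub>
              (braiding C B X \<cdot>\<^bsub>C\<^esub> braiding C X B))) \<cdot>\<^bsub>C\<^esub> w)"
          using T.canonical_rep_loop_relator[OF \<rho> assms(5,4)] by blast
        let ?g = "(twist C X \<boxtimes>\<^bsub>C\<^esub> Ident C B) \<cdot>\<^bsub>C\<^esub> ((twist C X \<boxtimes>\<^bsub>C\<^esub> Ident C B) \<cdot>\<^bsub>C\<^esub>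
              (braiding C B X \<cdot>\<^bsub>C\<^esub> braiding C X B))"
        have g: "?g \<in> Arr C" "Dom C ?g = X \<boxdot>\<^bsub>C\<^esub> B" "Cod C ?g = X \<boxdot>\<^bsub>C\<^esub> B"
          using w(4) by simp_all
        \<comment> \<open>\<open>Fa w\<close> is never computed: once \<open>?g\<close> has
          contracted to an identity, it cancels against the contraction of the inverse of
          \<open>w\<close>. \<open>comp_assoc_simp\<close> is switched off to keep \<open>?g\<close>
          intact for \<open>contract_loop\<close>.\<close>
        have "Fa (inv_arrow C w \<cdot>\<^bsub>C\<^esub> (?g \<cdot>\<^bsub>C\<^esub> w)) = Fa (inv_arrow C w) \<cdot>\<^bsub>D\<^esub> (Fa ?g \<cdot>\<^bsub>D\<^esub> Fa w)"
          using w g by (simp add: F.functor_comp_simp del: F.comp_assoc_simp)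
        also have "\<dots> = Fa (inv_arrow C w) \<cdot>\<^bsub>D\<^esub> Fa w"
          unfolding F.contract_loop[OF assms(3) w(4)] using w by simp
        also have "\<dots> = Fa (inv_arrow C w \<cdot>\<^bsub>C\<^esub> w)"
          by (rule F.functor_comp_simp[symmetric]) (use w in simp_all)
        also have "\<dots> = Ident D (Fo ?A)"
          using w A by (simp add: F.functor_ident)
        finally show ?thesis unfolding rel .
      qed
      ultimately show ?thesis
        using that unfolding framed_sphere_relators_eq by (auto simp: F.D.Aut_one)
    qed
    ultimately show ?thesis
      using group_hom.quotient_lift[OF _ framed_sphere_relators_carrier, of n "Aut D (Fo ?A)" "Fa \<circ> \<rho>"]
      by (metis comp_apply)
  qed
  note r = this
  show ?thesis
  proof (intro conjI allI impI)
    show "\<exists>\<rho>. canonical_rep C (twist C) X P \<rho>" by (rule T.ex_canonical_rep)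
    fix \<rho> assume \<rho>: "canonical_rep C (twist C) X P \<rho>"
    then show "group_hom (framed_braid_group n) (Aut C ?A) \<rho>"
      using assms(5) by (simp add: canonical_rep_def)
    show "\<exists>p r. group_hom (framed_Gamma0 n) (Gamma0 n) p \<and>
          group_hom (framed_Gamma0 n) (Aut D (Fo ?A)) r \<and>
          (\<forall>g \<in> carrier (framed_braid_group n).
             p (framed_Gamma0_proj n g) = Gamma0_proj n (snd g) \<and>
             r (framed_Gamma0_proj n g) = Fa (\<rho> g))"
      using p(1) p(2)[unfolded comp_apply] r[OF \<rho>] by metis
  qed (rule snd proj framed_proj contract)+
qed

end
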